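(* Let $X$ be a Banach space, let $n=2k$ with $k\in\mathbb{N}$, $k\ge1$, and let $K\subset\mathbb{R}^n$ be compact. Assume $F:\mathbb{R}^n\to X$ is $L^1$-integrable and $k$-times continuously differentiable. If there exist $g\in L^1(\mathbb{R}^n)$ and $\delta>0$ such that $$\sup_{\alpha\in\mathbb{N}_0^n,\ |\alpha|\le k}\ \sup_{x\in K}\ |y|^{-n+k}\,\|\nabla^\alpha F(x+y)\|\le g(y)\quad\text{for all } |y|\ge\delta,$$ then $S_R(F)(x)\to F(x)$ as $R\to\infty$ uniformly in $x\in K$.
   Context: $X$ is a Banach space with complex scalars and norm $\|\cdot\|$. For $L^1$-integrable $F:\mathbb{R}^n\to X$ the Fourier transform is $\hat F(\xi)=\int_{\mathbb{R}^n}e^{-i\xi\cdot s}F(s)\,ds$, and $S_R(F)(x)=\frac{1}{(2\pi)^n}\int_{|\xi|\le R}e^{ix\cdot\xi}\hat F(\xi)\,d\xi$ for $R\ge1$, $x\in\mathbb{R}^n$. For a multi-index $\alpha\in\mathbb{N}_0^n$, $\nabla^\alpha F$ denotes the partial derivative of $F$ of order $\alpha$ (with $\nabla^0F=F$). Convergence is in the norm of $X$. *)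

theory Defs
  imports "HOL-Analysis.Analysis"
begin

section \<open>Complex Banach spaces\<close>

class complex_banach = banach +
  fixes scaleC :: "complex \<Rightarrow> 'a \<Rightarrow> 'a" (infixr \<open>*\<^sub>C\<close> 75)
  assumes scaleC_add_right: "c *\<^sub>C (x + y) = c *\<^sub>C x + c *\<^sub>C y"
    and scaleC_add_left: "(c + d) *\<^sub>C x = c *\<^sub>C x + d *\<^sub>C x"
    and scaleC_scaleC: "c *\<^sub>C d *\<^sub>C x = (c * d) *\<^sub>C x"
    and scaleC_of_real: "of_real r *\<^sub>C x = r *\<^sub>R x"
    and norm_scaleC: "norm (c *\<^sub>C x) = cmod c * norm x"

instantiation complex :: complex_banach
begin

definition scaleC_complex :: "complex \<Rightarrow> complex \<Rightarrow> complex" where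
  "scaleC_complex c x = c * x"

instance
  by standard (simp_all add: scaleC_complex_def distrib_left distrib_right mult.assoc norm_mult
      scaleR_conv_of_real)

end

section \<open>Bochner integral in arbitrary Banach spaces\<close>

text \<open>The library predicate \<^const>\<open>has_bochner_integral\<close> requires a second countable codomain.
  The following is the same definition without that restriction.  The existence of approximating
  simple functions forces \<open>f\<close> to be almost everywhere separably valued.\<close>

definition has_banach_integral ::
    "'s measure \<Rightarrow> ('s \<Rightarrow> 'a::real_normed_vector) \<Rightarrow> 'a \<Rightarrow> bool" where
  "has_banach_integral M f z \<longleftrightarrow>
     f \<in> borel_measurable M \<and>
     (\<exists>s. (\<forall>i. Bochner_Integration.simple_bochner_integrable M (s i)) \<and>
          (\<lambda>i. \<integral>\<^sup>+x. norm (f x - s i x) \<partial>M) \<longlonglongrightarrow> 0 \<and>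
          (\<lambda>i. Bochner_Integration.simple_bochner_integral M (s i)) \<longlonglongrightarrow> z)"

lemma has_banach_integral_iff_has_bochner_integral:
  fixes f :: "'s \<Rightarrow> 'a::{real_normed_vector, second_countable_topology}"
  shows "has_banach_integral M f z \<longleftrightarrow> has_bochner_integral M f z"
  unfolding has_banach_integral_def has_bochner_integral.simps by blast

definition banach_integrable :: "'s measure \<Rightarrow> ('s \<Rightarrow> 'a::real_normed_vector) \<Rightarrow> bool" where
  "banach_integrable M f \<longleftrightarrow> (\<exists>z. has_banach_integral M f z)"

definition banach_integral :: "'s measure \<Rightarrow> ('s \<Rightarrow> 'a::real_normed_vector) \<Rightarrow> 'a" where
  "banach_integral M f =
     (if \<exists>z. has_banach_integral M f z then THE z. has_banach_integral M f z else 0)"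

section \<open>Fourier transform and spherical partial Fourier integrals\<close>

definition fourier :: "(real^'n \<Rightarrow> 'a::complex_banach) \<Rightarrow> real^'n \<Rightarrow> 'a" where
  "fourier F \<xi> = banach_integral lborel (\<lambda>s. exp (- \<i> * of_real (\<xi> \<bullet> s)) *\<^sub>C F s)"

definition fourier_partial :: "real \<Rightarrow> (real^'n \<Rightarrow> 'a::complex_banach) \<Rightarrow> real^'n \<Rightarrow> 'a" where
  "fourier_partial R F x =
     (1 / (2 * pi) ^ CARD('n)) *\<^sub>R
       banach_integral lborel
         (\<lambda>\<xi>. indicator (cball 0 R) \<xi> *\<^sub>R (exp (\<i> * of_real (x \<bullet> \<xi>)) *\<^sub>C fourier F \<xi>))"

section \<open>Partial derivatives\<close>

definition partial :: "'n \<Rightarrow> (real^'n \<Rightarrow> 'a::real_normed_vector) \<Rightarrow> real^'n \<Rightarrow> 'a" where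
  "partial i F x = vector_derivative (\<lambda>t. F (x + t *\<^sub>R axis i 1)) (at 0)"

text \<open>\<open>F\<close> is \<open>k\<close> times continuously differentiable: all iterated partial derivatives, in any order
  of differentiation, of total order at most \<open>k\<close> exist everywhere and are continuous.\<close>

fun C_k :: "nat \<Rightarrow> (real^'n \<Rightarrow> 'a::real_normed_vector) \<Rightarrow> bool" where
  "C_k 0 F \<longleftrightarrow> continuous_on UNIV F"
| "C_k (Suc k) F \<longleftrightarrow> continuous_on UNIV F \<and>
     (\<forall>i. (\<forall>x. (\<lambda>t. F (x + t *\<^sub>R axis i 1)) differentiable (at 0)) \<and> C_k k (partial i F))"

text \<open>A multi-index is a function \<open>\<alpha> :: 'n \<Rightarrow> nat\<close>, of order \<open>sum \<alpha> UNIV\<close>.  The operator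
  \<open>nabla \<alpha>\<close> is the composition of the powers \<open>partial i ^^ \<alpha> i\<close>, with the coordinates taken in one
  fixed enumeration of \<open>'n\<close>; on functions of class \<open>C_k\<close> with \<open>sum \<alpha> UNIV \<le> k\<close> the enumeration
  is irrelevant because mixed partial derivatives commute.\<close>

definition coords :: "'n::finite list" where
  "coords = (SOME js. distinct js \<and> set js = UNIV)"

definition nabla ::
    "('n \<Rightarrow> nat) \<Rightarrow> (real^'n \<Rightarrow> 'a::real_normed_vector) \<Rightarrow> real^'n \<Rightarrow> 'a" where
  "nabla \<alpha> F = foldr (\<lambda>i. partial i ^^ \<alpha> i) coords F"

end

theory Submission
  imports Defs
begin

text \<open>
  Let \<open>n = 2k\<close> be the dimension.  By Fubini, \<open>S\<^sub>R F(x) = \<integral> F(x + z) D\<^sub>R(z) dz\<close>, where \<open>D\<^sub>R\<close>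
  (\<open>ball_kernel R\<close>) is the inverse Fourier transform of the indicator of the ball of radius \<open>R\<close>.
  The kernel is radial: \<open>D\<^sub>R(z) = c R^(2k) P\<^sub>k(R |z|)\<close>, where
  \<open>P\<^sub>m(s) = \<integral>\<^sub>0\<^sup>\<pi> cos(s cos \<theta>) sin^(2m) \<theta> d\<theta>\<close> is a multiple of \<open>s^(-m) J\<^sub>m(s)\<close>
  (\<open>ball_fourier_integral\<close>).  Since \<open>P\<^sub>m' = - s P\<^sub>m\<^sub>+\<^sub>1 / (2m + 1)\<close>, the kernel is obtained,
  up to a constant, from \<open>P\<^sub>0(R r) = \<pi> J\<^sub>0(R r)\<close> by applying \<open>-(1/r) d/dr\<close> exactly \<open>k\<close> times,
  and this is where the even dimension enters.

  In polar coordinates around \<open>x\<close>, the convolution is an average over directions \<open>e\<close> of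
  \<open>\<integral> F(x + t e) D\<^sub>R(t) t^(2k-1) dt\<close>.  Integrating by parts \<open>k\<close> times along the ray
  (\<open>radial_by_parts\<close>) removes all powers of \<open>R\<close>: there remain a boundary term at \<open>0\<close>, which is a
  multiple of \<open>F(x)\<close> and adds up to exactly \<open>F(x)\<close>, and integrals
  \<open>\<integral> J\<^sub>0(R t) t^(j-1) (d/dt)^j F(x + t e) dt\<close> with \<open>1 \<le> j \<le> k\<close>.  For large \<open>t\<close> the factor
  \<open>t^(j-1)\<close> is at most \<open>t^(k-1) = t^(n-1) t^(k-n)\<close>, so that the hypothesis on \<open>F\<close> provides an integrable majorant of
  \<open>t^(j-1) (d/dt)^j F(x + t e)\<close> that does not depend on \<open>x \<in> K\<close>.  As \<open>J\<^sub>0\<close> is bounded and tends to \<open>0\<close> at infinity, they tend to \<open>0\<close> as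
  \<open>R \<rightarrow> \<infinity>\<close> by dominated convergence (\<open>bessel_error_tendsto_0\<close>), uniformly on \<open>K\<close>.
  The boundary terms at a finite radius \<open>T\<close> are dominated by a function of \<open>T\<close> that is integrable near
  infinity, hence they are arbitrarily small for suitable large \<open>T\<close> (\<open>shell_mean_small\<close>).

  The space \<open>X\<close> is reached through real functionals of norm at most one: all of the above is done for the
  scalar functions \<open>\<phi> \<circ> F\<close>, with bounds that do not depend on \<open>\<phi>\<close>, and the Hahn-Banach theorem
  (\<open>norming_functional\<close>) provides a \<open>\<phi>\<close> that attains the norm of \<open>S\<^sub>R F(x) - F(x)\<close>.  The kernel
  being real and even, real-linear functionals suffice although the Fourier transform involves complex
  scalars.
\<close>

section \<open>Norming functionals\<close>

text \<open>A linear functional dominated by the norm is represented by its graph, a subspace of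
  \<open>X \<times> \<real>\<close>.  The domination alone makes such a graph single-valued, so that extending the
  functional is just enlarging a subspace.  This is the one-dimensional extension step of Hahn-Banach: \<open>c\<close> has to lie between
  all \<open>a - \<parallel>y - x\<parallel>\<close> and all \<open>\<parallel>z + x\<parallel> - b\<close>, which is possible by the triangle inequality.\<close>

lemma norm_dominated_extension:
  fixes g :: "('a::real_normed_vector \<times> real) set"
  assumes sub: "subspace g" and dom: "\<And>y a. (y, a) \<in> g \<Longrightarrow> a \<le> norm y"
  obtains g' c where "subspace g'" "g \<subseteq> g'" "(x, c) \<in> g'" "\<And>y a. (y, a) \<in> g' \<Longrightarrow> a \<le> norm y"
proof -
  define L where "L = (\<lambda>(y, a). a - norm (y - x)) ` g"
  define c where "c = Sup L"
  have zero: "(0, 0) \<in> g" using subspace_0[OF sub] by (simp add: zero_prod_def)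
  have key: "a - norm (y - x) \<le> norm (z + x) - b" if "(y, a) \<in> g" "(z, b) \<in> g" for y a z b
  proof -
    have "(y + z, a + b) \<in> g" using subspace_add[OF sub that] by simp
    then have "a + b \<le> norm (y + z)" by (rule dom)
    also have "\<dots> \<le> norm (y - x) + norm (z + x)"
      using norm_triangle_ineq[of "y - x" "z + x"] by simp
    finally show ?thesis by simp
  qed
  have ne: "L \<noteq> {}" using zero by (auto simp: L_def)
  have bdd: "bdd_above L"
    unfolding L_def bdd_above_def using key[OF _ zero] by (auto intro!: exI[of _ "norm (0 + x) - 0"])
  have lower: "a - norm (y - x) \<le> c" if "(y, a) \<in> g" for y a
    unfolding c_def by (rule cSup_upper[OF _ bdd]) (use that in \<open>force simp: L_def\<close>)
  have upper: "c \<le> norm (y + x) - a" if "(y, a) \<in> g" for y a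
    unfolding c_def by (rule cSup_least[OF ne]) (use key[OF _ that] in \<open>auto simp: L_def\<close>)
  define g' where "g' = {(y + t *\<^sub>R x, a + t * c) | y a t. (y, a) \<in> g}"
  have mem: "(y + t *\<^sub>R x, a + t * c) \<in> g'" if "(y, a) \<in> g" for y a t
    using that unfolding g'_def by blast
  have "subspace g'"
    unfolding subspace_def
  proof (intro conjI ballI allI)
    show "0 \<in> g'" using mem[OF zero, of 0] by (simp add: zero_prod_def)
  next
    fix p q assume "p \<in> g'" "q \<in> g'"
    then obtain y a t z b s where *: "(y, a) \<in> g" "(z, b) \<in> g"
      "p = (y + t *\<^sub>R x, a + t * c)" "q = (z + s *\<^sub>R x, b + s * c)" unfolding g'_def by blast
    have "(y + z, a + b) \<in> g" using subspace_add[OF sub *(1,2)] by simp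
    moreover have "p + q = ((y + z) + (t + s) *\<^sub>R x, (a + b) + (t + s) * c)"
      by (simp add: * algebra_simps)
    ultimately show "p + q \<in> g'" unfolding g'_def by blast
  next
    fix r p assume "p \<in> g'"
    then obtain y a t where *: "(y, a) \<in> g" "p = (y + t *\<^sub>R x, a + t * c)" unfolding g'_def by blast
    have "(r *\<^sub>R y, r * a) \<in> g" using subspace_scale[OF sub *(1), of r] by simp
    moreover have "r *\<^sub>R p = (r *\<^sub>R y + (r * t) *\<^sub>R x, r * a + (r * t) * c)"
      by (simp add: * algebra_simps)
    ultimately show "r *\<^sub>R p \<in> g'" unfolding g'_def by blast
  qed
  moreover have "g \<subseteq> g'"
  proof
    fix p assume "p \<in> g"
    then show "p \<in> g'" using mem[of "fst p" "snd p" 0] by simp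
  qed
  moreover have "(x, c) \<in> g'" using mem[OF zero, of 1] by simp
  moreover have "e \<le> norm z" if "(z, e) \<in> g'" for z e
  proof -
    obtain y a t where *: "(y, a) \<in> g" "z = y + t *\<^sub>R x" "e = a + t * c"
      using \<open>(z, e) \<in> g'\<close> unfolding g'_def by blast
    have sc: "(r *\<^sub>R y, r * a) \<in> g" for r using subspace_scale[OF sub *(1), of r] by simp
    consider "t = 0" | "t > 0" | "t < 0" by linarith
    then show ?thesis
    proof cases
      case 1 then show ?thesis using dom[OF *(1)] * by simp
    next
      case 2
      have "t * c \<le> t * (norm ((1/t) *\<^sub>R y + x) - (1/t) * a)"
        using upper[OF sc[of "1/t"]] 2 by (intro mult_left_mono) auto
      also have "\<dots> = norm (t *\<^sub>R ((1/t) *\<^sub>R y + x)) - a"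
        using 2 by (simp add: right_diff_distrib del: scaleR_add_right)
      finally show ?thesis using 2 * by (simp add: algebra_simps)
    next
      case 3
      have "(-t) * ((-1/t) * a - norm ((-1/t) *\<^sub>R y - x)) \<le> (-t) * c"
        using lower[OF sc[of "-1/t"]] 3 by (intro mult_left_mono) auto
      moreover have "(-t) * ((-1/t) * a - norm ((-1/t) *\<^sub>R y - x)) = a - norm ((-t) *\<^sub>R ((-1/t) *\<^sub>R y - x))"
        using 3 by (simp add: right_diff_distrib del: scaleR_diff_right)
      moreover have "(-t) *\<^sub>R ((-1/t) *\<^sub>R y - x) = z" using 3 * by (simp add: algebra_simps)
      ultimately have "a - norm z \<le> (-t) * c" by metis
      then show ?thesis using *(3) by simp
    qed
  qed
  ultimately show thesis by (rule that)
qed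

text \<open>The Hahn-Banach theorem in the form used below.  By Zorn's lemma there is a maximal dominated graph
  that contains \<open>(v, \<parallel>v\<parallel>)\<close>, and by the extension step its domain is the whole space.\<close>

theorem norming_functional:
  fixes v :: "'a::real_normed_vector"
  obtains \<phi> :: "'a \<Rightarrow> real"
  where "linear \<phi>" "\<And>x. \<bar>\<phi> x\<bar> \<le> norm x" "\<phi> v = norm v"
proof -
  \<comment> \<open>The dominated graphs through \<open>(v, \<parallel>v\<parallel>)\<close>, ordered by inclusion.\<close>
  define \<A> where "\<A> = {g :: ('a \<times> real) set. subspace g \<and> (v, norm v) \<in> g \<and> (\<forall>(y, a) \<in> g. a \<le> norm y)}"
  have "range (\<lambda>t. (t *\<^sub>R v, t * norm v)) \<in> \<A>"
  proof -
    have "range (\<lambda>t. (t *\<^sub>R v, t * norm v)) = range (\<lambda>t. t *\<^sub>R (v, norm v))" by simp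
    moreover have "subspace (range (\<lambda>t. t *\<^sub>R (v, norm v)))"
      by (metis span_singleton subspace_span)
    moreover have "(v, norm v) \<in> range (\<lambda>t. (t *\<^sub>R v, t * norm v))"
      by (rule image_eqI[of _ _ 1]) auto
    moreover have "t * norm v \<le> norm (t *\<^sub>R v)" for t by (simp add: mult_right_mono)
    ultimately show ?thesis unfolding \<A>_def by auto
  qed
  then have "\<A> \<noteq> {}" by blast
  moreover have "\<Union>C \<in> \<A>" if C: "C \<noteq> {}" "subset.chain \<A> C" for C
  proof -
    have mem: "\<And>g. g \<in> C \<Longrightarrow> g \<in> \<A>" and lin: "\<And>g h. g \<in> C \<Longrightarrow> h \<in> C \<Longrightarrow> g \<subseteq> h \<or> h \<subseteq> g"
      using C(2) by (auto simp: subset_chain_def)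
    have "subspace (\<Union>C)"
      unfolding subspace_def
    proof (intro conjI ballI allI)
      show "0 \<in> \<Union>C" using C(1) mem by (auto simp: \<A>_def subspace_def)
    next
      fix p q assume "p \<in> \<Union>C" "q \<in> \<Union>C"
      then obtain g h where "g \<in> C" "h \<in> C" "p \<in> g" "q \<in> h" by blast
      with lin[of g h] obtain k where "k \<in> C" "p \<in> k" "q \<in> k" by blast
      then show "p + q \<in> \<Union>C" using mem[of k] by (auto simp: \<A>_def subspace_def)
    next
      fix r p assume "p \<in> \<Union>C"
      then obtain h where "h \<in> C" "p \<in> h" by blast
      then have "r *\<^sub>R p \<in> h" using mem[of h] by (auto simp: \<A>_def subspace_def)
      then show "r *\<^sub>R p \<in> \<Union>C" using \<open>h \<in> C\<close> by blast
    qed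
    then show ?thesis using C(1) mem unfolding \<A>_def by blast
  qed
  ultimately obtain g where g: "g \<in> \<A>" and max: "\<And>h. h \<in> \<A> \<Longrightarrow> g \<subseteq> h \<Longrightarrow> h = g"
    using subset_Zorn_nonempty[of \<A>] by blast
  have sub: "subspace g" and vg: "(v, norm v) \<in> g" and dom: "\<And>y a. (y, a) \<in> g \<Longrightarrow> a \<le> norm y"
    using g by (auto simp: \<A>_def)
  have total: "\<exists>a. (x, a) \<in> g" for x
  proof -
    obtain g' c where "subspace g'" "g \<subseteq> g'" "(x, c) \<in> g'" "\<And>y a. (y, a) \<in> g' \<Longrightarrow> a \<le> norm y"
      using norm_dominated_extension[OF sub dom] by blast
    moreover from this have "g' \<in> \<A>" using vg by (auto simp: \<A>_def)
    ultimately show ?thesis using max by blast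
  qed
  have single: "a = b" if "(x, a) \<in> g" "(x, b) \<in> g" for x a b
  proof -
    have "(0, a - b) \<in> g" "(0, b - a) \<in> g"
      using subspace_diff[OF sub that] subspace_diff[OF sub that(2,1)] by simp_all
    then show ?thesis using dom[of 0 "a - b"] dom[of 0 "b - a"] by simp
  qed
  define \<phi> where "\<phi> x = (THE a. (x, a) \<in> g)" for x
  have \<phi>: "(x, a) \<in> g \<longleftrightarrow> \<phi> x = a" for x a
    unfolding \<phi>_def using total single by (metis theI')
  have lin: "linear \<phi>"
  proof
    fix x y r
    show "\<phi> (x + y) = \<phi> x + \<phi> y"
      using subspace_add[OF sub, of "(x, \<phi> x)" "(y, \<phi> y)"] by (simp add: \<phi>)
    show "\<phi> (r *\<^sub>R x) = r *\<^sub>R \<phi> x"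
      using subspace_scale[OF sub, of "(x, \<phi> x)" r] by (simp add: \<phi>)
  qed
  moreover have "\<bar>\<phi> x\<bar> \<le> norm x" for x
    using dom[of x "\<phi> x"] dom[of "- x" "\<phi> (- x)"] linear_neg[OF lin, of x] by (auto simp: \<phi>)
  moreover have "\<phi> v = norm v" using vg \<phi> by simp
  ultimately show thesis by (rule that)
qed

section \<open>Banach-valued integrals\<close>

abbreviation "simple_integrable \<equiv> Bochner_Integration.simple_bochner_integrable"
abbreviation "simple_integral_of \<equiv> Bochner_Integration.simple_bochner_integral"

text \<open>In a space without countable base the difference of two measurable functions need not be measurable.
  If one of them takes finitely many values, the distance can be written as a finite sum.\<close>

lemma borel_measurable_norm_diff_simple:
  fixes f s :: "'s \<Rightarrow> 'a::real_normed_vector"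
  assumes f[measurable]: "f \<in> borel_measurable M" and s: "simple_function M s"
  shows "(\<lambda>x. norm (f x - s x)) \<in> borel_measurable M"
proof -
  have [measurable]: "s -` {v} \<inter> space M \<in> sets M" for v
    using s by (rule simple_functionD)
  have "(\<lambda>x. \<Sum>v\<in>s ` space M. indicator (s -` {v} \<inter> space M) x * norm (f x - v)) \<in> borel_measurable M"
    by (intro borel_measurable_sum borel_measurable_times borel_measurable_indicator
        borel_measurable_norm measurable_compose[OF f] borel_measurable_continuous_onI continuous_intros) auto
  also have "?this \<longleftrightarrow> ?thesis"
  proof (rule measurable_cong)
    fix x assume x: "x \<in> space M"
    have "(\<Sum>v\<in>s ` space M. indicator (s -` {v} \<inter> space M) x * norm (f x - v)) =
       (\<Sum>v\<in>{s x}. indicator (s -` {v} \<inter> space M) x * norm (f x - v))"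
      by (intro sum.mono_neutral_right) (use s x in \<open>auto simp: simple_function_def indicator_def\<close>)
    then show "(\<Sum>v\<in>s ` space M. indicator (s -` {v} \<inter> space M) x * norm (f x - v)) = norm (f x - s x)"
      using x by simp
  qed
  finally show ?thesis .
qed

lemma simple_integrable_norm_finite:
  fixes s :: "'s \<Rightarrow> 'a::real_normed_vector"
  assumes "simple_integrable M s"
  shows "(\<integral>\<^sup>+x. norm (s x) \<partial>M) < \<infinity>"
proof -
  have "simple_integrable M (\<lambda>x. norm (s x))"
    using simple_bochner_integrable_compose2[of "\<lambda>x _. norm x" M s s] assms by simp
  then show ?thesis
    using simple_bochner_integral_eq_nn_integral[of M "\<lambda>x. norm (s x)"]
    by (metis ennreal_less_top infinity_ennreal_def norm_ge_zero)
qed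

lemma banach_integrable_norm_finite:
  assumes "banach_integrable M f"
  shows "(\<integral>\<^sup>+x. norm (f x) \<partial>M) < \<infinity>"
proof -
  obtain s where f: "f \<in> borel_measurable M"
    and s: "\<And>i. simple_integrable M (s i)"
    and lim: "(\<lambda>i. \<integral>\<^sup>+x. norm (f x - s i x) \<partial>M) \<longlonglongrightarrow> 0"
    using assms by (auto simp: banach_integrable_def has_banach_integral_def)
  obtain i where i: "(\<integral>\<^sup>+x. norm (f x - s i x) \<partial>M) < \<infinity>"
    using order_tendstoD(2)[OF lim, of \<infinity>] by (auto simp: eventually_sequentially)
  have sf: "simple_function M (s i)" using s by (auto elim: simple_bochner_integrable.cases)
  have [measurable]: "(\<lambda>x. norm (f x - s i x)) \<in> borel_measurable M"
    by (rule borel_measurable_norm_diff_simple[OF f sf])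
  have [measurable]: "(\<lambda>x. norm (s i x)) \<in> borel_measurable M"
    using borel_measurable_simple_function[OF simple_function_compose1[OF sf, of norm]] .
  have "(\<integral>\<^sup>+x. norm (f x) \<partial>M) \<le> (\<integral>\<^sup>+x. ennreal (norm (f x - s i x)) + ennreal (norm (s i x)) \<partial>M)"
    by (intro nn_integral_mono) (metis ennreal_leI ennreal_plus norm_ge_zero norm_triangle_sub add.commute)
  also have "\<dots> = (\<integral>\<^sup>+x. norm (f x - s i x) \<partial>M) + (\<integral>\<^sup>+x. norm (s i x) \<partial>M)"
    by (rule nn_integral_add) auto
  also have "\<dots> < \<infinity>" using i simple_integrable_norm_finite[OF s] by simp
  finally show ?thesis .
qed

lemma banach_integrableI_simple_approx:
  fixes f :: "'s \<Rightarrow> 'a::banach"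
  assumes f: "f \<in> borel_measurable M"
    and s: "\<And>i. simple_integrable M (s i)"
    and lim: "(\<lambda>i. \<integral>\<^sup>+x. norm (f x - s i x) \<partial>M) \<longlonglongrightarrow> 0"
  shows "banach_integrable M f"
proof -
  let ?I = "\<lambda>i. simple_integral_of M (s i)"
  have sf: "simple_function M (s i)" for i using s by (auto elim: simple_bochner_integrable.cases)
  have [measurable]: "(\<lambda>x. norm (f x - s i x)) \<in> borel_measurable M" for i
    by (rule borel_measurable_norm_diff_simple[OF f sf])
  have dist: "ennreal (dist (?I i) (?I j)) \<le> (\<integral>\<^sup>+x. norm (f x - s i x) \<partial>M) + (\<integral>\<^sup>+x. norm (f x - s j x) \<partial>M)" for i j
  proof -
    have d: "simple_integrable M (\<lambda>x. s i x - s j x)"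
      by (rule simple_bochner_integrable_compose2[OF _ s s]) simp
    have nd: "simple_integrable M (\<lambda>x. norm (s i x - s j x))"
      by (rule simple_bochner_integrable_compose2[OF _ s s]) simp
    have "ennreal (dist (?I i) (?I j)) = norm (simple_integral_of M (\<lambda>x. s i x - s j x))"
      by (simp add: dist_norm simple_bochner_integral_diff[OF s s])
    also have "\<dots> \<le> simple_integral_of M (\<lambda>x. norm (s i x - s j x))"
      by (intro ennreal_leI simple_bochner_integral_norm_bound d)
    also have "\<dots> = (\<integral>\<^sup>+x. norm (s i x - s j x) \<partial>M)"
      by (rule simple_bochner_integral_eq_nn_integral[OF nd]) simp
    also have "\<dots> \<le> (\<integral>\<^sup>+x. ennreal (norm (f x - s i x)) + ennreal (norm (f x - s j x)) \<partial>M)"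
      by (intro nn_integral_mono)
         (metis dual_order.refl norm_diff_triangle_le norm_minus_commute ennreal_leI ennreal_plus norm_ge_zero)
    also have "\<dots> = (\<integral>\<^sup>+x. norm (f x - s i x) \<partial>M) + (\<integral>\<^sup>+x. norm (f x - s j x) \<partial>M)"
      by (rule nn_integral_add) auto
    finally show ?thesis .
  qed
  have "Cauchy ?I"
  proof (rule metric_CauchyI)
    fix e :: real assume e: "e > 0"
    have "eventually (\<lambda>i. (\<integral>\<^sup>+x. norm (f x - s i x) \<partial>M) < ennreal (e/2)) sequentially"
      by (rule order_tendstoD(2)[OF lim]) (use e in simp)
    then obtain N where N: "\<And>i. i \<ge> N \<Longrightarrow> (\<integral>\<^sup>+x. norm (f x - s i x) \<partial>M) < ennreal (e/2)"
      by (auto simp: eventually_sequentially)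
    have "dist (?I i) (?I j) < e" if "i \<ge> N" "j \<ge> N" for i j
    proof -
      have "ennreal (dist (?I i) (?I j)) < ennreal (e/2) + ennreal (e/2)"
        using dist[of i j] add_strict_mono[OF N[OF that(1)] N[OF that(2)]] by (rule le_less_trans)
      also have "\<dots> = ennreal e" using e by (simp flip: ennreal_plus)
      finally show ?thesis using e by (simp add: ennreal_less_iff)
    qed
    then show "\<exists>N. \<forall>i\<ge>N. \<forall>j\<ge>N. dist (?I i) (?I j) < e" by blast
  qed
  then obtain z where "?I \<longlonglongrightarrow> z" using Cauchy_convergent convergent_def by blast
  then show ?thesis
    unfolding banach_integrable_def has_banach_integral_def using f s lim by blast
qed

lemma bounded_linear_functional:
  fixes \<phi> :: "'a::real_normed_vector \<Rightarrow> real"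
  assumes "linear \<phi>" "\<And>v. \<bar>\<phi> v\<bar> \<le> C * norm v"
  shows "bounded_linear \<phi>"
  using assms by (intro bounded_linear_intro[of _ C]) (auto simp: linear_add linear_scale mult.commute)

text \<open>Functionals turn Banach-valued integrals into Lebesgue integrals.  Together with
  \<open>norming_functional\<close> this yields uniqueness and the norm bound for the integral.\<close>

lemma has_banach_integral_functional:
  fixes \<phi> :: "'a::real_normed_vector \<Rightarrow> real"
  assumes int: "has_banach_integral M f z" and \<phi>: "linear \<phi>" "\<And>v. \<bar>\<phi> v\<bar> \<le> C * norm v"
  shows "has_bochner_integral M (\<lambda>x. \<phi> (f x)) (\<phi> z)"
proof -
  have bl: "bounded_linear \<phi>"
    using \<phi> by (rule bounded_linear_functional)
  obtain s where f: "f \<in> borel_measurable M"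
    and s: "\<And>i. simple_integrable M (s i)"
    and lim: "(\<lambda>i. \<integral>\<^sup>+x. norm (f x - s i x) \<partial>M) \<longlonglongrightarrow> 0"
    and lim2: "(\<lambda>i. simple_integral_of M (s i)) \<longlonglongrightarrow> z"
    using int by (auto simp: has_banach_integral_def)
  have sf: "simple_function M (s i)" for i using s by (auto elim: simple_bochner_integrable.cases)
  have [measurable]: "(\<lambda>x. norm (f x - s i x)) \<in> borel_measurable M" for i
    by (rule borel_measurable_norm_diff_simple[OF f sf])
  show ?thesis
  proof (rule has_bochner_integral.intros)
    show "(\<lambda>x. \<phi> (f x)) \<in> borel_measurable M"
      by (rule measurable_compose[OF f])
        (intro borel_measurable_continuous_onI bounded_linear.continuous_on[OF bl] continuous_on_id)
    show "simple_integrable M (\<lambda>x. \<phi> (s i x))" for i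
      using simple_bochner_integrable_compose2[of "\<lambda>x _. \<phi> x" M "s i" "s i"] s linear_0[OF \<phi>(1)] by simp
    show "(\<lambda>i. simple_integral_of M (\<lambda>x. \<phi> (s i x))) \<longlonglongrightarrow> \<phi> z"
      using bounded_linear.tendsto[OF bl lim2] by (simp add: simple_bochner_integral_linear[OF \<phi>(1) s])
    show "(\<lambda>i. \<integral>\<^sup>+ x. ennreal (norm (\<phi> (f x) - \<phi> (s i x))) \<partial>M) \<longlonglongrightarrow> 0"
    proof (rule tendsto_sandwich[OF _ _ tendsto_const])
      show "(\<lambda>i. \<bar>C\<bar> * (\<integral>\<^sup>+x. norm (f x - s i x) \<partial>M)) \<longlonglongrightarrow> 0"
        using ennreal_tendsto_cmult[OF _ lim, of "\<bar>C\<bar>"] by simp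
      show "\<forall>\<^sub>F i in sequentially. (\<integral>\<^sup>+ x. ennreal (norm (\<phi> (f x) - \<phi> (s i x))) \<partial>M) \<le>
         \<bar>C\<bar> * (\<integral>\<^sup>+x. norm (f x - s i x) \<partial>M)"
      proof (intro always_eventually allI)
        fix i
        have "(\<integral>\<^sup>+ x. ennreal (norm (\<phi> (f x) - \<phi> (s i x))) \<partial>M) \<le> (\<integral>\<^sup>+x. ennreal \<bar>C\<bar> * norm (f x - s i x) \<partial>M)"
        proof (rule nn_integral_mono)
          fix x
          have "\<bar>\<phi> (f x - s i x)\<bar> \<le> C * norm (f x - s i x)" by (rule \<phi>(2))
          also have "\<dots> \<le> \<bar>C\<bar> * norm (f x - s i x)" by (intro mult_right_mono) auto
          finally show "ennreal (norm (\<phi> (f x) - \<phi> (s i x))) \<le> ennreal \<bar>C\<bar> * ennreal (norm (f x - s i x))"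
            by (simp add: linear_diff[OF \<phi>(1)] ennreal_leI flip: ennreal_mult)
        qed
        also have "\<dots> = \<bar>C\<bar> * (\<integral>\<^sup>+x. norm (f x - s i x) \<partial>M)" by (rule nn_integral_cmult) auto
        finally show "(\<integral>\<^sup>+ x. ennreal (norm (\<phi> (f x) - \<phi> (s i x))) \<partial>M) \<le>
         \<bar>C\<bar> * (\<integral>\<^sup>+x. norm (f x - s i x) \<partial>M)" .
      qed
    qed simp
  qed
qed

lemma has_banach_integral_unique:
  fixes f :: "'s \<Rightarrow> 'a::real_normed_vector"
  assumes "has_banach_integral M f z" "has_banach_integral M f w"
  shows "z = w"
proof -
  obtain \<phi> where \<phi>: "linear \<phi>" "\<And>x. \<bar>\<phi> x\<bar> \<le> norm x" "\<phi> (z - w) = norm (z - w)"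
    using norming_functional[of "z - w"] by blast
  have "has_bochner_integral M (\<lambda>x. \<phi> (f x)) (\<phi> z)" "has_bochner_integral M (\<lambda>x. \<phi> (f x)) (\<phi> w)"
    using has_banach_integral_functional[OF assms(1) \<phi>(1), of 1]
      has_banach_integral_functional[OF assms(2) \<phi>(1), of 1] \<phi>(2) by simp_all
  then have "\<phi> z = \<phi> w" by (rule has_bochner_integral_eq)
  then show ?thesis using \<phi>(3) linear_diff[OF \<phi>(1)] by simp
qed

lemma banach_integral_functional:
  fixes \<phi> :: "'a::real_normed_vector \<Rightarrow> real"
  assumes "banach_integrable M f" "linear \<phi>" "\<And>v. \<bar>\<phi> v\<bar> \<le> C * norm v"
  shows "integrable M (\<lambda>x. \<phi> (f x))" "\<phi> (banach_integral M f) = (LINT x|M. \<phi> (f x))"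
proof -
  obtain z where z: "has_banach_integral M f z" using assms(1) by (auto simp: banach_integrable_def)
  have "banach_integral M f = z"
    unfolding banach_integral_def using z has_banach_integral_unique by (metis the_equality)
  then show "integrable M (\<lambda>x. \<phi> (f x))" "\<phi> (banach_integral M f) = (LINT x|M. \<phi> (f x))"
    using has_banach_integral_functional[OF z assms(2,3)] by (auto simp: has_bochner_integral_iff)
qed

lemma norm_banach_integral_le:
  fixes f :: "'s \<Rightarrow> 'a::real_normed_vector"
  assumes f: "banach_integrable M f"
  shows "norm (banach_integral M f) \<le> (\<integral>\<^sup>+x. norm (f x) \<partial>M)"
proof -
  obtain \<phi> where \<phi>: "linear \<phi>" "\<And>x. \<bar>\<phi> x\<bar> \<le> norm x"
      "\<phi> (banach_integral M f) = norm (banach_integral M f)"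
    using norming_functional[of "banach_integral M f"] by blast
  have int: "integrable M (\<lambda>x. \<phi> (f x))" "\<phi> (banach_integral M f) = (LINT x|M. \<phi> (f x))"
    using banach_integral_functional[OF f \<phi>(1), of 1] \<phi>(2) by simp_all
  have "ennreal (norm (banach_integral M f)) = ennreal (norm (LINT x|M. \<phi> (f x)))"
    using \<phi>(3) int(2) by (metis abs_norm_cancel real_norm_def)
  also have "\<dots> \<le> (\<integral>\<^sup>+x. norm (\<phi> (f x)) \<partial>M)"
    by (rule has_bochner_integral_norm_bound) (use int in \<open>simp add: has_bochner_integral_iff\<close>)
  also have "\<dots> \<le> (\<integral>\<^sup>+x. norm (f x) \<partial>M)"
    using \<phi>(2) by (intro nn_integral_mono ennreal_leI) simp
  finally show ?thesis .
qed

text \<open>Continuous functions with integrable norm are integrable, whatever the codomain: a compact set has a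
  totally bounded image, so that on the part of \<open>S\<close> in a large ball \<open>f\<close> is uniformly close
  to a simple function, and the integral of \<open>\<parallel>f\<parallel>\<close> outside this ball is small.\<close>

lemma banach_integrable_continuous_on:
  fixes f :: "'s::euclidean_space \<Rightarrow> 'a::banach"
  assumes cont: "continuous_on S f" and S: "closed S"
    and fin: "(\<integral>\<^sup>+x\<in>S. norm (f x) \<partial>lborel) < \<infinity>"
  shows "banach_integrable lborel (\<lambda>x. indicator S x *\<^sub>R f x)"
proof -
  have meas: "(\<lambda>x. indicator S x *\<^sub>R f x) \<in> borel_measurable lborel"
    using borel_measurable_continuous_on_indicator[OF _ cont] S by auto
  have Sm[measurable]: "S \<in> sets borel" using S by simp
  have nm: "(\<lambda>x. norm (f x) * indicator S x) \<in> borel_measurable borel"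
    using measurable_compose[OF meas borel_measurable_norm] by (simp add: mult.commute)
  then have [measurable]: "(\<lambda>x. ennreal (norm (f x)) * indicator S x) \<in> borel_measurable borel"
    by (simp flip: ennreal_indicator ennreal_mult'')
  define B where "B m = cball (0::'s) (real m)" for m
  have [measurable]: "B m \<in> sets borel" for m by (simp add: B_def)
  \<comment> \<open>The accuracy on the ball of radius \<open>m\<close> is chosen such that the error integrates to at most \<open>1 / (m + 1)\<close>.\<close>
  define \<eta> where "\<eta> m = 1 / (real (Suc m) * (1 + measure lborel (B m)))" for m
  have \<eta>pos: "\<eta> m > 0" for m unfolding \<eta>_def
    by (intro divide_pos_pos mult_pos_pos add_pos_nonneg) auto
  have "\<exists>s. simple_integrable lborel s \<and>
      (\<forall>x \<in> S \<inter> B m. norm (f x - s x) \<le> \<eta> m) \<and> (\<forall>x. x \<notin> S \<inter> B m \<longrightarrow> s x = 0)" for m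
  proof -
    let ?C = "f ` (S \<inter> B m)"
    have "compact ?C"
      by (intro compact_continuous_image continuous_on_subset[OF cont])
         (auto simp: B_def closed_Int_compact S)
    then obtain D where D: "finite D" "?C \<subseteq> (\<Union>c\<in>D. ball c (\<eta> m))"
      using compact_eq_totally_bounded \<eta>pos[of m] by metis
    obtain ds where ds: "set ds = D" using finite_list[OF D(1)] by blast
    \<comment> \<open>\<open>pick v\<close> is the first centre in the list that is close to \<open>v\<close>; the default \<open>0\<close> is not taken on the image of the ball.\<close>
    define pick where "pick v = (case List.find (\<lambda>c. dist c v < \<eta> m) ds of None \<Rightarrow> 0 | Some c \<Rightarrow> c)" for v
    have pick_meas: "pick \<in> measurable borel (count_space UNIV)"
      unfolding pick_def[abs_def]
    proof (induction ds)
      case (Cons c ds)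
      have "{v. dist c v < \<eta> m} \<in> sets borel" by (intro borel_open open_Collect_less continuous_intros)
      then show ?case using Cons by (auto simp: if_distrib[where f="\<lambda>x. case x of None \<Rightarrow> _ | Some y \<Rightarrow> _ y"] intro!: measurable_If)
    qed simp
    have pick: "pick v \<in> insert 0 D" "v \<in> ?C \<Longrightarrow> norm (v - pick v) \<le> \<eta> m" for v
    proof -
      have "pick v \<in> insert 0 D \<and> (v \<in> ?C \<longrightarrow> norm (v - pick v) \<le> \<eta> m)"
      proof (cases "List.find (\<lambda>c. dist c v < \<eta> m) ds")
        case None
        then have "v \<notin> ?C" using D(2) ds by (fastforce simp: find_None_iff)
        then show ?thesis using None by (simp add: pick_def)
      next
        case (Some c)
        then have "c \<in> D" "dist c v < \<eta> m" using ds by (auto simp: find_Some_iff)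
        then show ?thesis using Some by (auto simp: pick_def dist_norm norm_minus_commute)
      qed
      then show "pick v \<in> insert 0 D" "v \<in> ?C \<Longrightarrow> norm (v - pick v) \<le> \<eta> m" by blast+
    qed
    define s where "s x = (if x \<in> S \<inter> B m then pick (f x) else 0)" for x
    have "simple_function lborel s"
      unfolding simple_function_def
    proof (intro conjI ballI)
      show "finite (s ` space lborel)"
        by (rule finite_subset[of _ "insert 0 D"]) (use pick(1) D(1) in \<open>auto simp: s_def\<close>)
      fix v
      have "s = (\<lambda>x. if x \<in> S \<inter> B m then pick (indicator S x *\<^sub>R f x) else 0)"
        by (auto simp: s_def fun_eq_iff)
      moreover have "\<dots> \<in> measurable lborel (count_space UNIV)"
        using measurable_compose[OF meas pick_meas] by (intro measurable_If) auto
      ultimately have "s \<in> measurable lborel (count_space UNIV)" by simp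
      then show "s -` {v} \<inter> space lborel \<in> sets lborel" by (rule measurable_sets) simp
    qed
    moreover have "emeasure lborel {x \<in> space lborel. s x \<noteq> 0} \<noteq> \<infinity>"
    proof -
      have "emeasure lborel {x \<in> space lborel. s x \<noteq> 0} \<le> emeasure lborel (B m)"
        by (rule emeasure_mono) (auto simp: s_def)
      also have "\<dots> < \<infinity>" unfolding B_def by (rule emeasure_lborel_cball_finite)
      finally show ?thesis by simp
    qed
    ultimately have "simple_integrable lborel s"
      by (rule simple_bochner_integrable.intros)
    then show ?thesis using pick(2) by (intro exI[of _ s]) (auto simp: s_def)
  qed
  then obtain s where s: "\<And>m. simple_integrable lborel (s m)"
    "\<And>m x. x \<in> S \<inter> B m \<Longrightarrow> norm (f x - s m x) \<le> \<eta> m" "\<And>m x. x \<notin> S \<inter> B m \<Longrightarrow> s m x = 0"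
    by metis
  show ?thesis
  proof (rule banach_integrableI_simple_approx[OF meas s(1)])
    let ?t = "\<lambda>m. \<integral>\<^sup>+x. (ennreal (norm (f x)) * indicator S x) * indicator (- B m) x \<partial>lborel"
    have t0: "?t \<longlonglongrightarrow> (\<integral>\<^sup>+x. 0 \<partial>(lborel :: 's measure))"
    proof (rule nn_integral_dominated_convergence[where w="\<lambda>x. ennreal (norm (f x)) * indicator S x"])
      show "AE x in lborel. (\<lambda>m. ennreal (norm (f x)) * indicator S x * indicator (- B m) x) \<longlonglongrightarrow> 0"
      proof (intro AE_I2 tendsto_eventually)
        fix x :: 's
        obtain N :: nat where "norm x \<le> N" using real_arch_simple by blast
        then have "x \<in> B m" if "m \<ge> N" for m using that by (auto simp: B_def)
        then show "\<forall>\<^sub>F m in sequentially. ennreal (norm (f x)) * indicator S x * indicator (- B m) x = 0"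
          unfolding eventually_sequentially by (auto intro!: exI[of _ N])
      qed
    qed (use fin in \<open>auto split: split_indicator\<close>)
    show "(\<lambda>m. \<integral>\<^sup>+x. norm (indicator S x *\<^sub>R f x - s m x) \<partial>lborel) \<longlonglongrightarrow> 0"
    proof (rule tendsto_sandwich[OF _ _ tendsto_const])
      show "(\<lambda>m. ennreal (1 / real (Suc m)) + ?t m) \<longlonglongrightarrow> 0"
        using tendsto_add[OF tendsto_ennrealI[OF LIMSEQ_Suc[OF lim_inverse_n']] t0] by simp
      show "\<forall>\<^sub>F m in sequentially. (\<integral>\<^sup>+x. norm (indicator S x *\<^sub>R f x - s m x) \<partial>lborel)
          \<le> ennreal (1 / real (Suc m)) + ?t m"
      proof (intro always_eventually allI)
        fix m
        have "(\<integral>\<^sup>+x. norm (indicator S x *\<^sub>R f x - s m x) \<partial>lborel)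
          \<le> (\<integral>\<^sup>+x. ennreal (\<eta> m) * indicator (B m) x
               + (ennreal (norm (f x)) * indicator S x) * indicator (- B m) x \<partial>lborel)"
        proof (rule nn_integral_mono)
          fix x
          show "ennreal (norm (indicator S x *\<^sub>R f x - s m x)) \<le> ennreal (\<eta> m) * indicator (B m) x
               + (ennreal (norm (f x)) * indicator S x) * indicator (- B m) x"
            using s(2)[of x m] s(3)[of x m] by (cases "x \<in> S"; cases "x \<in> B m") (auto intro: ennreal_leI)
        qed
        also have "\<dots> = ennreal (\<eta> m) * emeasure lborel (B m) + ?t m"
          by (subst nn_integral_add) (auto simp: nn_integral_cmult)
        also have "ennreal (\<eta> m) * emeasure lborel (B m) = ennreal (\<eta> m * measure lborel (B m))"
          using \<eta>pos[of m] emeasure_lborel_cball_finite[of "0::'s" m]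
          by (simp add: emeasure_eq_ennreal_measure ennreal_mult B_def)
        also have "\<eta> m * measure lborel (B m) \<le> \<eta> m * (1 + measure lborel (B m))"
          using \<eta>pos[of m] by (intro mult_left_mono) auto
        also have "\<dots> = 1 / real (Suc m)"
          unfolding \<eta>_def using measure_nonneg[of lborel "B m"] by (simp add: add_nonneg_eq_0_iff)
        finally show "(\<integral>\<^sup>+x. norm (indicator S x *\<^sub>R f x - s m x) \<partial>lborel)
          \<le> ennreal (1 / real (Suc m)) + ?t m" by (simp add: ennreal_leI add_mono)
      qed
    qed simp
  qed
qed

section \<open>Partial derivatives of functions of class \<open>C_k\<close>\<close>

lemma C_k_continuous: "C_k k F \<Longrightarrow> continuous_on UNIV F"
  by (cases k) auto

text \<open>The defining equation of \<open>C_k\<close> is unfolded by hand, since as a rewrite rule it would replace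
  every regularity assumption by its recursive expansion.\<close>

declare C_k.simps(2) [simp del]

lemma C_k_partial: "C_k (Suc k) F \<Longrightarrow> C_k k (partial i F)"
  by (simp add: C_k.simps(2))

lemma C_k_Suc_imp: "C_k (Suc k) F \<Longrightarrow> C_k k F"
proof (induction k arbitrary: F)
  case (Suc k)
  have "continuous_on UNIV F" "\<And>i x. (\<lambda>t. F (x + t *\<^sub>R axis i 1)) differentiable (at 0)"
    "\<And>i. C_k (Suc k) (partial i F)"
    using Suc.prems C_k.simps(2)[of "Suc k" F] by blast+
  then show ?case using Suc.IH by (simp add: C_k.simps(2))
qed (simp add: C_k.simps(2))

lemma C_k_mono: "C_k k F \<Longrightarrow> j \<le> k \<Longrightarrow> C_k j F"
  by (induction k) (metis le_zero_eq, metis C_k_Suc_imp le_SucE)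

lemma C_k_foldr_partial: "C_k (length is + k) F \<Longrightarrow> C_k k (foldr partial is F)"
proof (induction "is" arbitrary: k)
  case (Cons i "is")
  then have "C_k (Suc k) (foldr partial is F)" by simp
  then show ?case by (simp add: C_k_partial)
qed simp

lemma partial_has_vector_derivative:
  assumes "C_k (Suc k) F"
  shows "((\<lambda>t. F (x + t *\<^sub>R axis i 1)) has_vector_derivative partial i F (x + s *\<^sub>R axis i 1)) (at s)"
proof -
  have "((\<lambda>t. F ((x + s *\<^sub>R axis i 1) + t *\<^sub>R axis i 1)) has_vector_derivative partial i F (x + s *\<^sub>R axis i 1)) (at (s - s))"
    unfolding partial_def using assms by (simp add: vector_derivative_works[symmetric] C_k.simps(2))
  then have "((\<lambda>t. F ((x + s *\<^sub>R axis i 1) + t *\<^sub>R axis i 1)) \<circ> (\<lambda>t. t - s) has_vector_derivative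
     1 *\<^sub>R partial i F (x + s *\<^sub>R axis i 1)) (at s)"
    by (intro vector_diff_chain_at) (auto intro!: derivative_eq_intros)
  then show ?thesis by (simp add: o_def algebra_simps)
qed

lemma partial_has_real_derivative:
  fixes f :: "real^'n \<Rightarrow> real"
  assumes "C_k (Suc k) f"
  shows "((\<lambda>t. f (x + t *\<^sub>R axis i 1)) has_real_derivative partial i f (x + s *\<^sub>R axis i 1)) (at s)"
  using partial_has_vector_derivative[OF assms] by (simp add: has_real_derivative_iff_has_vector_derivative)

lemma partial_bounded_linear:
  assumes "bounded_linear \<phi>" "C_k (Suc k) F"
  shows "partial i (\<lambda>x. \<phi> (F x)) = (\<lambda>x. \<phi> (partial i F x))"
    and "(\<lambda>t. \<phi> (F (x + t *\<^sub>R axis i 1))) differentiable (at 0)"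
proof -
  have *: "((\<lambda>t. \<phi> (F (x + t *\<^sub>R axis i 1))) has_vector_derivative \<phi> (partial i F x)) (at 0)" for x
    using bounded_linear.has_vector_derivative[OF assms(1) partial_has_vector_derivative[OF assms(2), of x i 0]] by simp
  show "partial i (\<lambda>x. \<phi> (F x)) = (\<lambda>x. \<phi> (partial i F x))"
    unfolding partial_def[of i "\<lambda>x. \<phi> (F x)"] using vector_derivative_at[OF *] by blast
  show "(\<lambda>t. \<phi> (F (x + t *\<^sub>R axis i 1))) differentiable (at 0)"
    using * by (rule differentiableI_vector)
qed

lemma C_k_bounded_linear:
  assumes "bounded_linear \<phi>" "C_k k F"
  shows "C_k k (\<lambda>x. \<phi> (F x))"
  using assms(2)
proof (induction k arbitrary: F)
  case 0
  then show ?case using bounded_linear.continuous_on[OF assms(1)] by simp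
next
  case (Suc k)
  then show ?case
    using partial_bounded_linear[OF assms(1) Suc.prems]
      bounded_linear.continuous_on[OF assms(1) C_k_continuous[OF Suc.prems]]
    by (simp add: C_k.simps(2))
qed

lemma foldr_partial_bounded_linear:
  assumes "bounded_linear \<phi>" "C_k (length is) F"
  shows "foldr partial is (\<lambda>x. \<phi> (F x)) = (\<lambda>x. \<phi> (foldr partial is F x))"
  using assms(2)
proof (induction "is")
  case (Cons i "is")
  then have "C_k (Suc 0) (foldr partial is F)" by (intro C_k_foldr_partial) simp
  moreover have "C_k (length is) F" using Cons.prems by (auto intro: C_k_Suc_imp)
  ultimately show ?case using Cons.IH partial_bounded_linear(1)[OF assms(1), of 0 "foldr partial is F" i] by simp
qed simp

text \<open>Continuous partial derivatives imply total differentiability.  One changes the coordinates of the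
  argument one at a time, and the mean value theorem controls each change; the induction is over the set \<open>S\<close> of coordinates
  in which the increment may be nonzero.\<close>

lemma C_k_has_derivative:
  fixes f :: "real^'n \<Rightarrow> real"
  assumes f: "C_k (Suc k) f"
  shows "(f has_derivative (\<lambda>h. \<Sum>i\<in>UNIV. h $ i * partial i f x)) (at x)"
proof -
  have cont: "continuous_on UNIV (partial i f)" for i using C_k_continuous[OF C_k_partial[OF f]] .
  have approx: "\<exists>d>0. \<forall>h. norm h < d \<longrightarrow> (\<forall>i. i \<notin> S \<longrightarrow> h $ i = 0) \<longrightarrow>
      \<bar>f (x + h) - f x - (\<Sum>i\<in>S. h $ i * partial i f x)\<bar> \<le> e * (\<Sum>i\<in>S. \<bar>h $ i\<bar>)"
    if e: "e > 0" for S and e :: real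
    using finite[of S]
  proof (induction S)
    case empty
    have "h = 0" if "\<forall>i. h $ i = 0" for h :: "real^'n" using that by (simp add: vec_eq_iff)
    then show ?case by (intro exI[of _ 1]) fastforce
  next
    case (insert j S)
    from insert.IH obtain d where d: "d > 0" "\<And>h. norm h < d \<Longrightarrow> (\<And>i. i \<notin> S \<Longrightarrow> h $ i = 0) \<Longrightarrow>
      \<bar>f (x + h) - f x - (\<Sum>i\<in>S. h $ i * partial i f x)\<bar> \<le> e * (\<Sum>i\<in>S. \<bar>h $ i\<bar>)" by blast
    have "continuous (at x) (partial j f)" using cont by (simp add: continuous_on_eq_continuous_at)
    then obtain d' where d': "d' > 0" "\<And>y. dist y x < d' \<Longrightarrow> dist (partial j f y) (partial j f x) < e"
      using e unfolding continuous_at_eps_delta by blast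
    have "\<bar>f (x + h) - f x - (\<Sum>i\<in>insert j S. h $ i * partial i f x)\<bar> \<le> e * (\<Sum>i\<in>insert j S. \<bar>h $ i\<bar>)"
      if h: "norm h < min d d'" "\<And>i. i \<notin> insert j S \<Longrightarrow> h $ i = 0" for h
    proof -
      define h' where "h' = h - (h $ j) *\<^sub>R axis j 1"
      have h'i: "h' $ i = (if i = j then 0 else h $ i)" for i by (simp add: h'_def axis_def)
      have le: "norm (h' + t *\<^sub>R axis j 1) \<le> norm h" if "\<bar>t\<bar> \<le> \<bar>h $ j\<bar>" for t
        using that by (intro norm_le_componentwise_cart) (auto simp: h'i axis_def)
      have "norm h' < d" using le[of 0] h(1) by simp
      then have 1: "\<bar>f (x + h') - f x - (\<Sum>i\<in>S. h $ i * partial i f x)\<bar> \<le> e * (\<Sum>i\<in>S. \<bar>h $ i\<bar>)"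
      proof -
        have "(\<Sum>i\<in>S. h' $ i * partial i f x) = (\<Sum>i\<in>S. h $ i * partial i f x)"
          "(\<Sum>i\<in>S. \<bar>h' $ i\<bar>) = (\<Sum>i\<in>S. \<bar>h $ i\<bar>)"
          using insert.hyps by (intro sum.cong; auto simp: h'i)+
        moreover have "h' $ i = 0" if "i \<notin> S" for i using h(2) that by (auto simp: h'i)
        ultimately show ?thesis using d(2)[OF \<open>norm h' < d\<close>] by simp
      qed
      have "\<exists>\<tau>. \<bar>\<tau>\<bar> \<le> \<bar>h $ j\<bar> \<and> f (x + h) - f (x + h') = h $ j * partial j f (x + h' + \<tau> *\<^sub>R axis j 1)"
      proof -
        let ?q = "\<lambda>t. f (x + h' + t *\<^sub>R axis j 1)"
        have D: "(?q has_real_derivative partial j f (x + h' + t *\<^sub>R axis j 1)) (at t)" for t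
          by (rule partial_has_real_derivative[OF f])
        have q: "?q (h $ j) = f (x + h)" "?q 0 = f (x + h')" by (simp_all add: h'_def algebra_simps)
        consider "h $ j = 0" | "h $ j > 0" | "h $ j < 0" by linarith
        then show ?thesis
        proof cases
          case 1 then show ?thesis using q by (intro exI[of _ 0]) simp
        next
          case 2
          from MVT2[OF this, of ?q, OF D] obtain z where z: "0 < z" "z < h $ j"
            "?q (h $ j) - ?q 0 = (h $ j - 0) * partial j f (x + h' + z *\<^sub>R axis j 1)" by blast
          then show ?thesis using q by (intro exI[of _ z]) auto
        next
          case 3
          from MVT2[OF this, of ?q, OF D] obtain z where z: "h $ j < z" "z < 0"
            "?q 0 - ?q (h $ j) = (0 - h $ j) * partial j f (x + h' + z *\<^sub>R axis j 1)" by blast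
          then show ?thesis using q by (intro exI[of _ z]) auto
        qed
      qed
      then obtain \<tau> where \<tau>: "\<bar>\<tau>\<bar> \<le> \<bar>h $ j\<bar>"
        "f (x + h) - f (x + h') = h $ j * partial j f (x + h' + \<tau> *\<^sub>R axis j 1)" by blast
      have "dist (x + h' + \<tau> *\<^sub>R axis j 1) x < d'" using le[OF \<tau>(1)] h(1) by (simp add: dist_norm add.assoc)
      then have "\<bar>partial j f (x + h' + \<tau> *\<^sub>R axis j 1) - partial j f x\<bar> \<le> e"
        using d'(2) unfolding dist_real_def by (meson less_imp_le)
      then have "\<bar>h $ j * (partial j f (x + h' + \<tau> *\<^sub>R axis j 1) - partial j f x)\<bar> \<le> e * \<bar>h $ j\<bar>"
        by (simp add: abs_mult mult.commute[of e] mult_left_mono)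
      then have "\<bar>f (x + h) - f (x + h') - h $ j * partial j f x\<bar> \<le> e * \<bar>h $ j\<bar>"
        by (simp add: \<tau>(2) right_diff_distrib)
      with 1 show ?thesis using insert.hyps by (simp add: distrib_left)
    qed
    then show ?case using d(1) d'(1) by (intro exI[of _ "min d d'"]) auto
  qed
  show ?thesis
    unfolding has_derivative_at_alt
  proof (intro conjI allI impI)
    show "bounded_linear (\<lambda>h. \<Sum>i\<in>UNIV. h $ i * partial i f x)"
      by (intro bounded_linear_sum bounded_linear_mult_const bounded_linear_vec_nth)
    fix e :: real assume e: "e > 0"
    define e' where "e' = e / real CARD('n)"
    have e': "e' > 0" using e by (simp add: e'_def)
    obtain d where d: "d > 0" "\<And>h. norm h < d \<Longrightarrow>
        \<bar>f (x + h) - f x - (\<Sum>i\<in>UNIV. h $ i * partial i f x)\<bar> \<le> e' * (\<Sum>i\<in>UNIV. \<bar>h $ i\<bar>)"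
      using approx[OF e', of UNIV] by auto
    have "norm (f y - f x - (\<Sum>i\<in>UNIV. (y - x) $ i * partial i f x)) \<le> e * norm (y - x)"
      if "norm (y - x) < d" for y
    proof -
      have "(\<Sum>i\<in>UNIV. \<bar>(y - x) $ i\<bar>) \<le> real CARD('n) * norm (y - x)"
        using sum_bounded_above[of UNIV "\<lambda>i. \<bar>(y - x) $ i\<bar>" "norm (y - x)", OF component_le_norm_cart]
        by simp
      then have "e' * (\<Sum>i\<in>UNIV. \<bar>(y - x) $ i\<bar>) \<le> e' * (real CARD('n) * norm (y - x))"
        using e' by (intro mult_left_mono) auto
      also have "\<dots> = e * norm (y - x)" by (simp add: e'_def)
      finally show ?thesis using d(2)[OF that] by simp
    qed
    then show "\<exists>d>0. \<forall>y. norm (y - x) < d \<longrightarrow>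
        norm (f y - f x - (\<Sum>i\<in>UNIV. (y - x) $ i * partial i f x)) \<le> e * norm (y - x)"
      using d(1) by blast
  qed
qed

lemma C_k_ray_derivative:
  fixes f :: "real^'n \<Rightarrow> real"
  assumes f: "C_k (Suc k) f"
  shows "((\<lambda>t. f (x + t *\<^sub>R y)) has_real_derivative (\<Sum>i\<in>UNIV. y $ i * partial i f (x + t *\<^sub>R y))) (at t)"
proof -
  have "((\<lambda>t. x + t *\<^sub>R y) has_derivative (\<lambda>s. s *\<^sub>R y)) (at t)"
    by (auto intro!: derivative_eq_intros)
  from has_derivative_compose[OF this C_k_has_derivative[OF f]]
  have "((\<lambda>t. f (x + t *\<^sub>R y)) has_derivative (\<lambda>s. \<Sum>i\<in>UNIV. (s *\<^sub>R y) $ i * partial i f (x + t *\<^sub>R y))) (at t)" .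
  moreover have "(\<lambda>s. \<Sum>i\<in>UNIV. (s *\<^sub>R y) $ i * partial i f (x + t *\<^sub>R y)) =
      (*) (\<Sum>i\<in>UNIV. y $ i * partial i f (x + t *\<^sub>R y))"
    by (auto simp: fun_eq_iff sum_distrib_left sum_distrib_right mult_ac)
  ultimately show ?thesis unfolding has_field_derivative_def by simp
qed

text \<open>The derivative of order \<open>j\<close> of \<open>t \<mapsto> f (x + t y)\<close>, written as a sum over all
  words of \<open>j\<close> coordinates.  In this form differentiating once more is just prefixing a letter.\<close>

definition ray_deriv :: "(real^'n \<Rightarrow> real) \<Rightarrow> real^'n \<Rightarrow> real^'n \<Rightarrow> nat \<Rightarrow> real \<Rightarrow> real" where
  "ray_deriv f x y j t =
     (\<Sum>is | length is = j. (\<Prod>i\<leftarrow>is. y $ i) * foldr partial is f (x + t *\<^sub>R y))"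

lemma sum_lists_length_Suc:
  fixes h :: "'n::finite list \<Rightarrow> 'b::comm_monoid_add"
  shows "(\<Sum>is | length is = Suc j. h is) = (\<Sum>is | length is = j. \<Sum>i\<in>UNIV. h (i # is))"
proof -
  have fin: "finite {is :: 'n list. length is = j}" using finite_lists_length_eq[OF finite[of "UNIV :: 'n set"], of j] by simp
  have "(\<Sum>is | length is = j. \<Sum>i\<in>UNIV. h (i # is)) = (\<Sum>(is, i)\<in>{is. length is = j} \<times> UNIV. h (i # is))"
    by (simp add: sum.cartesian_product)
  also have "\<dots> = (\<Sum>is | length is = Suc j. h is)"
    by (rule sum.reindex_bij_witness[of _ "\<lambda>is. (tl is, hd is)" "\<lambda>(is, i). i # is"])
       (auto simp: length_Suc_conv)
  finally show ?thesis by simp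
qed

lemma ray_deriv_0: "ray_deriv f x y 0 t = f (x + t *\<^sub>R y)"
  by (simp add: ray_deriv_def)

lemma ray_deriv_has_derivative:
  fixes f :: "real^'n \<Rightarrow> real"
  assumes "C_k k f" "j < k"
  shows "(ray_deriv f x y j has_real_derivative ray_deriv f x y (Suc j) t) (at t)"
proof -
  have "((\<lambda>t. \<Sum>is | length is = j. (\<Prod>i\<leftarrow>is. y $ i) * foldr partial is f (x + t *\<^sub>R y)) has_real_derivative
     (\<Sum>is | length is = j. (\<Prod>i\<leftarrow>is. y $ i) * (\<Sum>i\<in>UNIV. y $ i * partial i (foldr partial is f) (x + t *\<^sub>R y)))) (at t)"
  proof (rule DERIV_sum)
    fix "is" :: "'n list" assume "is \<in> {is. length is = j}"
    then have "C_k (Suc 0) (foldr partial is f)"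
      using assms by (intro C_k_foldr_partial) (auto intro: C_k_mono)
    then show "((\<lambda>t. (\<Prod>i\<leftarrow>is. y $ i) * foldr partial is f (x + t *\<^sub>R y)) has_real_derivative
     (\<Prod>i\<leftarrow>is. y $ i) * (\<Sum>i\<in>UNIV. y $ i * partial i (foldr partial is f) (x + t *\<^sub>R y))) (at t)"
      by (intro DERIV_cmult C_k_ray_derivative)
  qed
  also have "(\<Sum>is | length is = j. (\<Prod>i\<leftarrow>is. y $ i) * (\<Sum>i\<in>UNIV. y $ i * partial i (foldr partial is f) (x + t *\<^sub>R y)))
      = ray_deriv f x y (Suc j) t"
    unfolding ray_deriv_def sum_lists_length_Suc by (simp add: sum_distrib_left mult_ac)
  finally show ?thesis unfolding ray_deriv_def[abs_def] .
qed

lemma continuous_ray_deriv: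
  assumes "C_k k f" "j \<le> k" "continuous_on A g" "continuous_on A h"
  shows "continuous_on A (\<lambda>z. ray_deriv f x (g z) j (h z))"
proof -
  have "continuous_on UNIV (foldr partial is f)" if "length is = j" for "is"
    using assms(1,2) that C_k_foldr_partial[of "is" 0 f] by (auto intro: C_k_mono)
  then have "continuous_on A (\<lambda>z. foldr partial is f (x + h z *\<^sub>R g z))" if "length is = j" for "is"
    by (rule continuous_on_compose2) (use that assms in \<open>auto intro!: continuous_intros\<close>)
  moreover have "continuous_on A (\<lambda>z. \<Prod>i\<leftarrow>is. g z $ i)" for "is"
    using assms(3) by (induction "is") (auto intro!: continuous_intros)
  ultimately show ?thesis
    unfolding ray_deriv_def by (intro continuous_intros) auto
qed

lemma abs_ray_deriv_le:
  fixes f :: "real^'n \<Rightarrow> real"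
  assumes "norm y \<le> 1" and "\<And>is. length is = j \<Longrightarrow> \<bar>foldr partial is f (x + t *\<^sub>R y)\<bar> \<le> B"
  shows "\<bar>ray_deriv f x y j t\<bar> \<le> real CARD('n) ^ j * B"
proof -
  have "\<bar>\<Prod>i\<leftarrow>is. y $ i\<bar> \<le> 1" for "is"
  proof (induction "is")
    case (Cons i "is")
    have "\<bar>y $ i\<bar> \<le> 1" using component_le_norm_cart[of y i] assms(1) by simp
    then show ?case using Cons by (simp add: abs_mult mult_le_one)
  qed simp
  then have "\<bar>(\<Prod>i\<leftarrow>is. y $ i) * foldr partial is f (x + t *\<^sub>R y)\<bar> \<le> B" if "length is = j" for "is"
    using assms(2)[OF that] mult_mono[of "\<bar>\<Prod>i\<leftarrow>is. y $ i\<bar>" 1 "\<bar>foldr partial is f (x + t *\<^sub>R y)\<bar>" B]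
    by (simp add: abs_mult)
  then have "\<bar>ray_deriv f x y j t\<bar> \<le> (\<Sum>is\<in>{is::'n list. length is = j}. B)"
    unfolding ray_deriv_def by (intro order.trans[OF sum_abs] sum_mono) auto
  also have "\<dots> = real CARD('n) ^ j * B"
    using card_lists_length_eq[of "UNIV :: 'n set" j] by simp
  finally show ?thesis .
qed

text \<open>The second difference on the left is symmetric in \<open>i\<close> and \<open>j\<close>, whereas the order of the two
  derivatives on the right is not: comparing the two readings gives the symmetry of mixed derivatives.\<close>

lemma second_difference_mean_value:
  fixes f :: "real^'n \<Rightarrow> real"
  assumes f: "C_k 2 f" and s: "s > 0"
  obtains \<xi> \<eta> where "0 < \<xi>" "\<xi> < s" "0 < \<eta>" "\<eta> < s"
    "f (x + s *\<^sub>R axis i 1 + s *\<^sub>R axis j 1) - f (x + s *\<^sub>R axis i 1) - f (x + s *\<^sub>R axis j 1) + f x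
       = s * (s * partial j (partial i f) (x + \<xi> *\<^sub>R axis i 1 + \<eta> *\<^sub>R axis j 1))"
proof -
  have f1: "C_k (Suc 1) f" and f2: "C_k (Suc 0) (partial i f)"
    using f C_k_partial[of 1 f] by (simp_all add: numeral_2_eq_2)
  let ?q = "\<lambda>t. f (x + s *\<^sub>R axis j 1 + t *\<^sub>R axis i 1) - f (x + t *\<^sub>R axis i 1)"
  have "(?q has_real_derivative (partial i f (x + s *\<^sub>R axis j 1 + t *\<^sub>R axis i 1) - partial i f (x + t *\<^sub>R axis i 1))) (at t)" for t
    by (intro DERIV_diff partial_has_real_derivative[OF f1])
  from MVT2[OF s, of ?q, OF this] obtain \<xi> where \<xi>: "0 < \<xi>" "\<xi> < s"
    "?q s - ?q 0 = s * (partial i f (x + s *\<^sub>R axis j 1 + \<xi> *\<^sub>R axis i 1) - partial i f (x + \<xi> *\<^sub>R axis i 1))"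
    by auto
  let ?r = "\<lambda>t. partial i f (x + \<xi> *\<^sub>R axis i 1 + t *\<^sub>R axis j 1)"
  have "(?r has_real_derivative (partial j (partial i f) (x + \<xi> *\<^sub>R axis i 1 + t *\<^sub>R axis j 1))) (at t)" for t
    by (intro partial_has_real_derivative[OF f2])
  from MVT2[OF s, of ?r, OF this] obtain \<eta> where \<eta>: "0 < \<eta>" "\<eta> < s"
    "?r s - ?r 0 = s * partial j (partial i f) (x + \<xi> *\<^sub>R axis i 1 + \<eta> *\<^sub>R axis j 1)" by auto
  show thesis
    by (rule that[OF \<xi>(1,2) \<eta>(1,2)]) (use \<xi>(3) \<eta>(3) in \<open>simp add: algebra_simps\<close>)
qed

lemma partial_commute:
  fixes f :: "real^'n \<Rightarrow> real"
  assumes f: "C_k 2 f"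
  shows "partial i (partial j f) = partial j (partial i f)"
proof
  fix x
  have "continuous_on UNIV (partial a (partial b f))" for a b
    using f by (intro C_k_continuous[of 0] C_k_partial) (simp add: numeral_2_eq_2)
  then have cont: "continuous (at x) (partial a (partial b f))" for a b
    by (simp add: continuous_on_eq_continuous_at)
  show "partial i (partial j f) x = partial j (partial i f) x"
  proof (rule ccontr)
    assume ne: "partial i (partial j f) x \<noteq> partial j (partial i f) x"
    \<comment> \<open>Half the gap: two values within \<open>e\<close> of the two derivatives cannot coincide.\<close>
    define e where "e = \<bar>partial i (partial j f) x - partial j (partial i f) x\<bar> / 2"
    have e: "e > 0" using ne by (simp add: e_def)
    obtain d1 where d1: "d1 > 0" "\<And>y. dist y x < d1 \<Longrightarrow> dist (partial i (partial j f) y) (partial i (partial j f) x) < e"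
      using cont[of i j] e unfolding continuous_at_eps_delta by blast
    obtain d2 where d2: "d2 > 0" "\<And>y. dist y x < d2 \<Longrightarrow> dist (partial j (partial i f) y) (partial j (partial i f) x) < e"
      using cont[of j i] e unfolding continuous_at_eps_delta by blast
    \<comment> \<open>Both intermediate points lie at distance less than \<open>2 s\<close> from \<open>x\<close>.\<close>
    define s where "s = min d1 d2 / 2"
    have s: "s > 0" using d1 d2 by (simp add: s_def)
    have near: "dist (x + \<xi> *\<^sub>R axis a 1 + \<eta> *\<^sub>R axis b 1) x < min d1 d2"
      if "0 < \<xi>" "\<xi> < s" "0 < \<eta>" "\<eta> < s" for \<xi> \<eta> and a b :: 'n
    proof -
      have "dist (x + \<xi> *\<^sub>R axis a 1 + \<eta> *\<^sub>R axis b 1) x \<le> norm (\<xi> *\<^sub>R axis a (1::real)) + norm (\<eta> *\<^sub>R axis b (1::real))"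
        unfolding dist_norm using norm_triangle_ineq[of "\<xi> *\<^sub>R axis a (1::real)" "\<eta> *\<^sub>R axis b (1::real)"] by (simp add: add.assoc)
      also have "\<dots> < s + s" using that by simp
      finally show ?thesis by (simp add: s_def)
    qed
    obtain \<xi> \<eta> where 1: "0 < \<xi>" "\<xi> < s" "0 < \<eta>" "\<eta> < s"
      "f (x + s *\<^sub>R axis i 1 + s *\<^sub>R axis j 1) - f (x + s *\<^sub>R axis i 1) - f (x + s *\<^sub>R axis j 1) + f x
       = s * (s * partial j (partial i f) (x + \<xi> *\<^sub>R axis i 1 + \<eta> *\<^sub>R axis j 1))"
      using second_difference_mean_value[OF f s] by blast
    obtain \<xi>' \<eta>' where 2: "0 < \<xi>'" "\<xi>' < s" "0 < \<eta>'" "\<eta>' < s"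
      "f (x + s *\<^sub>R axis j 1 + s *\<^sub>R axis i 1) - f (x + s *\<^sub>R axis j 1) - f (x + s *\<^sub>R axis i 1) + f x
       = s * (s * partial i (partial j f) (x + \<xi>' *\<^sub>R axis j 1 + \<eta>' *\<^sub>R axis i 1))"
      using second_difference_mean_value[OF f s] by blast
    let ?ji = "partial j (partial i f) (x + \<xi> *\<^sub>R axis i 1 + \<eta> *\<^sub>R axis j 1)"
    let ?ij = "partial i (partial j f) (x + \<xi>' *\<^sub>R axis j 1 + \<eta>' *\<^sub>R axis i 1)"
    have "s * (s * ?ji) =
      s * (s * ?ij)"
      unfolding 1(5)[symmetric] 2(5)[symmetric] by (simp add: algebra_simps)
    then have "?ji =
       ?ij" using s by simp
    moreover have "\<bar>?ji - partial j (partial i f) x\<bar> < e"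
      using d2(2) near[OF 1(1-4)] by (simp add: dist_real_def)
    moreover have "\<bar>?ij - partial i (partial j f) x\<bar> < e"
      using d1(2) near[OF 2(1-4)] by (simp add: dist_real_def)
    ultimately have "\<bar>partial i (partial j f) x - partial j (partial i f) x\<bar> < e + e" by linarith
    then show False unfolding e_def by simp
  qed
qed

lemma foldr_partial_move:
  fixes f :: "real^'n \<Rightarrow> real"
  assumes "C_k (length as + Suc (length bs)) f"
  shows "foldr partial (as @ x # bs) f = foldr partial (x # as @ bs) f"
  using assms
proof (induction as)
  case (Cons a as)
  have "C_k 2 (foldr partial (as @ bs) f)"
    using Cons.prems by (intro C_k_foldr_partial) (simp add: add.commute numeral_2_eq_2)
  from partial_commute[OF this, of a x] show ?case
    using Cons.IH C_k_Suc_imp[of "length as + Suc (length bs)" f] Cons.prems by simp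
qed simp

text \<open>For a function that is as often continuously differentiable as the word is long, the iterated partial
  derivative depends only on the multiplicities of the coordinates in the word.  This is what connects the derivatives along
  a ray, where every word occurs, with \<open>nabla\<close>, where the coordinates come in one fixed order.\<close>

lemma foldr_partial_permute:
  fixes f :: "real^'n \<Rightarrow> real"
  assumes "C_k (length xs) f" "count_list xs = count_list ys"
  shows "foldr partial xs f = foldr partial ys f"
  using assms
proof (induction xs arbitrary: ys)
  case Nil
  then have "count_list ys y = 0" for y by (metis count_list.simps(1))
  then have "ys = []" by (metis count_list_0_iff list.set_intros(1) neq_Nil_conv)
  then show ?case by simp
next
  case (Cons x xs)
  have "count_list ys x \<noteq> 0" using Cons.prems(2) by (metis count_list.simps(2) Suc_eq_plus1 nat.simps(3))
  then obtain as bs where ys: "ys = as @ x # bs" by (metis count_list_0_iff split_list)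
  have eq: "count_list xs = count_list (as @ bs)"
  proof
    fix y
    show "count_list xs y = count_list (as @ bs) y"
      using fun_cong[OF Cons.prems(2), of y] by (auto simp: ys split: if_splits)
  qed
  have len: "length zs = (\<Sum>y\<in>UNIV. count_list zs y)" for zs :: "'n list"
    by (simp add: sum_count_set)
  have "length xs = length (as @ bs)" unfolding len eq ..
  then have "foldr partial ys f = foldr partial (x # as @ bs) f"
    unfolding ys using Cons.prems(1) by (intro foldr_partial_move) simp
  moreover have "foldr partial xs f = foldr partial (as @ bs) f"
    using Cons.prems(1) eq by (intro Cons.IH) (auto intro: C_k_Suc_imp)
  ultimately show ?case by simp
qed

definition index_list :: "('n::finite \<Rightarrow> nat) \<Rightarrow> 'n list" where
  "index_list \<alpha> = concat (map (\<lambda>i. replicate (\<alpha> i) i) coords)"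

lemma coords: "distinct (coords :: 'n::finite list)" "set (coords :: 'n::finite list) = UNIV"
proof -
  have "\<exists>js :: 'n list. distinct js \<and> set js = UNIV" using finite_distinct_list[OF finite[of "UNIV :: 'n set"]] by auto
  from someI_ex[OF this] show "distinct (coords :: 'n::finite list)" "set (coords :: 'n::finite list) = UNIV"
    by (auto simp: coords_def)
qed

lemma nabla_index_list: "nabla \<alpha> F = foldr partial (index_list \<alpha>) F"
proof -
  have "foldr (\<lambda>i. partial i ^^ \<alpha> i) cs F = foldr partial (concat (map (\<lambda>i. replicate (\<alpha> i) i) cs)) F" for cs
    by (induction cs) (auto simp: foldr_replicate)
  then show ?thesis by (simp add: nabla_def index_list_def)
qed

lemma count_index_list:
  fixes \<alpha> :: "'n::finite \<Rightarrow> nat"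
  shows "count_list (index_list \<alpha>) = \<alpha>"
proof
  fix i
  have rep: "count_list (replicate m a) i = (if a = i then m else 0)" for m and a :: 'n
    by (induction m) auto
  have "count_list (concat (map (\<lambda>i. replicate (\<alpha> i) i) cs)) i = (if i \<in> set cs then \<alpha> i else 0)"
    if "distinct cs" for cs :: "'n list"
    using that by (induction cs) (auto simp: rep)
  then show "count_list (index_list \<alpha>) i = \<alpha> i" 
    using coords[where ?'n = 'n] by (simp add: index_list_def)
qed

lemma length_index_list: "length (index_list \<alpha>) = sum \<alpha> UNIV"
  using sum_count_set[of "index_list \<alpha>" UNIV] by (simp add: count_index_list)

lemma foldr_partial_eq_nabla:
  fixes f :: "real^'n \<Rightarrow> real"
  assumes "C_k (length is) f"
  shows "foldr partial is f = nabla (count_list is) f"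
  unfolding nabla_index_list
  by (rule foldr_partial_permute[OF assms]) (simp add: count_index_list)

lemma nabla_bounded_linear:
  assumes "bounded_linear \<phi>" "C_k (sum \<alpha> UNIV) F"
  shows "nabla \<alpha> (\<lambda>x. \<phi> (F x)) = (\<lambda>x. \<phi> (nabla \<alpha> F x))"
  unfolding nabla_index_list
  by (rule foldr_partial_bounded_linear) (use assms in \<open>auto simp: length_index_list\<close>)

lemma continuous_nabla:
  assumes "C_k k F" "sum \<alpha> UNIV \<le> k"
  shows "continuous_on UNIV (nabla \<alpha> F)"
  using C_k_foldr_partial[of "index_list \<alpha>" 0 F] C_k_mono[OF assms]
  by (simp add: nabla_index_list length_index_list)

section \<open>The Poisson integrals of the Bessel functions\<close>

text \<open>The phase \<open>c\<close> and the power of the cosine make this family of oscillatory integrals closed under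
  integration by parts: a quarter turn of the phase turns sines into cosines.\<close>

definition bessel_W :: "real \<Rightarrow> nat \<Rightarrow> nat \<Rightarrow> real \<Rightarrow> real" where
  "bessel_W c a b s = integral {0..pi} (\<lambda>\<theta>. cos (s * cos \<theta> + c) * sin \<theta> ^ a * cos \<theta> ^ b)"

text \<open>Poisson's integral: \<open>poisson_J m s\<close> equals \<open>\<pi> (2m - 1)!! s^(-m) J\<^sub>m(s)\<close> for \<open>s \<noteq> 0\<close>.\<close>

definition poisson_J :: "nat \<Rightarrow> real \<Rightarrow> real" where
  "poisson_J m s = integral {0..pi} (\<lambda>\<theta>. cos (s * cos \<theta>) * sin \<theta> ^ (2 * m))"

lemma poisson_J_bessel_W: "poisson_J m s = bessel_W 0 (2 * m) 0 s"
  by (simp add: poisson_J_def bessel_W_def)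

lemma bessel_W_integrable:
  "(\<lambda>\<theta>. cos (s * cos \<theta> + c) * sin \<theta> ^ a * cos \<theta> ^ b) integrable_on {0..pi}"
  by (intro integrable_continuous_interval continuous_intros)

lemma bessel_W_bounded: "\<bar>bessel_W c a b s\<bar> \<le> pi"
proof -
  have "norm (integral {0..pi} (\<lambda>\<theta>. cos (s * cos \<theta> + c) * sin \<theta> ^ a * cos \<theta> ^ b))
      \<le> integral {0..pi} (\<lambda>\<theta>. 1)"
  proof (rule integral_norm_bound_integral[OF bessel_W_integrable])
    show "norm (cos (s * cos \<theta> + c) * sin \<theta> ^ a * cos \<theta> ^ b) \<le> 1" for \<theta>
      unfolding real_norm_def abs_mult power_abs
      by (intro mult_le_one power_le_one) auto
  qed auto
  then show ?thesis by (simp add: bessel_W_def)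
qed

text \<open>The factor \<open>s sin \<theta>\<close> is, up to sign, the derivative of the phase \<open>s cos \<theta>\<close>; the
  boundary terms vanish because a power of \<open>sin\<close> is left.  Each integration by parts gains a factor \<open>s\<close> and
  costs two powers of \<open>sin\<close>.  For \<open>b = 0\<close> the truncated \<open>b - 1\<close> has the coefficient \<open>0\<close>.\<close>

lemma bessel_W_by_parts:
  "s * bessel_W c (a + 2) b s =
     real (a + 1) * bessel_W (c - pi/2) a (b + 1) s - real b * bessel_W (c - pi/2) (a + 2) (b - 1) s"
proof -
  let ?F = "\<lambda>\<theta>. sin (s * cos \<theta> + c) * sin \<theta> ^ (a + 1) * cos \<theta> ^ b"
  have sin_cos: "sin x = cos (x - pi/2)" for x :: real by (simp add: cos_diff)
  let ?f = "\<lambda>\<theta>. real (a + 1) * (cos (s * cos \<theta> + (c - pi/2)) * sin \<theta> ^ a * cos \<theta> ^ (b + 1))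
      - real b * (cos (s * cos \<theta> + (c - pi/2)) * sin \<theta> ^ (a + 2) * cos \<theta> ^ (b - 1))
      - s * (cos (s * cos \<theta> + c) * sin \<theta> ^ (a + 2) * cos \<theta> ^ b)"
  have "(?f has_integral (?F pi - ?F 0)) {0..pi}"
  proof (rule fundamental_theorem_of_calculus)
    fix \<theta>
    have "(?F has_real_derivative ?f \<theta>) (at \<theta> within {0..pi})"
      using sin_cos[of "s * cos \<theta> + c"]
      by - ((rule derivative_eq_intros refl)+, simp add: algebra_simps)
    then show "(?F has_vector_derivative ?f \<theta>) (at \<theta> within {0..pi})"
      by (simp add: has_real_derivative_iff_has_vector_derivative)
  qed simp
  moreover have "(?f has_integral real (a + 1) * bessel_W (c - pi/2) a (b + 1) s
      - real b * bessel_W (c - pi/2) (a + 2) (b - 1) s - s * bessel_W c (a + 2) b s) {0..pi}"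
    unfolding bessel_W_def
    by (intro has_integral_diff has_integral_mult_right integrable_integral bessel_W_integrable)
  ultimately have "real (a + 1) * bessel_W (c - pi/2) a (b + 1) s
      - real b * bessel_W (c - pi/2) (a + 2) (b - 1) s - s * bessel_W c (a + 2) b s = ?F pi - ?F 0"
    by (rule has_integral_unique[rotated])
  then show ?thesis by simp
qed

lemma bessel_W_decay:
  assumes "2 * m \<le> a"
  shows "\<exists>C\<ge>0. \<forall>s. \<bar>s\<bar> ^ m * \<bar>bessel_W c a b s\<bar> \<le> C"
  using assms
proof (induction m arbitrary: a b c)
  case 0
  then show ?case using bessel_W_bounded by (intro exI[of _ pi]) auto
next
  case (Suc m)
  define a' where "a' = a - 2"
  have a: "a = a' + 2" "2 * m \<le> a'" using Suc.prems by (auto simp: a'_def)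
  obtain C1 where C1: "C1 \<ge> 0" "\<And>s. \<bar>s\<bar> ^ m * \<bar>bessel_W (c - pi/2) a' (b + 1) s\<bar> \<le> C1"
    using Suc.IH[of a' "c - pi/2" "b + 1"] a by auto
  obtain C2 where C2: "C2 \<ge> 0" "\<And>s. \<bar>s\<bar> ^ m * \<bar>bessel_W (c - pi/2) (a' + 2) (b - 1) s\<bar> \<le> C2"
    using Suc.IH[of "a' + 2" "c - pi/2" "b - 1"] a by auto
  have "\<bar>s\<bar> ^ Suc m * \<bar>bessel_W c a b s\<bar> \<le> real (a' + 1) * C1 + real b * C2" for s
  proof -
    have "\<bar>s\<bar> ^ Suc m * \<bar>bessel_W c a b s\<bar> = \<bar>s\<bar> ^ m * \<bar>s * bessel_W c (a' + 2) b s\<bar>"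
      by (simp add: a abs_mult)
    also have "\<dots> \<le> \<bar>s\<bar> ^ m * (real (a' + 1) * \<bar>bessel_W (c - pi/2) a' (b + 1) s\<bar>
        + real b * \<bar>bessel_W (c - pi/2) (a' + 2) (b - 1) s\<bar>)"
      unfolding bessel_W_by_parts
      by (intro mult_left_mono order.trans[OF abs_triangle_ineq4]) (auto simp: abs_mult)
    also have "\<dots> = real (a' + 1) * (\<bar>s\<bar> ^ m * \<bar>bessel_W (c - pi/2) a' (b + 1) s\<bar>)
        + real b * (\<bar>s\<bar> ^ m * \<bar>bessel_W (c - pi/2) (a' + 2) (b - 1) s\<bar>)"
      by (simp add: algebra_simps)
    also have "\<dots> \<le> real (a' + 1) * C1 + real b * C2"
      using C1 C2 by (intro add_mono mult_left_mono) auto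
    finally show ?thesis .
  qed
  then show ?case using C1(1) C2(1)
    by (intro exI[of _ "real (a' + 1) * C1 + real b * C2"]) auto
qed

lemma poisson_J_decay: "\<exists>C\<ge>0. \<forall>s. \<bar>s\<bar> ^ m * \<bar>poisson_J m s\<bar> \<le> C"
  unfolding poisson_J_bessel_W by (rule bessel_W_decay) simp

lemma poisson_J_0_0: "poisson_J 0 0 = pi"
  by (simp add: poisson_J_def)

lemma abs_poisson_J_le: "\<bar>poisson_J m s\<bar> \<le> pi"
  unfolding poisson_J_bessel_W by (rule bessel_W_bounded)

text \<open>Differentiating \<open>poisson_J m\<close> produces the factor \<open>cos \<theta>\<close>, and an integration by parts
  trades it for two powers of \<open>sin\<close>.  In terms of Bessel functions this is
  \<open>(s^(-m) J\<^sub>m)' = - s^(-m) J\<^sub>m\<^sub>+\<^sub>1\<close>.\<close>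

lemma poisson_J_has_derivative:
  "(poisson_J m has_real_derivative - s / (2 * real m + 1) * poisson_J (Suc m) s) (at s)"
proof -
  let ?d = "\<lambda>s \<theta>. - (cos (s * cos \<theta> - pi/2) * sin \<theta> ^ (2*m) * cos \<theta>)"
  have "((\<lambda>s. integral (cbox 0 pi) (\<lambda>\<theta>. cos (s * cos \<theta>) * sin \<theta> ^ (2 * m))) has_real_derivative
       integral (cbox 0 pi) (?d s)) (at s within UNIV)"
  proof (rule leibniz_rule_field_derivative)
    fix s \<theta> :: real
    show "((\<lambda>s. cos (s * cos \<theta>) * sin \<theta> ^ (2 * m)) has_real_derivative ?d s \<theta>) (at s within UNIV)"
      by (auto intro!: derivative_eq_intros simp: cos_diff algebra_simps)
    show "(\<lambda>\<theta>. cos (s * cos \<theta>) * sin \<theta> ^ (2 * m)) integrable_on cbox 0 pi"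
      unfolding cbox_interval by (intro integrable_continuous_interval continuous_intros)
    show "continuous_on (UNIV \<times> cbox 0 pi) (\<lambda>(s, \<theta>). ?d s \<theta>)"
      unfolding case_prod_beta by (intro continuous_intros)
  qed auto
  moreover have "integral (cbox 0 pi) (?d s) = - bessel_W (0 - pi/2) (2*m) 1 s"
    by (simp add: bessel_W_def)
  moreover have "s * poisson_J (Suc m) s = (2 * real m + 1) * bessel_W (0 - pi/2) (2*m) 1 s"
    using bessel_W_by_parts[of s 0 "2*m" 0] by (simp add: poisson_J_bessel_W)
  then have "- bessel_W (0 - pi/2) (2*m) 1 s = - s / (2 * real m + 1) * poisson_J (Suc m) s"
    by (simp add: field_simps add_pos_nonneg)
  moreover have "poisson_J m = (\<lambda>s. integral (cbox 0 pi) (\<lambda>\<theta>. cos (s * cos \<theta>) * sin \<theta> ^ (2 * m)))"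
    by (simp add: poisson_J_def fun_eq_iff)
  ultimately show ?thesis by simp
qed

lemma continuous_poisson_J [continuous_intros]:
  "continuous_on A f \<Longrightarrow> continuous_on A (\<lambda>x. poisson_J m (f x))"
proof -
  have "continuous_on UNIV (poisson_J m)"
    by (intro continuous_at_imp_continuous_on ballI DERIV_isCont[OF poisson_J_has_derivative])
  then show "continuous_on A f \<Longrightarrow> continuous_on A (\<lambda>x. poisson_J m (f x))"
    by (rule continuous_on_compose2) auto
qed

text \<open>For \<open>m = 0\<close> there is no power of \<open>sin\<close> that compensates the stationary points \<open>0\<close> and
  \<open>\<pi>\<close> of the phase.  Neighbourhoods of length \<open>\<epsilon>\<close> of them contribute at most \<open>2\<epsilon>\<close>, and between them one
  integration by parts gives a bound \<open>O(1/s)\<close>.\<close>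

lemma poisson_J_0_tendsto_0: "(poisson_J 0 \<longlongrightarrow> 0) at_top"
proof -
  have bound: "\<bar>poisson_J 0 s\<bar> \<le> 2 * \<epsilon> + (2 / sin \<epsilon> + pi / (sin \<epsilon>)\<^sup>2) / s"
    if s: "s > 0" and \<epsilon>: "0 < \<epsilon>" "\<epsilon> < pi/2" for s \<epsilon>
  proof -
    let ?c = "\<lambda>\<theta>. cos (s * cos \<theta>)"
    have int: "?c integrable_on {a..b}" for a b
      by (intro integrable_continuous_interval continuous_intros)
    have sine: "sin \<theta> \<ge> sin \<epsilon>" if "\<theta> \<in> {\<epsilon>..pi - \<epsilon>}" for \<theta>
    proof (cases "\<theta> \<le> pi/2")
      case True
      then show ?thesis using that \<epsilon> by (intro sin_mono_le_eq[THEN iffD2]) auto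
    next
      case False
      have "sin \<epsilon> \<le> sin (pi - \<theta>)"
        using that False \<epsilon> by (intro sin_mono_le_eq[THEN iffD2]) auto
      then show ?thesis by simp
    qed
    have pos: "sin \<epsilon> > 0" using \<epsilon> by (intro sin_gt_zero) auto
    have split: "poisson_J 0 s = integral {0..\<epsilon>} ?c + integral {\<epsilon>..pi - \<epsilon>} ?c + integral {pi - \<epsilon>..pi} ?c"
      using Henstock_Kurzweil_Integration.integral_combine[of 0 \<epsilon> "pi - \<epsilon>" ?c] 
        Henstock_Kurzweil_Integration.integral_combine[of 0 "pi - \<epsilon>" pi ?c] \<epsilon> int
      by (simp add: poisson_J_def)
    have small: "\<bar>integral {a..b} ?c\<bar> \<le> b - a" if "a \<le> b" for a b
    proof -
      have "norm (integral {a..b} ?c) \<le> integral {a..b} (\<lambda>_. 1)"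
        by (rule integral_norm_bound_integral[OF int]) auto
      then show ?thesis using that by simp
    qed
    have mid: "\<bar>integral {\<epsilon>..pi - \<epsilon>} ?c\<bar> \<le> (2 / sin \<epsilon> + pi / (sin \<epsilon>)\<^sup>2) / s"
    proof -
      let ?F = "\<lambda>\<theta>. sin (s * cos \<theta>) / sin \<theta>"
      let ?r = "\<lambda>\<theta>. sin (s * cos \<theta>) * cos \<theta> / (sin \<theta>)\<^sup>2"
      have "((\<lambda>\<theta>. - s * ?c \<theta> - ?r \<theta>) has_integral (?F (pi - \<epsilon>) - ?F \<epsilon>)) {\<epsilon>..pi - \<epsilon>}"
      proof (rule fundamental_theorem_of_calculus)
        fix \<theta> assume "\<theta> \<in> {\<epsilon>..pi - \<epsilon>}"
        then have "sin \<theta> \<noteq> 0" using sine pos by force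
        then have "(?F has_real_derivative - s * ?c \<theta> - ?r \<theta>) (at \<theta> within {\<epsilon>..pi - \<epsilon>})"
          by (auto intro!: derivative_eq_intros simp: field_simps power2_eq_square)
        then show "(?F has_vector_derivative - s * ?c \<theta> - ?r \<theta>) (at \<theta> within {\<epsilon>..pi - \<epsilon>})"
          by (simp add: has_real_derivative_iff_has_vector_derivative)
      qed (use \<epsilon> in auto)
      moreover have rint: "?r integrable_on {\<epsilon>..pi - \<epsilon>}"
        by (intro integrable_continuous_interval continuous_intros) (use sine pos in force)
      have "((\<lambda>\<theta>. - s * ?c \<theta> - ?r \<theta>) has_integral
          (- s * integral {\<epsilon>..pi - \<epsilon>} ?c - integral {\<epsilon>..pi - \<epsilon>} ?r)) {\<epsilon>..pi - \<epsilon>}"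
        by (intro has_integral_diff has_integral_mult_right integrable_integral int rint)
      ultimately have "- s * integral {\<epsilon>..pi - \<epsilon>} ?c - integral {\<epsilon>..pi - \<epsilon>} ?r = ?F (pi - \<epsilon>) - ?F \<epsilon>"
        by (rule has_integral_unique[rotated])
      moreover have "\<bar>?F \<theta>\<bar> \<le> 1 / sin \<epsilon>" if "\<theta> \<in> {\<epsilon>..pi - \<epsilon>}" for \<theta>
        unfolding abs_divide using sine[OF that] pos by (intro frac_le) auto
      from this[of \<epsilon>] this[of "pi - \<epsilon>"] have "\<bar>?F \<epsilon>\<bar> \<le> 1 / sin \<epsilon>" "\<bar>?F (pi - \<epsilon>)\<bar> \<le> 1 / sin \<epsilon>"
        using \<epsilon> by auto
      moreover have "\<bar>integral {\<epsilon>..pi - \<epsilon>} ?r\<bar> \<le> pi / (sin \<epsilon>)\<^sup>2"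
      proof -
        have "norm (integral {\<epsilon>..pi - \<epsilon>} ?r) \<le> integral {\<epsilon>..pi - \<epsilon>} (\<lambda>_. 1 / (sin \<epsilon>)\<^sup>2)"
        proof (rule integral_norm_bound_integral[OF rint])
          fix \<theta> assume \<theta>: "\<theta> \<in> {\<epsilon>..pi - \<epsilon>}"
          have "\<bar>sin (s * cos \<theta>)\<bar> * \<bar>cos \<theta>\<bar> \<le> 1" by (intro mult_le_one) auto
          then show "norm (?r \<theta>) \<le> 1 / (sin \<epsilon>)\<^sup>2"
            unfolding real_norm_def abs_divide abs_mult
            using sine[OF \<theta>] pos by (intro frac_le) auto
        qed auto
        also have "\<dots> \<le> pi / (sin \<epsilon>)\<^sup>2" using \<epsilon> pos by (simp add: divide_right_mono)
        finally show ?thesis by simp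
      qed
      ultimately have "\<bar>s * integral {\<epsilon>..pi - \<epsilon>} ?c\<bar> \<le> 1 / sin \<epsilon> + 1 / sin \<epsilon> + pi / (sin \<epsilon>)\<^sup>2"
        by linarith
      then show ?thesis using s by (simp add: abs_mult pos_le_divide_eq mult.commute)
    qed
    show ?thesis
      using split small[of 0 \<epsilon>] small[of "pi - \<epsilon>" pi] mid \<epsilon> by linarith
  qed
  show ?thesis
  proof (rule tendstoI)
    fix e :: real assume "e > 0"
    define \<epsilon> where "\<epsilon> = min (e / 8) 1"
    have \<epsilon>: "0 < \<epsilon>" "\<epsilon> < pi / 2" "2 * \<epsilon> \<le> e / 4" using \<open>e > 0\<close> pi_gt3 by (auto simp: \<epsilon>_def)
    have "((\<lambda>s. (2 / sin \<epsilon> + pi / (sin \<epsilon>)\<^sup>2) / s) \<longlongrightarrow> 0) at_top"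
      by (intro tendsto_divide_0[OF tendsto_const] filterlim_at_top_imp_at_infinity filterlim_ident)
    then have "\<forall>\<^sub>F s in at_top. (2 / sin \<epsilon> + pi / (sin \<epsilon>)\<^sup>2) / s < e / 2"
      using \<open>e > 0\<close> by (intro order_tendstoD) auto
    then show "\<forall>\<^sub>F s in at_top. dist (poisson_J 0 s) 0 < e"
      using eventually_gt_at_top[of 0]
    proof eventually_elim
      case (elim s)
      then show ?case using bound[OF elim(2) \<epsilon>(1,2)] \<epsilon>(3) \<open>e > 0\<close>
        unfolding dist_real_def by linarith
    qed
  qed
qed

section \<open>Rotation invariance and polar coordinates\<close>

lemma cball_measurable [measurable]: "cball (a::'a::real_normed_vector) r \<in> sets borel"
  by simp

lemma nn_integral_lborel_affine:
  fixes h :: "'a::euclidean_space \<Rightarrow> ennreal"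
  assumes [measurable]: "h \<in> borel_measurable borel" and c: "c \<noteq> 0"
  shows "(\<integral>\<^sup>+x. h x \<partial>lborel) = ennreal (\<bar>c\<bar> ^ DIM('a)) * (\<integral>\<^sup>+x. h (a + c *\<^sub>R x) \<partial>lborel)"
  by (subst lborel_affine[OF c, of a])
     (simp add: nn_integral_density nn_integral_distr nn_integral_cmult)

text \<open>Uniqueness of Haar measure for the additive group.  Integrating \<open>f (x + y) g (y)\<close> against \<open>M\<close> in
  \<open>x\<close> and Lebesgue measure in \<open>y\<close>, in both orders, gives
  \<open>\<integral>f dM \<cdot> \<integral>g d\<lambda> = \<integral>f d\<lambda> \<cdot> \<integral>g dM\<close>, and for \<open>g\<close> the indicator of the
  unit ball the two integrals of \<open>g\<close> agree.\<close>

lemma lborel_unique_invariant: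
  fixes M :: "'a::euclidean_space measure"
  assumes sets: "sets M = sets borel" and "sigma_finite_measure M"
    and ball: "emeasure M (cball 0 1) = emeasure lborel (cball (0::'a) 1)"
    and trans: "\<And>h a. h \<in> borel_measurable borel \<Longrightarrow> (\<integral>\<^sup>+x. h (a + x) \<partial>M) = (\<integral>\<^sup>+x. h x \<partial>M)"
    and refl: "\<And>h a. h \<in> borel_measurable borel \<Longrightarrow> (\<integral>\<^sup>+x. h (a - x) \<partial>M) = (\<integral>\<^sup>+x. h x \<partial>M)"
  shows "M = lborel"
proof -
  interpret M: sigma_finite_measure M by fact
  interpret pair_sigma_finite M lborel ..
  have [measurable_cong, simp]: "sets M = sets borel" by fact
  have sp[simp]: "space M = UNIV" using sets_eq_imp_space_eq[OF sets] by simp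
  let ?g = "indicator (cball (0::'a) 1) :: 'a \<Rightarrow> ennreal"
  let ?b = "emeasure lborel (cball (0::'a) 1)"
  have eq: "(\<integral>\<^sup>+x. f x \<partial>M) * ?b = (\<integral>\<^sup>+x. f x \<partial>lborel) * ?b"
    if [measurable]: "f \<in> borel_measurable borel" for f :: "'a \<Rightarrow> ennreal"
  proof -
    have "(\<integral>\<^sup>+x. f x \<partial>M) * ?b = (\<integral>\<^sup>+y. (\<integral>\<^sup>+x. f x \<partial>M) * ?g y \<partial>lborel)"
      by (subst nn_integral_cmult_indicator) auto
    also have "\<dots> = (\<integral>\<^sup>+y. (\<integral>\<^sup>+x. f (y + x) * ?g y \<partial>M) \<partial>lborel)"
      by (simp add: nn_integral_multc trans)
    also have "\<dots> = (\<integral>\<^sup>+x. (\<integral>\<^sup>+y. f (y + x) * ?g y \<partial>lborel) \<partial>M)"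
      by (rule Fubini') measurable
    also have "\<dots> = (\<integral>\<^sup>+x. (\<integral>\<^sup>+y. f y * ?g (y - x) \<partial>lborel) \<partial>M)"
    proof (rule nn_integral_cong)
      fix x
      show "(\<integral>\<^sup>+y. f (y + x) * ?g y \<partial>lborel) = (\<integral>\<^sup>+y. f y * ?g (y - x) \<partial>lborel)"
        using nn_integral_lborel_affine[of "\<lambda>y. f y * ?g (y - x)" 1 x] by (simp add: add.commute)
    qed
    also have "\<dots> = (\<integral>\<^sup>+y. (\<integral>\<^sup>+x. f y * ?g (y - x) \<partial>M) \<partial>lborel)"
      by (rule Fubini'[symmetric]) measurable
    also have "\<dots> = (\<integral>\<^sup>+y. f y * emeasure M (cball 0 1) \<partial>lborel)"
      using refl[of ?g] by (simp add: nn_integral_cmult)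
    also have "\<dots> = (\<integral>\<^sup>+x. f x \<partial>lborel) * ?b" by (simp add: nn_integral_multc ball)
    finally show ?thesis .
  qed
  have b: "?b \<noteq> 0" "?b \<noteq> \<infinity>"
    using content_cball_pos[of 1 "0::'a"] emeasure_lborel_cball_finite[of "0::'a" 1]
    by (auto simp: emeasure_eq_ennreal_measure)
  show ?thesis
  proof (rule measure_eqI)
    fix A assume "A \<in> sets M"
    then have A: "A \<in> sets borel" by simp
    have "emeasure M A * ?b = emeasure lborel A * ?b" using eq[of "indicator A"] A by simp
    then show "emeasure M A = emeasure lborel A"
      using b ennreal_mult_cancel_left[of ?b "emeasure M A" "emeasure lborel A"]
      by (simp add: mult.commute)
  qed simp
qed

text \<open>The image of Lebesgue measure under a rotation is invariant under translations and reflections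
  and gives the unit ball its usual measure.\<close>

lemma lborel_distr_orthogonal:
  fixes f :: "'a::euclidean_space \<Rightarrow> 'a"
  assumes f: "orthogonal_transformation f"
  shows "distr lborel borel f = lborel"
proof -
  have lin: "linear f" by (rule orthogonal_transformation_linear[OF f])
  have [measurable]: "f \<in> borel_measurable borel"
    by (intro borel_measurable_continuous_onI linear_continuous_on linear_conv_bounded_linear[THEN iffD1] lin)
  obtain g where g: "\<And>x. f (g x) = x" "orthogonal_transformation g"
    using orthogonal_transformation_inv[OF f] orthogonal_transformation_surj[OF f] by (metis surj_f_inv_f)
  have vim: "f -` cball 0 1 = cball 0 1"
    using orthogonal_transformation_norm[OF f] by auto
  have ball: "emeasure (distr lborel borel f) (cball 0 1) = emeasure lborel (cball (0::'a) 1)"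
    by (simp add: emeasure_distr vim)
  have inv: "(\<integral>\<^sup>+x. h (a + s *\<^sub>R x) \<partial>distr lborel borel f) = (\<integral>\<^sup>+x. h x \<partial>distr lborel borel f)"
    if [measurable]: "h \<in> borel_measurable borel" and s: "\<bar>s\<bar> = 1" for h :: "'a \<Rightarrow> ennreal" and a s
  proof -
    have "(\<integral>\<^sup>+x. h (a + s *\<^sub>R x) \<partial>distr lborel borel f) = (\<integral>\<^sup>+x. h (f (g a + s *\<^sub>R x)) \<partial>lborel)"
      by (simp add: nn_integral_distr linear_add[OF lin] linear_scale[OF lin] g)
    also have "\<dots> = (\<integral>\<^sup>+x. h (f x) \<partial>lborel)"
      using nn_integral_lborel_affine[of "\<lambda>x. h (f x)" s "g a"] s by auto
    finally show ?thesis by (simp add: nn_integral_distr)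
  qed
  show ?thesis
  proof (rule lborel_unique_invariant[OF _ _ ball])
    show "sigma_finite_measure (distr lborel borel f)"
    proof
      show "\<exists>A. countable A \<and> A \<subseteq> sets (distr lborel borel f) \<and> \<Union> A = space (distr lborel borel f) \<and>
            (\<forall>a\<in>A. emeasure (distr lborel borel f) a \<noteq> \<infinity>)"
      proof (intro exI[of _ "range (\<lambda>n::nat. cball (0::'a) (real n))"] conjI ballI)
        show "\<Union> (range (\<lambda>n::nat. cball (0::'a) (real n))) = space (distr lborel borel f)"
          using real_arch_simple by fastforce
        fix a assume "a \<in> range (\<lambda>n::nat. cball (0::'a) (real n))"
        then obtain n :: nat where a: "a = cball 0 (real n)" by blast
        have "f -` a = a" using orthogonal_transformation_norm[OF f] by (auto simp: a)
        then show "emeasure (distr lborel borel f) a \<noteq> \<infinity>"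
          using emeasure_lborel_cball_finite[of "0::'a" n] by (simp add: emeasure_distr a)
      qed auto
    qed
  qed (use inv[of _ 1] inv[of _ "-1"] in auto)
qed

text \<open>A ball is cut into slices orthogonal to the basis vector \<open>b\<close>, which are balls of dimension \<open>d\<close>
  and radius \<open>sqrt (R\<^sup>2 - s\<^sup>2)\<close>.\<close>

lemma distr_ball_component:
  fixes b :: "'a::euclidean_space"
  assumes b: "b \<in> Basis" and n: "DIM('a) = Suc d" and R: "R > 0"
  shows "distr (density lborel (indicator (cball 0 R))) borel (\<lambda>\<xi>. \<xi> \<bullet> b) =
    density lborel (\<lambda>s. ennreal (indicator {-R..R} s * (unit_ball_vol (real d) * sqrt (R\<^sup>2 - s\<^sup>2) ^ d)))"
proof (rule measure_eqI)
  let ?D = "\<lambda>s. ennreal (indicator {-R..R} s * (unit_ball_vol (real d) * sqrt (R\<^sup>2 - s\<^sup>2) ^ d))"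
  let ?p = "\<lambda>s f. \<Sum>c\<in>Basis. (f(b := s)) c *\<^sub>R c"
  fix A assume "A \<in> sets (distr (density lborel (indicator (cball (0::'a) R))) borel (\<lambda>\<xi>. \<xi> \<bullet> b))"
  then have [measurable]: "A \<in> sets borel" by simp
  interpret product_sigma_finite "\<lambda>_. lborel :: real measure" by standard
  let ?B = "Basis - {b} :: 'a set"
  have insB: "insert b ?B = Basis" using b by auto
  have card: "card ?B = d" using b n by simp
  let ?h = "\<lambda>\<xi>::'a. indicator (cball 0 R) \<xi> * indicator A (\<xi> \<bullet> b) :: ennreal"
  have "emeasure (distr (density lborel (indicator (cball (0::'a) R))) borel (\<lambda>\<xi>. \<xi> \<bullet> b)) A =
     (\<integral>\<^sup>+\<xi>. ?h \<xi> \<partial>lborel)"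
    by (subst nn_integral_indicator[symmetric]) (simp_all add: nn_integral_distr nn_integral_density del: nn_integral_indicator)
  also have "\<dots> = (\<integral>\<^sup>+f. ?h (\<Sum>c\<in>Basis. f c *\<^sub>R c) \<partial>Pi\<^sub>M (insert b ?B) (\<lambda>_. lborel))"
    unfolding insB by (subst lborel_eq, subst nn_integral_distr) auto
  also have "\<dots> = (\<integral>\<^sup>+s. \<integral>\<^sup>+f. ?h (?p s f) \<partial>Pi\<^sub>M ?B (\<lambda>_. lborel) \<partial>lborel)"
  proof (rule product_nn_integral_insert_rev)
    show "(\<lambda>f. ?h (\<Sum>c\<in>Basis. f c *\<^sub>R c)) \<in> borel_measurable (Pi\<^sub>M (insert b ?B) (\<lambda>_. lborel))"
      unfolding insB by measurable
  qed auto
  also have "\<dots> = (\<integral>\<^sup>+s. ?D s * indicator A s \<partial>lborel)"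
  proof (rule nn_integral_cong_AE)
    \<comment> \<open>At \<open>s = - R\<close> and \<open>s = R\<close> the slice is a point and no longer a ball of positive radius.\<close>
    have "AE s in lborel. s \<notin> {-R, R}" by (intro AE_not_in countable_imp_null_set_lborel) auto
    then show "AE s in lborel. (\<integral>\<^sup>+f. ?h (?p s f) \<partial>Pi\<^sub>M ?B (\<lambda>_. lborel)) =
       ?D s * indicator A s"
    proof eventually_elim
      case (elim s)
      have nrm: "norm (?p s f) = sqrt (s\<^sup>2 + (\<Sum>c\<in>?B. (f c)\<^sup>2))" for f :: "'a \<Rightarrow> real"
      proof -
        have "(norm (?p s f))\<^sup>2 = (\<Sum>c\<in>Basis. ((f(b := s)) c)\<^sup>2)"
          unfolding power2_norm_eq_inner by (subst euclidean_inner) (simp add: power2_eq_square)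
        also have "\<dots> = s\<^sup>2 + (\<Sum>c\<in>?B. (f c)\<^sup>2)"
          by (subst sum.remove[OF _ b]) auto
        finally show ?thesis by (metis norm_ge_zero real_sqrt_unique)
      qed
      have comp: "(?p s f) \<bullet> b = s" for f :: "'a \<Rightarrow> real"
        using b by simp
      show ?case
      proof (cases "\<bar>s\<bar> < R")
        case True
        then have sq: "s\<^sup>2 < R\<^sup>2" using abs_le_square_iff[of R s] by auto
        let ?S = "{f. sqrt (\<Sum>c\<in>?B. (f c)\<^sup>2) \<le> sqrt (R\<^sup>2 - s\<^sup>2)} \<inter> space (Pi\<^sub>M ?B (\<lambda>_. lborel :: real measure))"
        have "(\<integral>\<^sup>+f. ?h (?p s f) \<partial>Pi\<^sub>M ?B (\<lambda>_. lborel)) =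
          (\<integral>\<^sup>+f. indicator A s * indicator ?S f \<partial>Pi\<^sub>M ?B (\<lambda>_. lborel))"
        proof (rule nn_integral_cong)
          fix f assume "f \<in> space (Pi\<^sub>M ?B (\<lambda>_. lborel :: real measure))"
          moreover have "sqrt (s\<^sup>2 + (\<Sum>c\<in>?B. (f c)\<^sup>2)) \<le> R \<longleftrightarrow> sqrt (\<Sum>c\<in>?B. (f c)\<^sup>2) \<le> sqrt (R\<^sup>2 - s\<^sup>2)"
            using R real_sqrt_le_iff[of "s\<^sup>2 + (\<Sum>c\<in>?B. (f c)\<^sup>2)" "R\<^sup>2"] by auto
          ultimately show "?h (?p s f) = indicator A s * indicator ?S f"
            unfolding comp by (auto simp: nrm indicator_def simp del: fun_upd_apply)
        qed
        also have "\<dots> = indicator A s * emeasure (Pi\<^sub>M ?B (\<lambda>_. lborel)) ?S"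
          by (subst nn_integral_cmult) auto
        also have "emeasure (Pi\<^sub>M ?B (\<lambda>_. lborel)) ?S = ennreal (unit_ball_vol (real d) * sqrt (R\<^sup>2 - s\<^sup>2) ^ d)"
          using emeasure_cball_aux[of ?B "sqrt (R\<^sup>2 - s\<^sup>2)"] sq card by simp
        finally show ?thesis using True by (simp add: mult.commute abs_less_iff)
      next
        case False
        have "R < sqrt (s\<^sup>2 + (\<Sum>c\<in>?B. (f c)\<^sup>2))" for f :: "'a \<Rightarrow> real"
        proof -
          have "R < \<bar>s\<bar>" using False elim by auto
          also have "\<dots> \<le> sqrt (s\<^sup>2 + (\<Sum>c\<in>?B. (f c)\<^sup>2))"
            by (simp add: real_le_rsqrt sum_nonneg)
          finally show ?thesis .
        qed
        then have "?h (?p s f) = 0" for f :: "'a \<Rightarrow> real"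
          using nrm[of f] by (simp add: indicator_def not_le del: fun_upd_apply)
        then have "(\<integral>\<^sup>+f. ?h (?p s f) \<partial>Pi\<^sub>M ?B (\<lambda>_. lborel)) =
           (\<integral>\<^sup>+f. 0 \<partial>Pi\<^sub>M ?B (\<lambda>_. lborel :: real measure))" by (simp only:)
        moreover have "s \<notin> {-R..R}" using False elim by auto
        ultimately show ?thesis by (simp del: fun_upd_apply)
      qed
    qed
  qed
  also have "\<dots> = emeasure (density lborel (\<lambda>s. ?D s)) A"
    by (subst emeasure_density) auto
  finally show "emeasure (distr (density lborel (indicator (cball (0::'a) R))) borel (\<lambda>\<xi>. \<xi> \<bullet> b)) A =
     emeasure (density lborel (\<lambda>s. ?D s)) A" .
qed simp

text \<open>Surface measure on the unit sphere is, up to the factor \<open>n\<close>, the image of Lebesgue measure on the unit ball under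
  the radial projection \<open>sgn\<close>.  Hence polar coordinates can be formulated with the ball in place of
  the sphere: the pair \<open>(y, t)\<close> stands for the point at distance \<open>t\<close> from the origin in direction \<open>y\<close>.\<close>

definition cone_measure :: "('a::euclidean_space \<times> real) measure" where
  "cone_measure = density (lborel \<Otimes>\<^sub>M lborel)
     (\<lambda>(y, t). ennreal (real DIM('a) * (indicator (cball 0 1) y * (indicator {0<..} t * t ^ (DIM('a) - 1)))))"

lemma sgn_measurable [measurable]: "(sgn :: 'a::euclidean_space \<Rightarrow> 'a) \<in> borel_measurable borel"
  unfolding sgn_div_norm[abs_def] by measurable

lemma nn_integral_power_tail:
  assumes "r > 0" "n > 0"
  shows "(\<integral>\<^sup>+t. ennreal (indicator {r..} t * (1 / t ^ Suc n)) \<partial>lborel) = ennreal (1 / (real n * r ^ n))"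
proof -
  have "(\<integral>\<^sup>+t. ennreal (1 / t ^ Suc n) * indicator {r..} t \<partial>lborel) = ennreal (0 - (- 1 / (real n * r ^ n)))"
  proof (rule nn_integral_FTC_atLeast)
    fix t assume t: "r \<le> t"
    with assms have "t \<noteq> 0" by auto
    then have "((\<lambda>t. - (1 / real n) * inverse (t ^ n)) has_real_derivative
        - (1 / real n) * - (inverse (t ^ n) * (real n * t ^ (n - 1)) * inverse (t ^ n))) (at t)"
      by (auto intro!: derivative_eq_intros)
    also have "- (1 / real n) * - (inverse (t ^ n) * (real n * t ^ (n - 1)) * inverse (t ^ n)) = 1 / t ^ Suc n"
      using \<open>t \<noteq> 0\<close> assms power_minus_mult[of n t] by (simp add: field_simps)
    finally show "((\<lambda>t. - 1 / (real n * t ^ n)) has_real_derivative 1 / t ^ Suc n) (at t)"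
      by (simp add: field_simps)
    show "0 \<le> 1 / t ^ Suc n" using t assms by simp
  next
    have "((\<lambda>t. - (1 / real n) * inverse (t ^ n)) \<longlongrightarrow> - (1 / real n) * 0) at_top"
      by (intro tendsto_mult tendsto_const tendsto_inverse_0_at_top filterlim_pow_at_top filterlim_ident assms)
    then show "((\<lambda>t. - 1 / (real n * t ^ n)) \<longlongrightarrow> 0) at_top"
      by (simp add: field_simps)
  qed auto
  moreover have "(\<integral>\<^sup>+t. ennreal (indicator {r..} t * (1 / t ^ Suc n)) \<partial>lborel) =
      (\<integral>\<^sup>+t. ennreal (1 / t ^ Suc n) * indicator {r..} t \<partial>lborel)"
    by (rule nn_integral_cong) (simp add: indicator_def)
  ultimately show ?thesis by simp
qed

text \<open>Substituting \<open>t = s |y|\<close> and then \<open>u = s y\<close> turns the double integral into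
  \<open>\<integral> 1\<^sub>A(u) \<cdot> n |u|^n \<integral> s^(-n-1) ds du\<close> with \<open>s\<close> ranging over \<open>s \<ge> |u|\<close>; the inner
  integral is \<open>1 / (n |u|^n)\<close>.\<close>

theorem lborel_polar:
  "lborel = distr cone_measure borel (\<lambda>(y, t). t *\<^sub>R sgn (y::'a::euclidean_space))"
proof (rule measure_eqI)
  fix A :: "'a set" assume "A \<in> sets lborel"
  then have [measurable]: "A \<in> sets borel" by simp
  define n where "n = DIM('a)"
  have n: "n > 0" by (simp add: n_def)
  let ?w = "\<lambda>(y::'a) s::real. ennreal (real n * (indicator (cball 0 1) y * (indicator {0<..} s * s ^ (n - 1) * norm y ^ n)))"
  let ?v = "\<lambda>(u::'a) s::real. ennreal (real n * norm u ^ n * (indicator {0<..} s * (if norm u \<le> s then 1 else 0) * (1 / s ^ Suc n)))"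
  let ?q = "\<lambda>(y::'a) t::real. ennreal (real n * (indicator (cball 0 1) y * (indicator {0<..} t * t ^ (n - 1))))"
  have "emeasure (distr cone_measure borel (\<lambda>(y, t). t *\<^sub>R sgn (y::'a))) A =
     (\<integral>\<^sup>+p. (case p of (y, t) \<Rightarrow> ?q y t * indicator A (t *\<^sub>R sgn y)) \<partial>(lborel \<Otimes>\<^sub>M lborel))"
    unfolding cone_measure_def n_def[symmetric]
    by (subst nn_integral_indicator[symmetric])
       (simp_all add: nn_integral_distr nn_integral_density case_prod_unfold del: nn_integral_indicator)
  also have "\<dots> = (\<integral>\<^sup>+y. \<integral>\<^sup>+t. ?q y t * indicator A (t *\<^sub>R sgn y) \<partial>lborel \<partial>lborel)"
    by (subst lborel.nn_integral_fst[symmetric]) (auto simp: case_prod_beta)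
  also have "\<dots> = (\<integral>\<^sup>+y. \<integral>\<^sup>+s. ?w y s * indicator A (s *\<^sub>R y) \<partial>lborel \<partial>lborel)"
  proof (rule nn_integral_cong_AE)
    \<comment> \<open>The origin, where \<open>sgn\<close> vanishes instead of having norm one, is a null set.\<close>
    have "AE y in lborel. y \<noteq> (0::'a)" by (rule AE_lborel_singleton)
    then show "AE y in lborel. (\<integral>\<^sup>+t. ?q y t * indicator A (t *\<^sub>R sgn y) \<partial>lborel) =
      (\<integral>\<^sup>+s. ?w y s * indicator A (s *\<^sub>R y) \<partial>lborel)"
    proof eventually_elim
      case (elim y)
      then have y: "norm y > 0" by simp
      have "(\<integral>\<^sup>+t. ?q y t * indicator A (t *\<^sub>R sgn y) \<partial>lborel) =
        ennreal (norm y) * (\<integral>\<^sup>+s. ?q y (0 + norm y * s) * indicator A ((0 + norm y * s) *\<^sub>R sgn y) \<partial>lborel)"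
        using y by (subst nn_integral_real_affine[where c="norm y" and t=0]) auto
      also have "\<dots> = (\<integral>\<^sup>+s. ennreal (norm y) * (?q y (0 + norm y * s) * indicator A ((0 + norm y * s) *\<^sub>R sgn y)) \<partial>lborel)"
        by (subst nn_integral_cmult) auto
      also have "\<dots> = (\<integral>\<^sup>+s. ?w y s * indicator A (s *\<^sub>R y) \<partial>lborel)"
      proof (rule nn_integral_cong)
        fix s :: real
        have "(norm y * s) *\<^sub>R sgn y = s *\<^sub>R y" using y by (simp add: sgn_div_norm)
        moreover have "norm y * (norm y * s) ^ (n - 1) = s ^ (n - 1) * norm y ^ n"
          using n by (cases n) (auto simp: power_mult_distrib)
        moreover have "indicator {0<..} (norm y * s) = (indicator {0<..} s :: real)"
          using y by (auto simp: indicator_def zero_less_mult_iff)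
        moreover have "ennreal (norm y) * ?q y (norm y * s) =
          ennreal (norm y * (n * (indicator (cball 0 1) y * (indicator {0<..} (norm y * s) * (norm y * s) ^ (n - 1)))))"
          by (subst ennreal_mult) (auto simp: indicator_def)
        moreover have "norm y * (real n * (indicator (cball 0 1) y * (indicator {0<..} (norm y * s) * (norm y * s) ^ (n - 1))))
          = real n * (indicator (cball 0 1) y * (indicator {0<..} (norm y * s) * (norm y * (norm y * s) ^ (n - 1))))"
          by (simp only: mult_ac)
        ultimately show "ennreal (norm y) * (?q y (0 + norm y * s) * indicator A ((0 + norm y * s) *\<^sub>R sgn y)) =
          ?w y s * indicator A (s *\<^sub>R y)"
          by (simp only: mult.assoc[symmetric] add_0)
      qed
      finally show ?case .
    qed
  qed
  also have "\<dots> = (\<integral>\<^sup>+s. \<integral>\<^sup>+y. ?w y s * indicator A (s *\<^sub>R y) \<partial>lborel \<partial>lborel)"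
    by (rule lborel_pair.Fubini'[symmetric]) measurable
  also have "\<dots> = (\<integral>\<^sup>+s. \<integral>\<^sup>+u. indicator A u * ?v u s \<partial>lborel \<partial>lborel)"
  proof (rule nn_integral_cong)
    fix s :: real
    show "(\<integral>\<^sup>+y. ?w y s * indicator A (s *\<^sub>R y) \<partial>lborel) =
      (\<integral>\<^sup>+u. indicator A u * ?v u s \<partial>lborel)"
    proof (cases "s > 0")
      case True
      show ?thesis
      proof (subst (2) nn_integral_lborel_affine[of _ s 0], goal_cases)
        case 3
        have "ennreal (\<bar>s\<bar> ^ DIM('a)) * (\<integral>\<^sup>+x. indicator A (0 + s *\<^sub>R x) * ?v (0 + s *\<^sub>R x) s \<partial>lborel) =
          (\<integral>\<^sup>+x. ennreal (s ^ n) * (indicator A (s *\<^sub>R x) * ?v (s *\<^sub>R x) s) \<partial>lborel)"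
          using True by (subst nn_integral_cmult) (auto simp: n_def)
        also have "\<dots> = (\<integral>\<^sup>+y. ?w y s * indicator A (s *\<^sub>R y) \<partial>lborel)"
        proof (rule nn_integral_cong)
          fix x :: 'a
          have 1: "(if norm (s *\<^sub>R x) \<le> s then 1 else 0) = (indicator (cball 0 1) x :: real)"
            using True by (auto simp: indicator_def)
          let ?X = "real n * norm (s *\<^sub>R x) ^ n * (indicator {0<..} s * (if norm (s *\<^sub>R x) \<le> s then 1 else 0) * (1 / s ^ Suc n))"
          let ?Y = "real n * (indicator (cball 0 1) x * (indicator {0<..} s * s ^ (n - 1) * norm x ^ n))"
          have "s ^ n * ?X = ?Y"
            unfolding 1 using True n by (cases n) (auto simp: power_mult_distrib field_simps)
          moreover have "ennreal (s ^ n) * ennreal ?X = ennreal (s ^ n * ?X)"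
            using True by (intro ennreal_mult'[symmetric]) simp
          ultimately show "ennreal (s ^ n) * (indicator A (s *\<^sub>R x) * ennreal ?X) = ennreal ?Y * indicator A (s *\<^sub>R x)"
            by (simp only: mult.left_commute[of "ennreal (s ^ n)"]) (simp only: mult.commute)
        qed
        finally show ?case by simp
      qed (use True in auto)
    qed simp
  qed
  also have "\<dots> = (\<integral>\<^sup>+u. \<integral>\<^sup>+s. indicator A u * ?v u s \<partial>lborel \<partial>lborel)"
    by (rule lborel_pair.Fubini') measurable
  also have "\<dots> = (\<integral>\<^sup>+u. indicator A u \<partial>lborel)"
  proof (rule nn_integral_cong_AE)
    have "AE y in lborel. y \<noteq> (0::'a)" by (rule AE_lborel_singleton)
    then show "AE u::'a in lborel. (\<integral>\<^sup>+s. indicator A u * ?v u s \<partial>lborel) = indicator A u"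
    proof eventually_elim
      case (elim u)
      then have u: "norm u > 0" by simp
      have "(\<integral>\<^sup>+s. indicator A u * ?v u s \<partial>lborel) =
        (\<integral>\<^sup>+s. (indicator A u * ennreal (real n * norm u ^ n)) * ennreal (indicator {norm u..} s * (1 / s ^ Suc n)) \<partial>lborel)"
      proof (rule nn_integral_cong)
        fix s :: real
        have "s > 0" if "norm u \<le> s" using u that by linarith
        then show "indicator A u * ?v u s =
          (indicator A u * ennreal (real n * norm u ^ n)) * ennreal (indicator {norm u..} s * (1 / s ^ Suc n))"
          by (auto simp: indicator_def simp flip: ennreal_mult)
      qed
      also have "\<dots> = (indicator A u * ennreal (real n * norm u ^ n)) * ennreal (1 / (real n * norm u ^ n))"
        by (subst nn_integral_cmult) (simp_all only: nn_integral_power_tail[OF u n], measurable)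
      also have "\<dots> = indicator A u"
        using u n by (simp add: mult.assoc flip: ennreal_mult)
      finally show ?case .
    qed
  qed
  also have "\<dots> = emeasure lborel A" by simp
  finally show "emeasure lborel A = emeasure (distr cone_measure borel (\<lambda>(y, t). t *\<^sub>R sgn (y::'a))) A" ..
qed (simp add: cone_measure_def)

section \<open>The Fourier transform of a ball, and integration by parts along a ray\<close>

text \<open>After a rotation \<open>z\<close> is a multiple of a basis vector.  The slices of the ball then have volume
  \<open>V (R\<^sup>2 - s\<^sup>2)^(k - 1/2)\<close>, and \<open>s = - R cos \<theta>\<close> gives Poisson's integral.\<close>

theorem ball_fourier_integral:
  fixes z :: "real^'n"
  assumes k: "k \<ge> 1" "CARD('n) = 2 * k" and R: "R > 0"
  shows "(LINT \<xi>|lborel. indicator (cball 0 R) \<xi> * cos (z \<bullet> \<xi>)) =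
    unit_ball_vol (real (2 * k - 1)) * R ^ (2 * k) * poisson_J k (R * norm z)"
proof -
  define r where "r = norm z"
  define d where "d = 2 * k - 1"
  define V where "V = unit_ball_vol (real d)"
  have d: "DIM(real^'n) = Suc d" using k by (simp add: d_def)
  obtain b :: "real^'n" where b: "b \<in> Basis" using nonempty_Basis by blast
  obtain T :: "real^'n \<Rightarrow> real^'n" where T: "orthogonal_transformation T" "T z = r *\<^sub>R b"
    using orthogonal_transformation_exists[of z "r *\<^sub>R b"] b by (auto simp: r_def)
  have [measurable]: "T \<in> borel_measurable borel"
    using orthogonal_transformation_linear[OF T(1)]
    by (intro borel_measurable_continuous_onI linear_continuous_on linear_conv_bounded_linear[THEN iffD1])
  have "(LINT \<xi>|lborel. indicator (cball 0 R) \<xi> * cos (z \<bullet> \<xi>)) =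
      (LINT \<xi>|lborel. indicator (cball 0 R) (T \<xi>) * cos ((r *\<^sub>R b) \<bullet> T \<xi>))"
    using orthogonal_transformation_norm[OF T(1)] T
    by (intro Bochner_Integration.integral_cong refl) (auto simp: indicator_def orthogonal_transformation_def T(2)[symmetric])
  also have "\<dots> = (LINT \<xi>|distr lborel borel T. indicator (cball 0 R) \<xi> * cos ((r *\<^sub>R b) \<bullet> \<xi>))"
    by (subst integral_distr) auto
  also have "\<dots> = (LINT \<xi>|lborel. indicator (cball 0 R) \<xi> *\<^sub>R cos (r * (\<xi> \<bullet> b)))"
    by (simp add: lborel_distr_orthogonal[OF T(1)] inner_commute)
  also have "\<dots> = (LINT \<xi>|density lborel (\<lambda>\<xi>. ennreal (indicator (cball 0 R) \<xi>)). cos (r * (\<xi> \<bullet> b)))"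
    by (subst integral_density) auto
  also have "\<dots> = (LINT s|distr (density lborel (indicator (cball 0 R))) borel (\<lambda>\<xi>. \<xi> \<bullet> b). cos (r * s))"
    by (subst integral_distr) (auto simp: ennreal_indicator)
  also have "\<dots> = (LINT s|lborel. (indicator {-R..R} s * (V * sqrt (R\<^sup>2 - s\<^sup>2) ^ d)) *\<^sub>R cos (r * s))"
    unfolding distr_ball_component[OF b d R] V_def
  proof (rule integral_density)
    show "AE s in lborel. 0 \<le> indicat_real {- R..R} s * (unit_ball_vol (real d) * sqrt (R\<^sup>2 - s\<^sup>2) ^ d)"
    proof (rule AE_I2)
      fix s
      have "s\<^sup>2 \<le> R\<^sup>2" if "s \<in> {-R..R}" using that R by (auto simp: abs_le_square_iff[symmetric])
      then show "0 \<le> indicat_real {- R..R} s * (unit_ball_vol (real d) * sqrt (R\<^sup>2 - s\<^sup>2) ^ d)"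
        by (auto simp: indicator_def)
    qed
  qed auto
  also have "\<dots> = (LINT s:{-R..R}|lborel. V * sqrt (R\<^sup>2 - s\<^sup>2) ^ d * cos (r * s))"
    unfolding set_lebesgue_integral_def by (intro Bochner_Integration.integral_cong) auto
  also have "\<dots> = integral {-R..R} (\<lambda>s. V * sqrt (R\<^sup>2 - s\<^sup>2) ^ d * cos (r * s))"
    by (rule set_borel_integral_eq_integral(2), rule borel_integrable_atLeastAtMost', intro continuous_intros)
  also have "\<dots> = integral {0..pi} (\<lambda>\<theta>. V * R ^ (2 * k) * (cos (R * r * cos \<theta>) * sin \<theta> ^ (2 * k)))"
  proof -
    have "((\<lambda>\<theta>. (R * sin \<theta>) *\<^sub>R (V * sqrt (R\<^sup>2 - (- R * cos \<theta>)\<^sup>2) ^ d * cos (r * (- R * cos \<theta>)))) has_integral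
       integral {- R * cos 0..- R * cos pi} (\<lambda>s. V * sqrt (R\<^sup>2 - s\<^sup>2) ^ d * cos (r * s))) {0..pi}"
    proof (rule has_integral_substitution[where c="-R" and d=R])
      show "(\<lambda>\<theta>. - R * cos \<theta>) ` {0..pi} \<subseteq> {- R..R}"
      proof safe
        fix \<theta> :: real
        have "\<bar>R * cos \<theta>\<bar> \<le> R * 1" unfolding abs_mult using R by (intro mult_mono) auto
        then show "- R * cos \<theta> \<in> {- R..R}" by auto
      qed
    qed (use R in \<open>auto intro!: continuous_intros derivative_eq_intros\<close>)
    then have "integral {-R..R} (\<lambda>s. V * sqrt (R\<^sup>2 - s\<^sup>2) ^ d * cos (r * s)) =
       integral {0..pi} (\<lambda>\<theta>. (R * sin \<theta>) *\<^sub>R (V * sqrt (R\<^sup>2 - (- R * cos \<theta>)\<^sup>2) ^ d * cos (r * (- R * cos \<theta>))))"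
      by (simp add: integral_unique)
    also have "\<dots> = integral {0..pi} (\<lambda>\<theta>. V * R ^ (2 * k) * (cos (R * r * cos \<theta>) * sin \<theta> ^ (2 * k)))"
    proof (rule Henstock_Kurzweil_Integration.integral_cong)
      fix \<theta> assume "\<theta> \<in> {0..pi}"
      then have s: "sin \<theta> \<ge> 0" by (auto intro: sin_ge_zero)
      have "R\<^sup>2 - (- R * cos \<theta>)\<^sup>2 = (R * sin \<theta>)\<^sup>2"
        by (simp add: power_mult_distrib sin_squared_eq right_diff_distrib)
      then have eq1: "sqrt (R\<^sup>2 - (- R * cos \<theta>)\<^sup>2) = R * sin \<theta>" using s R by simp
      have eq2: "(R * sin \<theta>) * (R * sin \<theta>) ^ d = R ^ (2 * k) * sin \<theta> ^ (2 * k)"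
        using k by (subst power_Suc[symmetric]) (simp add: d_def power_mult_distrib)
      have eq3: "cos (r * (- R * cos \<theta>)) = cos (R * r * cos \<theta>)"
        using cos_minus[of "R * r * cos \<theta>"] by (simp add: mult_ac)
      have eq4: "V * R ^ (2 * k) * (cos (R * r * cos \<theta>) * sin \<theta> ^ (2 * k)) =
         V * (R ^ (2 * k) * sin \<theta> ^ (2 * k)) * cos (R * r * cos \<theta>)" by (simp only: mult_ac)
      show "(R * sin \<theta>) *\<^sub>R (V * sqrt (R\<^sup>2 - (- R * cos \<theta>)\<^sup>2) ^ d * cos (r * (- R * cos \<theta>))) =
        V * R ^ (2 * k) * (cos (R * r * cos \<theta>) * sin \<theta> ^ (2 * k))"
        unfolding eq1 eq3 eq4 real_scaleR_def eq2[symmetric] by (simp only: mult_ac)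
    qed
    finally show ?thesis .
  qed
  also have "\<dots> = V * R ^ (2 * k) * poisson_J k (R * r)" by (simp add: poisson_J_def)
  finally show ?thesis by (simp add: V_def d_def r_def)
qed


text \<open>The situation on one ray: \<open>u i\<close> are the successive derivatives of the function, \<open>p l\<close> is a chain
  of kernels in which each is obtained from the preceding one by \<open>-(1/t) d/dt\<close>.  The numbers \<open>B\<close>
  and \<open>W\<close> bound the boundary terms at \<open>T\<close>, and \<open>Q\<close> bounds the integrals that are left in the end.\<close>

definition radial_data ::
    "nat \<Rightarrow> nat \<Rightarrow> (nat \<Rightarrow> real \<Rightarrow> real) \<Rightarrow> (nat \<Rightarrow> real \<Rightarrow> real) \<Rightarrow> real \<Rightarrow> real \<Rightarrow> real \<Rightarrow> real \<Rightarrow> bool" where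
  "radial_data N m u p T B W Q \<longleftrightarrow> T \<ge> 1 \<and> B \<ge> 0 \<and>
     (\<forall>i<N. \<forall>t. (u i has_real_derivative u (Suc i) t) (at t)) \<and>
     (\<forall>i\<le>N. continuous_on {0..T} (u i)) \<and>
     (\<forall>l<m. \<forall>t. (p l has_real_derivative - t * p (Suc l) t) (at t)) \<and>
     (\<forall>l\<le>m. continuous_on {0..T} (p l)) \<and>
     (\<forall>l<m. T ^ l * \<bar>p l T\<bar> \<le> B) \<and>
     (\<forall>i\<le>N. \<bar>u i T\<bar> \<le> W) \<and>
     (\<forall>i. 1 \<le> i \<longrightarrow> i \<le> N \<longrightarrow> \<bar>integral {0..T} (\<lambda>t. t ^ (i - 1) * u i t * p 0 t)\<bar> \<le> Q)"

lemma radial_data_mono: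
  "radial_data N m u p T B W Q \<Longrightarrow> N' \<le> N \<Longrightarrow> m' \<le> m \<Longrightarrow> radial_data N' m' u p T B W Q"
  unfolding radial_data_def by auto

lemma radial_data_nonneg:
  assumes "radial_data N m u p T B W Q"
  shows "W \<ge> 0" and "N \<ge> 1 \<Longrightarrow> Q \<ge> 0"
proof -
  have "\<bar>u 0 T\<bar> \<le> W" using assms by (simp add: radial_data_def)
  then show "W \<ge> 0" by linarith
  show "Q \<ge> 0" if "N \<ge> 1"
  proof -
    have "\<bar>integral {0..T} (\<lambda>t. t ^ (1 - 1) * u 1 t * p 0 t)\<bar> \<le> Q"
      using assms that unfolding radial_data_def by blast
    then show ?thesis by linarith
  qed
qed

fun radial_const :: "nat \<Rightarrow> nat \<Rightarrow> real" where
  "radial_const 0 j = 1"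
| "radial_const (Suc m) j = 1 + radial_const m (Suc j) + real (2 * m + j) * radial_const m j"

lemma radial_const_nonneg: "radial_const m j \<ge> 0"
  by (induction m j rule: radial_const.induct) auto

text \<open>The integral with kernel \<open>p m\<close> is reduced to integrals with kernel \<open>p 0\<close>.  As
  \<open>t * p (Suc m) t\<close> is minus the derivative of \<open>p m\<close>, one integration by parts lowers \<open>m\<close> by one and
  leaves the weights \<open>t ^ (2 * m + j - 1) * u j\<close> and \<open>t ^ (2 * m + j) * u (j + 1)\<close>, both of
  the original shape.  The first one has the coefficient \<open>2 * m + j\<close>, which vanishes just when the weight would
  become \<open>1 / t\<close>; it is in this last step that the boundary term at \<open>0\<close> appears.\<close>

lemma radial_by_parts:
  assumes "radial_data (j + m) m u p T B W Q" and "j + m \<ge> 1"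
  shows "\<bar>integral {0..T} (\<lambda>t. t ^ (2 * m + j - 1) * u j t * p m t) -
      (if j = 0 then 2 ^ (m - 1) * fact (m - 1) * (u 0 0 * p 0 0) else 0)\<bar>
    \<le> radial_const m j * (B * T ^ (j + m - 1) * W + Q)"
  using assms
proof (induction m arbitrary: j)
  case 0
  have "0 \<le> B * T ^ (j + 0 - 1) * W"
    using 0 radial_data_nonneg(1)[OF 0(1)] by (simp add: radial_data_def)
  moreover have "\<bar>integral {0..T} (\<lambda>t. t ^ (j - 1) * u j t * p 0 t)\<bar> \<le> Q"
    using 0 by (simp add: radial_data_def)
  ultimately show ?case using 0 by simp
next
  case (Suc m)
  let ?I = "\<lambda>m j. integral {0..T} (\<lambda>t. t ^ (2 * m + j - 1) * u j t * p m t)"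
  let ?c = "\<lambda>m j. if j = 0 then 2 ^ (m - 1) * fact (m - 1) * (u 0 0 * p 0 0) else 0"
  let ?E = "B * T ^ (j + m) * W + Q"
  have T: "T \<ge> 1" and B: "B \<ge> 0"
    and u: "\<And>i t. i < j + Suc m \<Longrightarrow> (u i has_real_derivative u (Suc i) t) (at t)"
    and cu: "\<And>i. i \<le> j + Suc m \<Longrightarrow> continuous_on {0..T} (u i)"
    and p: "\<And>l t. l < Suc m \<Longrightarrow> (p l has_real_derivative - t * p (Suc l) t) (at t)"
    and cp: "\<And>l. l \<le> Suc m \<Longrightarrow> continuous_on {0..T} (p l)"
    and pT: "\<And>l. l < Suc m \<Longrightarrow> T ^ l * \<bar>p l T\<bar> \<le> B"
    and uT: "\<And>i. i \<le> j + Suc m \<Longrightarrow> \<bar>u i T\<bar> \<le> W"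
    using Suc.prems(1) by (auto simp: radial_data_def)
  note W = radial_data_nonneg(1)[OF Suc.prems(1)] and Q = radial_data_nonneg(2)[OF Suc.prems]
  let ?F = "\<lambda>t. t ^ (2 * m + j) * u j t * p m t"
  let ?f = "\<lambda>t. real (2 * m + j) * (t ^ (2 * m + j - 1) * u j t * p m t) + t ^ (2 * m + Suc j - 1) * u (Suc j) t * p m t
      - t ^ (2 * Suc m + j - 1) * u j t * p (Suc m) t"
  have FTC: "(?f has_integral (?F T - ?F 0)) {0..T}"
  proof (rule fundamental_theorem_of_calculus)
    fix t :: real
    have "(?F has_real_derivative ((real (2 * m + j) * (1 * t ^ (2 * m + j - 1))) * u j t + u (Suc j) t * t ^ (2 * m + j)) * p m t
        + (- t * p (Suc m) t) * (t ^ (2 * m + j) * u j t)) (at t)"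
      using u[of j t] p[of m t] DERIV_power[OF DERIV_ident, of "2 * m + j" t UNIV]
      by (intro DERIV_mult) auto
    also have "((real (2 * m + j) * (1 * t ^ (2 * m + j - 1))) * u j t + u (Suc j) t * t ^ (2 * m + j)) * p m t
        + (- t * p (Suc m) t) * (t ^ (2 * m + j) * u j t) = ?f t"
      by (simp add: algebra_simps)
    finally show "(?F has_vector_derivative ?f t) (at t within {0..T})"
      by (simp add: has_real_derivative_iff_has_vector_derivative has_vector_derivative_at_within)
  qed (use T in auto)
  have "(?f has_integral (real (2 * m + j) * ?I m j + ?I m (Suc j) - ?I (Suc m) j)) {0..T}"
    by (intro has_integral_diff has_integral_add has_integral_mult_right integrable_integral
        integrable_continuous_interval continuous_intros cu cp) auto
  from has_integral_unique[OF this FTC]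
  have parts: "?I (Suc m) j = real (2 * m + j) * ?I m j + ?I m (Suc j) - ?F T + ?F 0" by linarith
  have FT: "\<bar>?F T\<bar> \<le> ?E"
  proof -
    have "\<bar>?F T\<bar> = T ^ (j + m) * (T ^ m * \<bar>p m T\<bar>) * \<bar>u j T\<bar>"
      using T by (simp add: abs_mult power_add mult_2)
    also have "\<dots> \<le> T ^ (j + m) * B * W" using T B W by (intro mult_mono pT uT) auto
    finally show ?thesis using Q by (simp add: mult_ac)
  qed
  have 1: "\<bar>?I m (Suc j)\<bar> \<le> radial_const m (Suc j) * ?E"
    using Suc.IH[of "Suc j"] radial_data_mono[OF Suc.prems(1)] by simp
  have 2: "\<bar>real (2 * m + j) * ?I m j + ?F 0 - ?c (Suc m) j\<bar> \<le> real (2 * m + j) * radial_const m j * ?E"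
  proof (cases "j + m = 0")
    case True
    then show ?thesis using Q W B T by simp
  next
    case False
    have "B * T ^ (j + m - 1) * W \<le> B * T ^ (j + m) * W"
      using B W T by (intro mult_right_mono mult_left_mono power_increasing) auto
    then have "radial_const m j * (B * T ^ (j + m - 1) * W + Q) \<le> radial_const m j * ?E"
      using radial_const_nonneg by (intro mult_left_mono) auto
    moreover have "\<bar>?I m j - ?c m j\<bar> \<le> radial_const m j * (B * T ^ (j + m - 1) * W + Q)"
      using False by (intro Suc.IH radial_data_mono[OF Suc.prems(1)]) auto
    ultimately have "\<bar>?I m j - ?c m j\<bar> \<le> radial_const m j * ?E" by linarith
    then have "real (2 * m + j) * \<bar>?I m j - ?c m j\<bar> \<le> real (2 * m + j) * (radial_const m j * ?E)"
      by (intro mult_left_mono) auto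
    moreover have "real (2 * m + j) * ?I m j + ?F 0 - ?c (Suc m) j = real (2 * m + j) * (?I m j - ?c m j)"
      using False by (cases m) (auto simp: algebra_simps)
    ultimately show ?thesis by (simp add: abs_mult mult.assoc)
  qed
  have "\<bar>?I (Suc m) j - ?c (Suc m) j\<bar> \<le> ?E + radial_const m (Suc j) * ?E + real (2 * m + j) * radial_const m j * ?E"
    unfolding parts using 1 2 FT by linarith
  also have "\<dots> = radial_const (Suc m) j * ?E" by (simp add: algebra_simps)
  finally show ?case by simp
qed

section \<open>The scalar error estimate\<close>

lemma nn_integral_polar:
  fixes h :: "'a::euclidean_space \<Rightarrow> ennreal"
  assumes [measurable]: "h \<in> borel_measurable borel"
  shows "(\<integral>\<^sup>+z. h z \<partial>lborel) = (\<integral>\<^sup>+y. \<integral>\<^sup>+t.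
    ennreal (real DIM('a) * (indicator (cball 0 1) y * (indicator {0<..} t * t ^ (DIM('a) - 1)))) * h (t *\<^sub>R sgn y)
    \<partial>lborel \<partial>lborel)"
proof -
  have "(\<integral>\<^sup>+z. h z \<partial>lborel) = (\<integral>\<^sup>+p. ennreal (real DIM('a) * (indicator (cball 0 1) (fst p) *
     (indicator {0<..} (snd p) * snd p ^ (DIM('a) - 1)))) * h (snd p *\<^sub>R sgn (fst p)) \<partial>(lborel \<Otimes>\<^sub>M lborel))"
    by (subst lborel_polar)
       (simp add: cone_measure_def nn_integral_distr nn_integral_density case_prod_unfold)
  also have "\<dots> = (\<integral>\<^sup>+y. \<integral>\<^sup>+t.
    ennreal (real DIM('a) * (indicator (cball 0 1) y * (indicator {0<..} t * t ^ (DIM('a) - 1)))) * h (t *\<^sub>R sgn y)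
    \<partial>lborel \<partial>lborel)"
    by (subst lborel.nn_integral_fst[symmetric]) auto
  finally show ?thesis .
qed

lemma measurable_poisson_J [measurable]: "poisson_J m \<in> borel_measurable borel"
  by (intro borel_measurable_continuous_onI continuous_poisson_J continuous_on_id)

text \<open>The double factorial \<open>(2m - 1)!!\<close>.\<close>

definition odd_fact :: "nat \<Rightarrow> real" where
  "odd_fact m = (\<Prod>i<m. 2 * real i + 1)"

lemma odd_fact_pos: "odd_fact m > 0"
  unfolding odd_fact_def by (intro prod_pos) auto

text \<open>This normalisation of the dilated Poisson integrals makes every kernel the image of the preceding one
  under \<open>-(1/t) d/dt\<close>, without a factor.\<close>

definition radial_kernel :: "real \<Rightarrow> nat \<Rightarrow> real \<Rightarrow> real" where
  "radial_kernel R m t = R ^ (2 * m) * poisson_J m (R * t) / odd_fact m"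

lemma radial_kernel_0: "radial_kernel R 0 t = poisson_J 0 (R * t)"
  by (simp add: radial_kernel_def odd_fact_def)

lemma radial_kernel_has_derivative:
  "(radial_kernel R m has_real_derivative - t * radial_kernel R (Suc m) t) (at t)"
proof -
  have "((\<lambda>t. poisson_J m (R * t)) has_real_derivative
      (- (R * t) / (2 * real m + 1) * poisson_J (Suc m) (R * t)) * R) (at t)"
    by (rule DERIV_chain2[OF poisson_J_has_derivative]) (auto intro!: derivative_eq_intros)
  then have "((\<lambda>t. R ^ (2 * m) * poisson_J m (R * t) / odd_fact m) has_real_derivative
      R ^ (2 * m) * ((- (R * t) / (2 * real m + 1) * poisson_J (Suc m) (R * t)) * R) / odd_fact m) (at t)"
    by (intro DERIV_cdivide DERIV_cmult)
  also have "R ^ (2 * m) * ((- (R * t) / (2 * real m + 1) * poisson_J (Suc m) (R * t)) * R) / odd_fact m =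
     - t * radial_kernel R (Suc m) t"
    using odd_fact_pos[of m]
    by (simp add: radial_kernel_def odd_fact_def field_simps power2_eq_square)
  finally show ?thesis by (simp add: radial_kernel_def[abs_def])
qed

lemma continuous_radial_kernel [continuous_intros]:
  "continuous_on A f \<Longrightarrow> continuous_on A (\<lambda>x. radial_kernel R m (f x))"
  unfolding radial_kernel_def using odd_fact_pos[of m] by (intro continuous_intros) auto

lemma measurable_radial_kernel [measurable]: "radial_kernel R m \<in> borel_measurable borel"
  by (intro borel_measurable_continuous_onI continuous_radial_kernel continuous_on_id)

lemma abs_radial_kernel_le: "R \<ge> 0 \<Longrightarrow> \<bar>radial_kernel R m t\<bar> \<le> R ^ (2 * m) * pi / odd_fact m"
  unfolding radial_kernel_def abs_divide abs_mult using odd_fact_pos[of m] abs_poisson_J_le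
  by (auto intro!: divide_right_mono mult_mono)

lemma radial_kernel_decay:
  assumes "R > 0"
  shows "\<exists>B\<ge>0. \<forall>l<k. \<forall>t\<ge>0. t ^ l * \<bar>radial_kernel R l t\<bar> \<le> B"
proof -
  have "\<forall>l. \<exists>C. \<forall>s. \<bar>s\<bar> ^ l * \<bar>poisson_J l s\<bar> \<le> C" using poisson_J_decay by blast
  then obtain C where C: "\<And>l s. \<bar>s\<bar> ^ l * \<bar>poisson_J l s\<bar> \<le> C l" by metis
  define B where "B l = R ^ l * C l / odd_fact l" for l
  have C0: "C l \<ge> 0" for l using C[of 1 l] by (smt (verit) abs_ge_zero mult_nonneg_nonneg zero_le_power)
  then have B0: "B l \<ge> 0" for l using assms odd_fact_pos[of l] by (simp add: B_def)
  have B: "t ^ l * \<bar>radial_kernel R l t\<bar> \<le> B l" if "t \<ge> 0" for l t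
  proof -
    have "t ^ l * \<bar>radial_kernel R l t\<bar> = R ^ l * (\<bar>R * t\<bar> ^ l * \<bar>poisson_J l (R * t)\<bar>) / odd_fact l"
    proof -
      have e: "R ^ (2 * l) = R ^ l * R ^ l" by (simp add: mult_2 power_add)
      show ?thesis
        unfolding radial_kernel_def e using assms that odd_fact_pos[of l]
        by (simp add: abs_mult power_mult_distrib)
    qed
    also have "\<dots> \<le> B l"
      unfolding B_def using assms odd_fact_pos[of l] by (intro divide_right_mono mult_left_mono C) auto
    finally show ?thesis .
  qed
  have "t ^ l * \<bar>radial_kernel R l t\<bar> \<le> (\<Sum>l<k. B l)" if "l < k" "t \<ge> 0" for l t
    using B[OF that(2), of l] member_le_sum[of l "{..<k}" B] B0 that(1) by fastforce
  then show ?thesis using B0 by (intro exI[of _ "\<Sum>l<k. B l"]) (auto intro: sum_nonneg)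
qed

text \<open>\<open>G\<close> is a common majorant, as a function of the displacement \<open>z\<close>, of all derivatives of order at most \<open>k\<close> at
  \<open>x + z\<close>.  In dimension \<open>n = 2 k\<close> its integrability against \<open>|z|^(-k)\<close> is the growth hypothesis of the theorem.\<close>

locale ray_majorant =
  fixes k :: nat and G :: "real^'n \<Rightarrow> real" and \<delta> G0 :: real
  assumes k: "k \<ge> 1" "CARD('n) = 2 * k"
    and G_measurable [measurable]: "G \<in> borel_measurable borel"
    and G_nonneg: "\<And>z. G z \<ge> 0"
    and \<delta>: "\<delta> \<ge> 1"
    and G_near: "\<And>z. norm z \<le> \<delta> \<Longrightarrow> G z \<le> G0"
    and G_far: "(\<integral>\<^sup>+z. ennreal (indicator {\<delta>..} (norm z) * (G z / norm z ^ k)) \<partial>lborel) < \<infinity>"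
begin

abbreviation far_weight :: "real^'n \<Rightarrow> real \<Rightarrow> real" where
  "far_weight y t \<equiv> indicator (cball 0 1) y * (indicator {\<delta>..} t * (t ^ (k - 1) * G (t *\<^sub>R sgn y)))"

abbreviation ray_weight :: "real \<Rightarrow> real^'n \<Rightarrow> real \<Rightarrow> real" where
  "ray_weight R y t \<equiv> indicator {0..} t * (\<bar>poisson_J 0 (R * t)\<bar> * ((1 + t) ^ (k - 1) * G (t *\<^sub>R sgn y)))"

text \<open>In polar coordinates \<open>|z|^(-k)\<close> combines with the density \<open>t^(2k-1)\<close> to \<open>t^(k-1)\<close>.\<close>

lemma G_far_polar:
  "(\<integral>\<^sup>+y. \<integral>\<^sup>+t. ennreal (far_weight y t)
     \<partial>lborel \<partial>lborel) < \<infinity>"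
proof -
  let ?n = "DIM(real^'n)"
  let ?h = "\<lambda>z::real^'n. ennreal (indicator {\<delta>..} (norm z) * (G z / norm z ^ k))"
  have "(\<integral>\<^sup>+y. \<integral>\<^sup>+t. ennreal (far_weight y t)
     \<partial>lborel \<partial>lborel) \<le> (\<integral>\<^sup>+y. \<integral>\<^sup>+t.
    ennreal (real ?n * (indicator (cball 0 1) y * (indicator {0<..} t * t ^ (?n - 1)))) * ?h (t *\<^sub>R sgn y)
    \<partial>lborel \<partial>lborel)"
  proof (rule nn_integral_mono_AE)
    have "AE y in lborel. y \<noteq> (0::real^'n)" by (rule AE_lborel_singleton)
    then show "AE y in lborel. (\<integral>\<^sup>+t. ennreal (far_weight y t) \<partial>lborel)
      \<le> (\<integral>\<^sup>+t. ennreal (real ?n * (indicator (cball 0 1) y * (indicator {0<..} t * t ^ (?n - 1)))) * ?h (t *\<^sub>R sgn y) \<partial>lborel)"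
    proof eventually_elim
      case (elim y)
      show ?case
      proof (rule nn_integral_mono)
        fix t :: real
        show "ennreal (far_weight y t)
          \<le> ennreal (real ?n * (indicator (cball 0 1) y * (indicator {0<..} t * t ^ (?n - 1)))) * ?h (t *\<^sub>R sgn y)"
        proof (cases "y \<in> cball 0 1 \<and> \<delta> \<le> t")
          case True
          then have t: "t > 0" using \<delta> by linarith
          have nrm: "norm (t *\<^sub>R sgn y) = t" using elim t by (simp add: norm_sgn)
          have "t ^ (?n - 1) = t ^ (k - 1) * t ^ k" using k by (simp add: mult_2 flip: power_add)
          then have "real ?n * t ^ (?n - 1) * (G (t *\<^sub>R sgn y) / t ^ k) = real ?n * (t ^ (k - 1) * G (t *\<^sub>R sgn y))"
            using t by simp
          \<comment> \<open>The factor \<open>n\<close> from the cone measure is at least one and can be dropped.\<close>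
          also have "\<dots> \<ge> 1 * (t ^ (k - 1) * G (t *\<^sub>R sgn y))"
            using k t G_nonneg by (intro mult_right_mono) auto
          finally have le: "t ^ (k - 1) * G (t *\<^sub>R sgn y) \<le> real ?n * t ^ (?n - 1) * (G (t *\<^sub>R sgn y) / t ^ k)" by simp
          have "ennreal (real ?n * (indicator (cball 0 1) y * (indicator {0<..} t * t ^ (?n - 1)))) * ?h (t *\<^sub>R sgn y)
            = ennreal (real ?n * t ^ (?n - 1)) * ennreal (G (t *\<^sub>R sgn y) / t ^ k)"
            using True t by (simp only: nrm) (simp add: indicator_def)
          also have "\<dots> = ennreal (real ?n * t ^ (?n - 1) * (G (t *\<^sub>R sgn y) / t ^ k))"
            using t by (intro ennreal_mult'[symmetric]) auto
          finally show ?thesis using True le by (simp add: ennreal_leI del: DIM_cart)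
        qed (auto simp: indicator_def)
      qed
    qed
  qed
  also have "\<dots> = (\<integral>\<^sup>+z. ?h z \<partial>lborel)" by (rule nn_integral_polar[symmetric]) auto
  also have "\<dots> < \<infinity>" by (rule G_far)
  finally show ?thesis .
qed

text \<open>Up to a constant, a bound for the boundary terms that arise when the rays are cut off at distance \<open>t\<close>.\<close>

definition shell_mean :: "real \<Rightarrow> ennreal" where
  "shell_mean t = (\<integral>\<^sup>+y. ennreal (indicator (cball 0 1) y * (t ^ (k - 1) * G (t *\<^sub>R sgn y))) \<partial>lborel)"

text \<open>The function \<open>shell_mean\<close> need not tend to \<open>0\<close>, but it is integrable on \<open>{\<delta>..}\<close>, so it
  cannot stay above \<open>\<epsilon>\<close> from \<open>N\<close> on.\<close>

lemma shell_mean_small: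
  assumes "\<epsilon> > 0"
  shows "\<exists>t\<ge>N. shell_mean t < ennreal \<epsilon>"
proof (rule ccontr)
  assume "\<not> (\<exists>t\<ge>N. shell_mean t < ennreal \<epsilon>)"
  then have ge: "ennreal \<epsilon> \<le> shell_mean t" if "t \<ge> N" for t using that by (auto simp: not_less)
  let ?m = "max N \<delta>"
  have "\<infinity> = ennreal \<epsilon> * emeasure lborel {?m..}"
  proof -
    have "emeasure lborel {?m..} = \<infinity>"
    proof (rule ccontr)
      assume "emeasure lborel {?m..} \<noteq> \<infinity>"
      then obtain r where r: "r \<ge> 0" "emeasure lborel {?m..} = ennreal r"
        by (cases "emeasure lborel {?m..}") auto
      have "emeasure lborel {?m..?m + (r + 1)} \<le> emeasure lborel {?m..}" by (intro emeasure_mono) auto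
      then show False using r by (simp add: ennreal_le_iff)
    qed
    then show ?thesis using assms by (simp add: ennreal_mult_top)
  qed
  also have "\<dots> = (\<integral>\<^sup>+t. ennreal \<epsilon> * indicator {?m..} t \<partial>lborel)"
    by (subst nn_integral_cmult_indicator) auto
  also have "\<dots> \<le> (\<integral>\<^sup>+t. \<integral>\<^sup>+y. ennreal (far_weight y t) \<partial>lborel \<partial>lborel)"
  proof (rule nn_integral_mono)
    fix t :: real
    show "ennreal \<epsilon> * indicator {?m..} t \<le>
      (\<integral>\<^sup>+y. ennreal (far_weight y t) \<partial>lborel)"
    proof (cases "t \<ge> ?m")
      case True
      then show ?thesis using ge[of t] by (simp add: shell_mean_def)
    qed auto
  qed
  also have "\<dots> = (\<integral>\<^sup>+y. \<integral>\<^sup>+t. ennreal (far_weight y t) \<partial>lborel \<partial>lborel)"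
    by (rule lborel_pair.Fubini') measurable
  also have "\<dots> < \<infinity>" by (rule G_far_polar)
  finally show False by simp
qed

text \<open>Up to a constant, a bound for what remains after the integrations by parts.  It depends on the point and on the
  function only through the majorant.\<close>

definition bessel_error :: "real \<Rightarrow> ennreal" where
  "bessel_error R = (\<integral>\<^sup>+y. \<integral>\<^sup>+t. ennreal (indicator (cball 0 1) y *
     (ray_weight R y t)) \<partial>lborel \<partial>lborel)"

lemma majorant_finite:
  "(\<integral>\<^sup>+y. \<integral>\<^sup>+t. ennreal (indicator (cball 0 1) y *
     (indicator {0..} t * ((1 + t) ^ (k - 1) * G (t *\<^sub>R sgn y)))) \<partial>lborel \<partial>lborel) < \<infinity>"
proof -
  have G0: "G0 \<ge> 0" using G_near[of 0] G_nonneg[of 0] \<delta> by simp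
  let ?c = "(1 + \<delta>) ^ (k - 1) * G0"
  let ?near = "\<lambda>(y::real^'n) t. ennreal (indicator (cball 0 1) y * (indicator {0..\<delta>} t * ?c))"
  let ?far = "\<lambda>(y::real^'n) t. ennreal (2 ^ (k - 1)) * ennreal (far_weight y t)"
  have c0: "?c \<ge> 0" using G0 \<delta> by simp
  have "(\<integral>\<^sup>+y. \<integral>\<^sup>+t. ennreal (indicator (cball 0 1) y *
     (indicator {0..} t * ((1 + t) ^ (k - 1) * G (t *\<^sub>R sgn y)))) \<partial>lborel \<partial>lborel)
    \<le> (\<integral>\<^sup>+y. \<integral>\<^sup>+t. ?near y t + ?far y t \<partial>lborel \<partial>lborel)"
  proof (intro nn_integral_mono)
    fix y :: "real^'n" and t :: real
    show "ennreal (indicator (cball 0 1) y * (indicator {0..} t * ((1 + t) ^ (k - 1) * G (t *\<^sub>R sgn y)))) \<le> ?near y t + ?far y t"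
    proof (cases "y \<in> cball 0 1 \<and> 0 \<le> t")
      case True
      show ?thesis
      proof (cases "t \<le> \<delta>")
        case t: True
        have "norm (t *\<^sub>R sgn y) \<le> \<delta>" using True t by (simp add: norm_sgn)
        then have "(1 + t) ^ (k - 1) * G (t *\<^sub>R sgn y) \<le> ?c"
          using True t G_near G_nonneg by (intro mult_mono power_mono) auto
        then have "ennreal (indicator (cball 0 1) y * (indicator {0..} t * ((1 + t) ^ (k - 1) * G (t *\<^sub>R sgn y)))) \<le> ?near y t"
          using True t by (intro ennreal_leI) (simp add: indicator_def)
        then show ?thesis by (rule order.trans) simp
      next
        case t: False
        have "(1 + t) ^ (k - 1) \<le> (2 * t) ^ (k - 1)" using t \<delta> by (intro power_mono) auto
        then have "(1 + t) ^ (k - 1) * G (t *\<^sub>R sgn y) \<le> 2 ^ (k - 1) * (t ^ (k - 1) * G (t *\<^sub>R sgn y))"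
          using G_nonneg[of "t *\<^sub>R sgn y"] mult_right_mono by (fastforce simp: power_mult_distrib mult.assoc)
        then have "ennreal (indicator (cball 0 1) y * (indicator {0..} t * ((1 + t) ^ (k - 1) * G (t *\<^sub>R sgn y)))) \<le> ?far y t"
          using True t by (subst ennreal_mult'[symmetric]) (auto intro!: ennreal_leI)
        then show ?thesis by (rule order.trans) simp
      qed
    qed (auto simp: indicator_def)
  qed
  also have "\<dots> = (\<integral>\<^sup>+y. \<integral>\<^sup>+t. ?near y t \<partial>lborel \<partial>lborel) + (\<integral>\<^sup>+y. \<integral>\<^sup>+t. ?far y t \<partial>lborel \<partial>lborel)"
    by (simp add: nn_integral_add)
  also have "(\<integral>\<^sup>+y. \<integral>\<^sup>+t. ?near y t \<partial>lborel \<partial>lborel) = ennreal (?c * \<delta>) * emeasure lborel (cball (0::real^'n) 1)"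
  proof -
    have "(\<integral>\<^sup>+t. ?near y t \<partial>lborel) = ennreal (?c * \<delta>) * indicator (cball 0 1) y" for y :: "real^'n"
    proof -
      have "(\<integral>\<^sup>+t. ?near y t \<partial>lborel) = (\<integral>\<^sup>+t. (ennreal ?c * indicator (cball 0 1) y) * indicator {0..\<delta>} t \<partial>lborel)"
        by (intro nn_integral_cong) (auto simp: indicator_def)
      also have "\<dots> = (ennreal ?c * indicator (cball 0 1) y) * ennreal \<delta>"
        using \<delta> by (subst nn_integral_cmult_indicator) auto
      also have "\<dots> = ennreal (?c * \<delta>) * indicator (cball 0 1) y"
        using c0 \<delta> by (subst ennreal_mult'[of ?c \<delta>]) (auto simp: mult_ac)
      finally show ?thesis .
    qed
    then show ?thesis by (simp add: nn_integral_cmult_indicator)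
  qed
  also have "(\<integral>\<^sup>+y. \<integral>\<^sup>+t. ?far y t \<partial>lborel \<partial>lborel) = ennreal (2 ^ (k - 1)) *
     (\<integral>\<^sup>+y. \<integral>\<^sup>+t. ennreal (far_weight y t) \<partial>lborel \<partial>lborel)"
    by (simp add: nn_integral_cmult)
  also have "ennreal (?c * \<delta>) * emeasure lborel (cball (0::real^'n) 1) + \<dots> < \<infinity>"
    using G_far_polar emeasure_lborel_cball_finite[of "0::real^'n" 1]
    by (simp add: ennreal_mult_less_top)
  finally show ?thesis .
qed

text \<open>Dominated convergence: \<open>poisson_J 0\<close> is bounded by \<open>\<pi>\<close> and tends to \<open>0\<close> at infinity.\<close>

lemma bessel_error_tendsto_0: "(bessel_error \<longlongrightarrow> 0) at_top"
proof (rule tendsto_at_topI_sequentially)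
  fix X :: "nat \<Rightarrow> real" assume X: "filterlim X at_top sequentially"
  let ?g = "\<lambda>p::(real^'n) \<times> real. indicator (cball 0 1) (fst p) * (indicator {0..} (snd p) * ((1 + snd p) ^ (k - 1) * G (snd p *\<^sub>R sgn (fst p))))"
  let ?j = "\<lambda>i p::(real^'n) \<times> real. ennreal (\<bar>poisson_J 0 (X i * snd p)\<bar> * ?g p)"
  have g0: "?g p \<ge> 0" for p by (auto simp: indicator_def G_nonneg)
  have eq: "bessel_error (X i) = (\<integral>\<^sup>+p. ?j i p \<partial>(lborel \<Otimes>\<^sub>M lborel))" for i
    unfolding bessel_error_def
    by (subst lborel.nn_integral_fst[symmetric]) (auto simp: mult_ac)
  have "(\<lambda>i. \<integral>\<^sup>+p. ?j i p \<partial>(lborel \<Otimes>\<^sub>M lborel)) \<longlonglongrightarrow> (\<integral>\<^sup>+p. 0 \<partial>((lborel :: (real^'n) measure) \<Otimes>\<^sub>M (lborel :: real measure)))"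
  proof (rule nn_integral_dominated_convergence)
    show "AE p in lborel \<Otimes>\<^sub>M lborel. ?j i p \<le> ennreal pi * ennreal (?g p)" for i
    proof (rule AE_I2)
      fix p
      have "ennreal (\<bar>poisson_J 0 (X i * snd p)\<bar> * ?g p) \<le> ennreal (pi * ?g p)"
        by (intro ennreal_leI mult_right_mono abs_poisson_J_le g0)
      also have "\<dots> = ennreal pi * ennreal (?g p)" by (rule ennreal_mult') simp
      finally show "?j i p \<le> ennreal pi * ennreal (?g p)" .
    qed
    have "(\<integral>\<^sup>+p. ennreal (?g p) \<partial>(lborel \<Otimes>\<^sub>M lborel)) < \<infinity>"
      using majorant_finite by (subst lborel.nn_integral_fst[symmetric]) auto
    then show "(\<integral>\<^sup>+p. ennreal pi * ennreal (?g p) \<partial>(lborel \<Otimes>\<^sub>M lborel)) < \<infinity>"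
      by (subst nn_integral_cmult) (measurable, simp add: ennreal_mult_less_top)
    have ae: "AE t in (lborel :: real measure). t \<noteq> 0" by (rule AE_lborel_singleton)
    have "AE p in ((lborel :: (real^'n) measure) \<Otimes>\<^sub>M (lborel :: real measure)). snd p \<noteq> 0"
    proof (rule lborel_pair.AE_pair_measure)
      show "{p \<in> space ((lborel :: (real^'n) measure) \<Otimes>\<^sub>M (lborel :: real measure)). snd p \<noteq> 0}
          \<in> sets (lborel \<Otimes>\<^sub>M lborel)" by measurable
    qed (use ae in auto)
    then show "AE p in ((lborel :: (real^'n) measure) \<Otimes>\<^sub>M (lborel :: real measure)). (\<lambda>i. ?j i p) \<longlonglongrightarrow> 0"
    proof eventually_elim
      case (elim p)
      show ?case
      proof (cases "snd p > 0")
        case True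
        have "filterlim (\<lambda>i. X i * snd p) at_top sequentially"
          by (rule filterlim_at_top_mult_tendsto_pos[OF tendsto_const True X])
        then have "(\<lambda>i. poisson_J 0 (X i * snd p)) \<longlonglongrightarrow> 0" by (rule filterlim_compose[OF poisson_J_0_tendsto_0])
        then have "(\<lambda>i. \<bar>poisson_J 0 (X i * snd p)\<bar> * ?g p) \<longlonglongrightarrow> \<bar>0\<bar> * ?g p"
          by (intro tendsto_mult tendsto_rabs tendsto_const)
        then show ?thesis using tendsto_ennrealI by fastforce
      next
        case False
        then show ?thesis using elim by (simp add: indicator_def)
      qed
    qed
  qed measurable
  then show "(\<lambda>i. bessel_error (X i)) \<longlonglongrightarrow> 0" by (simp add: eq)
qed


abbreviation ray_integral :: "real \<Rightarrow> (real^'n \<Rightarrow> real) \<Rightarrow> real^'n \<Rightarrow> real \<Rightarrow> real^'n \<Rightarrow> real" where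
  "ray_integral R f x T y \<equiv>
     integral {0..T} (\<lambda>t. t ^ (2 * k - 1) * f (x + t *\<^sub>R sgn y) * radial_kernel R k t)"

text \<open>The boundary term at \<open>0\<close> that \<open>radial_by_parts\<close> produces for \<open>m = k\<close> and \<open>j = 0\<close>; the
  factor \<open>\<pi>\<close> is \<open>poisson_J 0 0\<close>.\<close>

abbreviation origin_value :: "(real^'n \<Rightarrow> real) \<Rightarrow> real^'n \<Rightarrow> real" where
  "origin_value f x \<equiv> 2 ^ (k - 1) * fact (k - 1) * (f x * pi)"

lemma ray_integral_error:
  fixes f :: "real^'n \<Rightarrow> real"
  assumes f: "C_k k f" and fG: "\<And>is z. length is \<le> k \<Longrightarrow> \<bar>foldr partial is f (x + z)\<bar> \<le> G z"
    and R: "R > 0" and B: "B \<ge> 0" "\<And>l t. l < k \<Longrightarrow> t \<ge> 0 \<Longrightarrow> t ^ l * \<bar>radial_kernel R l t\<bar> \<le> B"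
    and T: "T \<ge> 1"
  shows "ennreal \<bar>ray_integral R f x T y - origin_value f x\<bar> \<le>
    ennreal (radial_const k 0 + 1) * (ennreal (B * real CARD('n) ^ k) * ennreal (T ^ (k - 1) * G (T *\<^sub>R sgn y)) +
      ennreal (real CARD('n) ^ k) * (\<integral>\<^sup>+t. ennreal (ray_weight R y t) \<partial>lborel))"
    (is "_ \<le> ennreal ?C * (?S + ennreal ?N * ?q)")
proof -
  have C: "?C > 0" using radial_const_nonneg[of k 0] by simp
  have N: "?N \<ge> 1" using k by (intro one_le_power) simp
  have e: "norm (sgn y) \<le> 1" by (simp add: norm_sgn)
  show ?thesis
  \<comment> \<open>If the remaining integral is infinite, the bound is trivial; otherwise it is the number \<open>Q\<close> of \<open>radial_data\<close>.\<close>
  proof (cases "?q = \<infinity>")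
    case True
    then show ?thesis using C N by (simp add: ennreal_mult_top)
  next
    case False
    then obtain r where r: "r \<ge> 0" "?q = ennreal r" by (cases ?q) auto
    let ?u = "ray_deriv f x (sgn y)" and ?p = "radial_kernel R"
    have u: "\<bar>?u i t\<bar> \<le> ?N * G (t *\<^sub>R sgn y)" if "i \<le> k" for i t
    proof -
      have "\<bar>?u i t\<bar> \<le> real CARD('n) ^ i * G (t *\<^sub>R sgn y)"
        using that by (intro abs_ray_deriv_le[OF e] fG) auto
      also have "\<dots> \<le> ?N * G (t *\<^sub>R sgn y)"
        using that k by (intro mult_right_mono power_increasing G_nonneg) auto
      finally show ?thesis .
    qed
    have cont: "continuous_on A (?u i)" if "i \<le> k" for i A
      using continuous_ray_deriv[OF f that continuous_on_const continuous_on_id, of A x "sgn y"] by simp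
    have "radial_data (0 + k) k ?u ?p T B (?N * G (T *\<^sub>R sgn y)) (?N * r)"
      unfolding radial_data_def
    proof (intro conjI allI impI)
      fix i t assume "i < 0 + k"
      then show "(?u i has_real_derivative ?u (Suc i) t) (at t)"
        by (intro ray_deriv_has_derivative[OF f]) simp
    next
      fix l t show "(?p l has_real_derivative - t * ?p (Suc l) t) (at t)"
        by (rule radial_kernel_has_derivative)
    next
      fix i assume i: "1 \<le> i" "i \<le> 0 + k"
      let ?h = "\<lambda>t. t ^ (i - 1) * ?u i t * ?p 0 t"
      have ch: "continuous_on {0..T} ?h"
        using i by (intro continuous_intros cont) auto
      have "norm (integral {0..T} ?h) \<le> integral {0..T} (\<lambda>t. \<bar>?h t\<bar>)"
        by (rule integral_norm_bound_integral[OF integrable_continuous_interval[OF ch]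
              integrable_continuous_interval[OF continuous_on_rabs[OF ch]]]) simp
      then have "\<bar>integral {0..T} ?h\<bar> \<le> integral {0..T} (\<lambda>t. \<bar>?h t\<bar>)" by simp
      moreover have "ennreal (integral {0..T} (\<lambda>t. \<bar>?h t\<bar>)) \<le> ennreal (?N * r)"
      proof -
        have "ennreal (integral {0..T} (\<lambda>t. \<bar>?h t\<bar>)) = (\<integral>\<^sup>+t. ennreal \<bar>?h t\<bar> * indicator {0..T} t \<partial>lborel)"
          by (rule nn_integral_has_integral_lebesgue'[symmetric, OF abs_ge_zero
                integrable_integral[OF integrable_continuous_interval[OF continuous_on_rabs[OF ch]]]])
        also have "\<dots> \<le> (\<integral>\<^sup>+t. ennreal ?N * ennreal (ray_weight R y t) \<partial>lborel)"
        proof (rule nn_integral_mono)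
          fix t
          show "ennreal \<bar>?h t\<bar> * indicator {0..T} t \<le> ennreal ?N * ennreal (ray_weight R y t)"
          proof (cases "t \<in> {0..T}")
            case True
            have "t ^ (i - 1) \<le> (1 + t) ^ (i - 1)" using True by (intro power_mono) auto
            also have "\<dots> \<le> (1 + t) ^ (k - 1)" using True i by (intro power_increasing) auto
            finally have "\<bar>t ^ (i - 1)\<bar> * \<bar>?u i t\<bar> * \<bar>?p 0 t\<bar> \<le>
               (1 + t) ^ (k - 1) * (?N * G (t *\<^sub>R sgn y)) * \<bar>poisson_J 0 (R * t)\<bar>"
              unfolding radial_kernel_0 using True i G_nonneg[of "t *\<^sub>R sgn y"]
              by (intro mult_mono u mult_nonneg_nonneg) auto
            then have "\<bar>?h t\<bar> \<le> ?N * (ray_weight R y t)"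
              using True by (simp add: abs_mult mult_ac)
            then show ?thesis using True N by (subst ennreal_mult'[symmetric]) (auto intro!: ennreal_leI)
          qed simp
        qed
        also have "\<dots> = ennreal (?N * r)"
          using N r by (subst nn_integral_cmult) (auto simp: ennreal_mult' measurable_poisson_J)
        finally show ?thesis .
      qed
      then have "integral {0..T} (\<lambda>t. \<bar>?h t\<bar>) \<le> ?N * r" using N r by (simp add: ennreal_le_iff)
      ultimately show "\<bar>integral {0..T} ?h\<bar> \<le> ?N * r" by linarith
    qed (use T B u cont in \<open>auto intro!: continuous_radial_kernel continuous_on_id\<close>)
    from radial_by_parts[OF this] k
    have le: "\<bar>ray_integral R f x T y - origin_value f x\<bar> \<le>
        radial_const k 0 * (B * T ^ (k - 1) * (?N * G (T *\<^sub>R sgn y)) + ?N * r)"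
      by (simp add: ray_deriv_0 radial_kernel_0 poisson_J_0_0)
    also have "\<dots> \<le> ?C * (B * T ^ (k - 1) * (?N * G (T *\<^sub>R sgn y)) + ?N * r)"
      using B T G_nonneg r N by (intro mult_right_mono) auto
    finally have "ennreal \<bar>ray_integral R f x T y - origin_value f x\<bar> \<le>
      ennreal (?C * ((B * ?N) * (T ^ (k - 1) * G (T *\<^sub>R sgn y)) + ?N * r))"
      by (intro ennreal_leI) (simp add: mult_ac)
    also have "\<dots> = ennreal ?C * (?S + ennreal ?N * ?q)"
      using B T G_nonneg[of "T *\<^sub>R sgn y"] r C by (simp add: ennreal_mult' ennreal_plus)
    finally show ?thesis .
  qed
qed

text \<open>Polar coordinates reduce the integral over the ball of radius \<open>T\<close> to the rays.  The integrals of the boundary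
  terms at \<open>T\<close> give \<open>shell_mean T\<close>, the rest gives \<open>bessel_error R\<close>.\<close>

lemma truncated_integral_error:
  fixes f :: "real^'n \<Rightarrow> real"
  assumes f: "C_k k f" and fG: "\<And>is z. length is \<le> k \<Longrightarrow> \<bar>foldr partial is f (x + z)\<bar> \<le> G z"
    and R: "R > 0" and B: "B \<ge> 0" "\<And>l t. l < k \<Longrightarrow> t \<ge> 0 \<Longrightarrow> t ^ l * \<bar>radial_kernel R l t\<bar> \<le> B"
    and T: "T \<ge> 1"
  shows "ennreal \<bar>(LINT z|lborel. indicator (cball 0 T) z * (f (x + z) * radial_kernel R k (norm z)))
      - real CARD('n) * unit_ball_vol (real CARD('n)) * origin_value f x\<bar> \<le>
    ennreal (real CARD('n) * (radial_const k 0 + 1)) * (ennreal (B * real CARD('n) ^ k) * shell_mean T +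
      ennreal (real CARD('n) ^ k) * bessel_error R)"
proof -
  let ?n = "real CARD('n)"
  let ?H = "\<lambda>z. indicator (cball 0 T) z * (f (x + z) * radial_kernel R k (norm z))"
  let ?q = "\<lambda>(y::real^'n) t::real. ?n * (indicator (cball 0 1) y * (indicator {0<..} t * t ^ (CARD('n) - 1)))"
  let ?\<Psi> = "\<lambda>p. ?q (fst p) (snd p) * ?H (snd p *\<^sub>R sgn (fst p))"
  let ?c = "origin_value f x"
  have contf: "continuous_on UNIV f" by (rule C_k_continuous[OF f])
  then have [measurable]: "f \<in> borel_measurable borel" by (rule borel_measurable_continuous_onI)
  have H: "integrable lborel ?H"
  proof -
    have "continuous_on (cball 0 T) (\<lambda>z. f (x + z) * radial_kernel R k (norm z))"
      by (intro continuous_intros continuous_on_compose2[OF contf]) auto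
    from borel_integrable_compact[OF compact_cball this] show ?thesis by simp
  qed
  have q0: "?q y t \<ge> 0" for y t by (auto simp: indicator_def)
  have Hm: "?H \<in> borel_measurable borel" by measurable
  have Hcone: "integrable (cone_measure :: ((real^'n) \<times> real) measure) (\<lambda>p. ?H (snd p *\<^sub>R sgn (fst p)))"
    "(LINT z|lborel. ?H z) = (LINT p|cone_measure. ?H (snd p *\<^sub>R sgn (fst p)))"
  proof -
    have sg: "(\<lambda>p::(real^'n) \<times> real. snd p *\<^sub>R sgn (fst p)) \<in> measurable cone_measure borel"
      unfolding cone_measure_def by measurable
    have lb: "lborel = distr cone_measure borel (\<lambda>p::(real^'n) \<times> real. snd p *\<^sub>R sgn (fst p))"
      using lborel_polar[where 'a="real^'n"] by (simp add: case_prod_unfold)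
    show "integrable (cone_measure :: ((real^'n) \<times> real) measure) (\<lambda>p. ?H (snd p *\<^sub>R sgn (fst p)))"
      using H integrable_distr_eq[OF sg Hm] lb by simp
    show "(LINT z|lborel. ?H z) = (LINT p|cone_measure. ?H (snd p *\<^sub>R sgn (fst p)))"
      using integral_distr[OF sg Hm] lb by simp
  qed
  have Hpm: "(\<lambda>p::(real^'n) \<times> real. ?H (snd p *\<^sub>R sgn (fst p))) \<in> borel_measurable (lborel \<Otimes>\<^sub>M lborel)"
    by measurable
  have qm: "(\<lambda>p. ?q (fst p) (snd p)) \<in> borel_measurable (lborel \<Otimes>\<^sub>M lborel)" by measurable
  have cone: "(cone_measure :: ((real^'n) \<times> real) measure) = density (lborel \<Otimes>\<^sub>M lborel) (\<lambda>p. ennreal (?q (fst p) (snd p)))"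
    by (simp add: cone_measure_def case_prod_unfold)
  have \<Psi>: "integrable (lborel \<Otimes>\<^sub>M lborel) ?\<Psi>" "(LINT z|lborel. ?H z) = (LINT p|(lborel \<Otimes>\<^sub>M lborel). ?\<Psi> p)"
    using Hcone(1) integrable_density[OF Hpm qm AE_I2[OF q0]]
      Hcone(2) integral_density[OF Hpm qm AE_I2[OF q0]] by (simp_all add: cone)
  \<comment> \<open>\<open>\<phi> y\<close> is the contribution of the ray in direction \<open>y\<close>.\<close>
  define \<phi> where "\<phi> y = (LINT t|lborel. ?\<Psi> (y, t))" for y
  have \<phi>: "integrable lborel \<phi>" "(LINT z|lborel. ?H z) = (LINT y|lborel. \<phi> y)"
    unfolding \<phi>_def \<Psi>(2)
    by (rule lborel_pair.integrable_fst'[OF \<Psi>(1)]) (rule lborel_pair.integral_fst'[OF \<Psi>(1), symmetric])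
  have \<phi>_eq: "\<phi> y = ?n * indicator (cball 0 1) y * ray_integral R f x T y" if "y \<noteq> 0" for y
  proof -
    let ?h = "\<lambda>t. t ^ (2 * k - 1) * f (x + t *\<^sub>R sgn y) * radial_kernel R k t"
    have ch: "continuous_on {0..T} ?h"
      by (intro continuous_intros continuous_on_compose2[OF contf]) auto
    have "\<phi> y = (LINT t|lborel. ?n * indicator (cball 0 1) y * (indicator {0..T} t *\<^sub>R ?h t))"
      unfolding \<phi>_def fst_conv snd_conv
    proof (rule integral_cong_AE)
      have "AE t in lborel. t \<noteq> (0::real)" by (rule AE_lborel_singleton)
      then show "AE t in lborel. ?q y t * ?H (t *\<^sub>R sgn y) = ?n * indicator (cball 0 1) y * (indicator {0..T} t *\<^sub>R ?h t)"
      proof eventually_elim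
        case (elim t)
        show ?case
        proof (cases "t > 0")
          case True
          then have nrm: "norm (t *\<^sub>R sgn y) = t" using that by (simp add: norm_sgn)
          then show ?thesis using True k by (simp add: indicator_def)
        next
          case False
          then show ?thesis using elim by simp
        qed
      qed
    qed measurable
    also have "\<dots> = ?n * indicator (cball 0 1) y * (LINT t:{0..T}|lborel. ?h t)"
      unfolding set_lebesgue_integral_def by simp
    also have "(LINT t:{0..T}|lborel. ?h t) = ray_integral R f x T y"
      by (rule set_borel_integral_eq_integral(2), rule borel_integrable_atLeastAtMost'[OF ch])
    finally show ?thesis .
  qed
  have ballint: "integrable lborel (\<lambda>y::real^'n. ?n * indicator (cball 0 1) y * ?c)"
    using emeasure_lborel_cball_finite[of "0::real^'n" 1] by (intro integrable_mult_left integrable_mult_right) auto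
  have vol: "(LINT y|lborel. ?n * indicator (cball (0::real^'n) 1) y * ?c) = ?n * unit_ball_vol (real CARD('n)) * ?c"
  proof -
    have "measure lborel (cball (0::real^'n) 1) = unit_ball_vol (real CARD('n))"
      using content_cball[of 1 "0::real^'n"] by simp
    then show ?thesis by simp
  qed
  have "(LINT z|lborel. ?H z) - ?n * unit_ball_vol (real CARD('n)) * ?c
     = (LINT y|lborel. \<phi> y - ?n * indicator (cball 0 1) y * ?c)"
    unfolding \<phi>(2) Bochner_Integration.integral_diff[OF \<phi>(1) ballint] vol ..
  then have "ennreal \<bar>(LINT z|lborel. ?H z) - ?n * unit_ball_vol (real CARD('n)) * ?c\<bar> \<le>
     (\<integral>\<^sup>+y. norm (\<phi> y - ?n * indicator (cball 0 1) y * ?c) \<partial>lborel)"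
    using integral_norm_bound_ennreal[OF Bochner_Integration.integrable_diff[OF \<phi>(1) ballint]] by simp
  also have "\<dots> \<le> (\<integral>\<^sup>+y. ennreal (?n * (radial_const k 0 + 1)) *
      (ennreal (B * ?n ^ k) * ennreal (indicator (cball 0 1) y * (T ^ (k - 1) * G (T *\<^sub>R sgn y))) +
       ennreal (?n ^ k) * (\<integral>\<^sup>+t. ennreal (indicator (cball 0 1) y * (ray_weight R y t)) \<partial>lborel)) \<partial>lborel)"
  proof (rule nn_integral_mono_AE)
    have "AE y in lborel. y \<noteq> (0::real^'n)" by (rule AE_lborel_singleton)
    then show "AE y in lborel. ennreal (norm (\<phi> y - ?n * indicator (cball 0 1) y * ?c)) \<le>
       ennreal (?n * (radial_const k 0 + 1)) *
      (ennreal (B * ?n ^ k) * ennreal (indicator (cball 0 1) y * (T ^ (k - 1) * G (T *\<^sub>R sgn y))) +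
       ennreal (?n ^ k) * (\<integral>\<^sup>+t. ennreal (indicator (cball 0 1) y * (ray_weight R y t)) \<partial>lborel))"
    proof eventually_elim
      case (elim y)
      show ?case
      proof (cases "y \<in> cball 0 1")
        case True
        have "\<phi> y - ?n * indicator (cball 0 1) y * ?c = ?n * (ray_integral R f x T y - ?c)"
          using True by (simp add: \<phi>_eq[OF elim] right_diff_distrib del: mem_cball_0)
        then have "ennreal (norm (\<phi> y - ?n * indicator (cball 0 1) y * ?c)) = ennreal ?n * ennreal \<bar>ray_integral R f x T y - ?c\<bar>"
          by (simp add: abs_mult ennreal_mult')
        also have "\<dots> \<le> ennreal ?n * (ennreal (radial_const k 0 + 1) * (ennreal (B * ?n ^ k) * ennreal (T ^ (k - 1) * G (T *\<^sub>R sgn y)) +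
      ennreal (?n ^ k) * (\<integral>\<^sup>+t. ennreal (ray_weight R y t) \<partial>lborel)))"
          by (intro mult_left_mono ray_integral_error[OF f fG R B T]) auto
        finally show ?thesis using True by (simp add: ennreal_mult' mult.assoc)
      qed (simp add: \<phi>_eq[OF elim])
    qed
  qed
  also have "\<dots> = ennreal (?n * (radial_const k 0 + 1)) * (ennreal (B * ?n ^ k) * shell_mean T +
      ennreal (?n ^ k) * bessel_error R)"
    unfolding shell_mean_def bessel_error_def
    by (simp add: nn_integral_cmult nn_integral_add measurable_poisson_J)
  finally show ?thesis .
qed

text \<open>Letting \<open>T\<close> tend to infinity along radii for which \<open>shell_mean T\<close> is small removes the boundary
  terms.  Their constant \<open>B\<close> depends on \<open>R\<close>, but \<open>R\<close> is fixed here.\<close>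

lemma radial_integral_error:
  fixes f :: "real^'n \<Rightarrow> real"
  assumes f: "C_k k f" and fG: "\<And>is z. length is \<le> k \<Longrightarrow> \<bar>foldr partial is f (x + z)\<bar> \<le> G z"
    and R: "R > 0" and int: "integrable lborel (\<lambda>z. f (x + z))"
  shows "ennreal \<bar>(LINT z|lborel. f (x + z) * radial_kernel R k (norm z))
      - real CARD('n) * unit_ball_vol (real CARD('n)) * origin_value f x\<bar> \<le>
    ennreal (real CARD('n) * (radial_const k 0 + 1) * real CARD('n) ^ k) * bessel_error R"
    (is "ennreal \<bar>?A - ?L\<bar> \<le> _")
proof (rule ennreal_le_epsilon)
  fix \<epsilon> :: real assume \<epsilon>: "\<epsilon> > 0"
  let ?n = "real CARD('n)"
  let ?C = "?n * (radial_const k 0 + 1)"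
  obtain B where B: "B \<ge> 0" "\<And>l t. l < k \<Longrightarrow> t \<ge> 0 \<Longrightarrow> t ^ l * \<bar>radial_kernel R l t\<bar> \<le> B"
    using radial_kernel_decay[OF R, of k] by blast
  let ?A' = "\<lambda>T. LINT z|lborel. indicator (cball 0 T) z * (f (x + z) * radial_kernel R k (norm z))"
  have [measurable]: "f \<in> borel_measurable borel" by (rule borel_measurable_continuous_onI[OF C_k_continuous[OF f]])
  have C: "?C > 0" using radial_const_nonneg[of k 0] k by simp
  define M where "M = R ^ (2 * k) * pi / odd_fact k"
  have M: "\<bar>radial_kernel R k t\<bar> \<le> M" for t
    unfolding M_def using R by (intro abs_radial_kernel_le) simp
  then have "M \<ge> 0" by (meson abs_ge_zero order.trans)
  have "(?A' \<longlongrightarrow> ?A) at_top"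
  proof (rule integral_dominated_convergence_at_top[where w="\<lambda>z. \<bar>f (x + z)\<bar> * M"])
    show "\<forall>\<^sub>F T in at_top. AE z in lborel. norm (indicator (cball 0 T) z * (f (x + z) * radial_kernel R k (norm z)))
        \<le> \<bar>f (x + z)\<bar> * M"
      using M \<open>M \<ge> 0\<close>
      by (intro always_eventually allI AE_I2) (auto simp: abs_mult indicator_def intro!: mult_left_mono)
    show "AE z in lborel. ((\<lambda>T. indicator (cball 0 T) z * (f (x + z) * radial_kernel R k (norm z)))
        \<longlongrightarrow> f (x + z) * radial_kernel R k (norm z)) at_top"
    proof (intro AE_I2 tendsto_eventually)
      fix z :: "real^'n"
      show "\<forall>\<^sub>F T in at_top. indicator (cball 0 T) z * (f (x + z) * radial_kernel R k (norm z)) = f (x + z) * radial_kernel R k (norm z)"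
        using eventually_ge_at_top[of "norm z"] by eventually_elim simp
    qed
  qed (use int in auto)
  then have "\<forall>\<^sub>F T in at_top. dist (?A' T) ?A < \<epsilon> / 2" using \<epsilon> by (intro tendstoD) auto
  then obtain N where N: "\<And>T. T \<ge> N \<Longrightarrow> \<bar>?A' T - ?A\<bar> < \<epsilon> / 2"
    by (auto simp: eventually_at_top_linorder dist_real_def)
  \<comment> \<open>This \<open>\<eta>\<close> absorbs the constant in front of \<open>shell_mean T\<close>; the summand \<open>1\<close> covers the case that the constant is \<open>0\<close>.\<close>
  define \<eta> where "\<eta> = \<epsilon> / (2 * (?C * (B * ?n ^ k) + 1))"
  have CB: "?C * (B * ?n ^ k) \<ge> 0" using C B by simp
  then have \<eta>: "\<eta> > 0" "?C * (B * ?n ^ k) * \<eta> \<le> \<epsilon> / 2"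
    using \<epsilon> by (auto simp: \<eta>_def field_simps add_nonneg_pos)
  obtain T where T: "T \<ge> max N 1" "shell_mean T < ennreal \<eta>" using shell_mean_small[OF \<eta>(1)] by blast
  have "\<bar>?A - ?L\<bar> \<le> \<bar>?A' T - ?L\<bar> + \<epsilon> / 2" using N[of T] T(1) by linarith
  then have "ennreal \<bar>?A - ?L\<bar> \<le> ennreal \<bar>?A' T - ?L\<bar> + ennreal (\<epsilon> / 2)"
    using \<epsilon> by (simp add: ennreal_leI flip: ennreal_plus)
  also have "ennreal \<bar>?A' T - ?L\<bar> \<le> ennreal ?C * (ennreal (B * ?n ^ k) * shell_mean T + ennreal (?n ^ k) * bessel_error R)"
    using T(1) by (intro truncated_integral_error[OF f fG R B]) auto
  also have "\<dots> \<le> ennreal ?C * (ennreal (B * ?n ^ k) * ennreal \<eta> + ennreal (?n ^ k) * bessel_error R)"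
    using T(2) by (intro mult_left_mono add_right_mono) auto
  also have "\<dots> = ennreal (?C * (B * ?n ^ k) * \<eta>) + ennreal (?C * ?n ^ k) * bessel_error R"
    using C B \<eta> by (simp add: distrib_left ennreal_mult' mult.assoc)
  also have "\<dots> \<le> ennreal (\<epsilon> / 2) + ennreal (?C * ?n ^ k) * bessel_error R"
    using \<eta>(2) by (intro add_right_mono ennreal_leI)
  finally have "ennreal \<bar>?A - ?L\<bar> \<le> (ennreal (\<epsilon> / 2) + ennreal (?C * ?n ^ k) * bessel_error R) + ennreal (\<epsilon> / 2)"
    by (simp add: add_right_mono)
  also have "\<dots> = ennreal (?C * ?n ^ k) * bessel_error R + ennreal \<epsilon>"
    using \<epsilon> by (simp add: add.assoc add.commute add.left_commute flip: ennreal_plus)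
  finally show "ennreal \<bar>?A - ?L\<bar> \<le> ennreal (?C * ?n ^ k) * bessel_error R + ennreal \<epsilon>" .
qed

end

section \<open>From scalar to vector-valued functions\<close>

lemma odd_fact_eq: "odd_fact k = fact (2 * k) / (2 ^ k * fact k)"
proof -
  have "odd_fact k * (2 ^ k * fact k) = fact (2 * k)"
  proof (induction k)
    case (Suc k)
    have "odd_fact (Suc k) * (2 ^ Suc k * fact (Suc k)) =
        (odd_fact k * (2 ^ k * fact k)) * ((2 * real k + 1) * (2 * real k + 2))"
      by (simp add: odd_fact_def algebra_simps)
    also have "\<dots> = fact (2 * Suc k)" unfolding Suc.IH by (simp add: algebra_simps)
    finally show ?case .
  qed (simp add: odd_fact_def)
  then show ?thesis by (simp add: field_simps)
qed

text \<open>The product of all constants: the normalisation of the inverse Fourier transform and the kernel on one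
  side, the surface of the unit sphere and the boundary term at \<open>0\<close> on the other.  That it equals one is what makes
  the limit \<open>F(x)\<close> and not a multiple of it.\<close>

lemma kernel_constant:
  assumes "k \<ge> 1"
  shows "unit_ball_vol (real (2 * k - 1)) * odd_fact k / (2 * pi) ^ (2 * k) *
    (real (2 * k) * unit_ball_vol (real (2 * k)) * (2 ^ (k - 1) * fact (k - 1) * pi)) = 1"
proof -
  obtain j where k: "k = Suc j" using assms by (cases k) auto
  have "2 * k - 1 = 2 * j + 1" by (simp add: k)
  then have V1: "unit_ball_vol (real (2 * k - 1)) = 2 ^ (2 * k) * fact k / fact (2 * k) * pi ^ j"
    using unit_ball_vol_odd[of j] by (simp only: k)
  have p: "(2 * pi) ^ (2 * k) = 2 ^ (2 * k) * pi ^ j * pi * pi ^ k"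
  proof -
    have "2 * k = (j + 1) + k" by (simp add: k)
    then have "pi ^ (2 * k) = pi ^ j * pi * pi ^ k" by (simp only: power_add power_one_right)
    then show ?thesis by (simp only: power_mult_distrib mult.assoc)
  qed
  have cancel: "c * B / A * P * (A / (d * B)) / (c * P * pi * q) * (2 * K * (q / B) * (e * g * pi)) = 1"
    if "d = 2 * e" "B = K * g" "A \<noteq> 0" "K \<noteq> 0" "g \<noteq> 0" "e \<noteq> 0" "c \<noteq> 0" "P \<noteq> 0" "q \<noteq> 0"
    for A B c d e g K P q :: real
    using that by (simp add: field_simps)
  have "real (2 * k) = 2 * real k" "k - 1 = j" by (simp_all add: k)
  then show ?thesis
    unfolding V1 unit_ball_vol_even odd_fact_eq p by (simp only:) (rule cancel; simp add: k)
qed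

definition ball_kernel :: "real \<Rightarrow> real^'n \<Rightarrow> real" where
  "ball_kernel R z = (LINT \<xi>|lborel. indicator (cball 0 R) \<xi> * cos (z \<bullet> \<xi>)) / (2 * pi) ^ CARD('n)"

lemma (in ray_majorant) ball_kernel_error:
  fixes f :: "real^'n \<Rightarrow> real"
  assumes f: "C_k k f" and fG: "\<And>is z. length is \<le> k \<Longrightarrow> \<bar>foldr partial is f (x + z)\<bar> \<le> G z"
    and R: "R > 0" and int: "integrable lborel (\<lambda>z. f (x + z))"
  shows "ennreal \<bar>(LINT z|lborel. f (x + z) * ball_kernel R z) - f x\<bar> \<le>
    ennreal (unit_ball_vol (real (2 * k - 1)) * odd_fact k / (2 * pi) ^ (2 * k) *
      (real CARD('n) * (radial_const k 0 + 1) * real CARD('n) ^ k)) * bessel_error R"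
proof -
  define \<kappa> where "\<kappa> = unit_ball_vol (real (2 * k - 1)) * odd_fact k / (2 * pi) ^ (2 * k)"
  have \<kappa>: "\<kappa> > 0" unfolding \<kappa>_def using odd_fact_pos[of k]
    by (intro divide_pos_pos mult_pos_pos unit_ball_vol_pos zero_less_power) auto
  have kern: "ball_kernel R z = \<kappa> * radial_kernel R k (norm z)" for z :: "real^'n"
    unfolding ball_kernel_def ball_fourier_integral[OF k R] \<kappa>_def radial_kernel_def
    using odd_fact_pos[of k] k by simp
  have L: "f x = \<kappa> * (real CARD('n) * unit_ball_vol (real CARD('n)) * origin_value f x)"
  proof -
    have "\<kappa> * (real CARD('n) * unit_ball_vol (real CARD('n)) * origin_value f x) =
      (\<kappa> * (real (2 * k) * unit_ball_vol (real (2 * k)) * (2 ^ (k - 1) * fact (k - 1) * pi))) * f x"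
      unfolding k(2) by (simp only: mult_ac)
    moreover have "\<kappa> * (real (2 * k) * unit_ball_vol (real (2 * k)) * (2 ^ (k - 1) * fact (k - 1) * pi)) = 1"
      unfolding \<kappa>_def by (rule kernel_constant[OF k(1)])
    ultimately show ?thesis by (simp only: mult_1)
  qed
  have "(LINT z|lborel. f (x + z) * ball_kernel R z) = \<kappa> * (LINT z|lborel. f (x + z) * radial_kernel R k (norm z))"
    unfolding kern by (simp add: mult.left_commute)
  then have "(LINT z|lborel. f (x + z) * ball_kernel R z) - f x = \<kappa> * ((LINT z|lborel. f (x + z) * radial_kernel R k (norm z))
      - real CARD('n) * unit_ball_vol (real CARD('n)) * origin_value f x)"
    by (subst L) (simp only: right_diff_distrib)
  then have "ennreal \<bar>(LINT z|lborel. f (x + z) * ball_kernel R z) - f x\<bar> = ennreal \<kappa> * ennreal \<bar>(LINT z|lborel. f (x + z) * radial_kernel R k (norm z))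
      - real CARD('n) * unit_ball_vol (real CARD('n)) * origin_value f x\<bar>"
    using \<kappa> by (simp add: abs_mult ennreal_mult')
  also have "\<dots> \<le> ennreal \<kappa> * (ennreal (real CARD('n) * (radial_const k 0 + 1) * real CARD('n) ^ k) * bessel_error R)"
    by (intro mult_left_mono radial_integral_error[OF f fG R int]) auto
  also have "\<dots> = ennreal (\<kappa> * (real CARD('n) * (radial_const k 0 + 1) * real CARD('n) ^ k)) * bessel_error R"
    using \<kappa> by (subst ennreal_mult') (auto simp: mult.assoc)
  finally show ?thesis unfolding \<kappa>_def .
qed

lemma linear_scaleC: "linear (\<lambda>v::'a::complex_banach. c *\<^sub>C v)"
proof
  show "c *\<^sub>C r *\<^sub>R v = r *\<^sub>R (c *\<^sub>C v)" for r and v :: 'a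
    by (simp add: scaleC_of_real[symmetric] scaleC_scaleC mult.commute)
qed (rule scaleC_add_right)

lemma continuous_on_scaleC [continuous_intros]:
  fixes v :: "'s::topological_space \<Rightarrow> 'a::complex_banach"
  assumes "continuous_on A c" "continuous_on A v"
  shows "continuous_on A (\<lambda>x. c x *\<^sub>C v x)"
proof -
  have "bounded_bilinear (\<lambda>c (v::'a). c *\<^sub>C v)"
  proof
    show "(r *\<^sub>R c) *\<^sub>C v = r *\<^sub>R (c *\<^sub>C v)" for r c and v :: 'a
      unfolding scaleR_conv_of_real[of r c] scaleC_scaleC[symmetric] by (rule scaleC_of_real)
    show "\<exists>K. \<forall>c (v::'a). norm (c *\<^sub>C v) \<le> norm c * norm v * K"
      by (intro exI[of _ 1]) (simp add: norm_scaleC)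
  qed (auto simp: scaleC_add_left scaleC_add_right linear_scale[OF linear_scaleC])
  from bounded_bilinear.continuous_on[OF this assms] show ?thesis .
qed

lemma norm_banach_integral_diff_le:
  fixes f g :: "'s \<Rightarrow> 'a::real_normed_vector"
  assumes f: "banach_integrable M f" and g: "banach_integrable M g"
  shows "ennreal (norm (banach_integral M f - banach_integral M g)) \<le> (\<integral>\<^sup>+x. norm (f x - g x) \<partial>M)"
proof -
  let ?v = "banach_integral M f - banach_integral M g"
  obtain \<phi> where \<phi>: "linear \<phi>" "\<And>x. \<bar>\<phi> x\<bar> \<le> norm x" "\<phi> ?v = norm ?v"
    using norming_functional[of ?v] by blast
  have le: "\<And>v. \<bar>\<phi> v\<bar> \<le> 1 * norm v" using \<phi>(2) by simp
  note If = banach_integral_functional[OF f \<phi>(1) le] and Ig = banach_integral_functional[OF g \<phi>(1) le]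
  have "norm ?v = (LINT x|M. \<phi> (f x) - \<phi> (g x))"
    using \<phi>(3) If Ig by (simp add: linear_diff[OF \<phi>(1)])
  also have "\<dots> = (LINT x|M. \<phi> (f x - g x))" by (simp add: linear_diff[OF \<phi>(1)])
  finally have "ennreal (norm ?v) \<le> ennreal (norm (LINT x|M. \<phi> (f x - g x)))" by (intro ennreal_leI) simp
  also have "\<dots> \<le> (\<integral>\<^sup>+x. norm (\<phi> (f x - g x)) \<partial>M)"
    using Bochner_Integration.integrable_diff[OF If(1) Ig(1)]
    by (intro integral_norm_bound_ennreal) (simp add: linear_diff[OF \<phi>(1)])
  also have "\<dots> \<le> (\<integral>\<^sup>+x. norm (f x - g x) \<partial>M)"
    using \<phi>(2) by (intro nn_integral_mono ennreal_leI) simp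
  finally show ?thesis .
qed

lemma banach_integrable_character_scaleC:
  fixes F :: "real^'n \<Rightarrow> 'a::complex_banach"
  assumes F: "continuous_on UNIV F" "banach_integrable lborel F"
  shows "banach_integrable lborel (\<lambda>s. exp (- \<i> * of_real (\<xi> \<bullet> s)) *\<^sub>C F s)"
proof -
  have "continuous_on UNIV (\<lambda>s. exp (- \<i> * of_real (\<xi> \<bullet> s)) *\<^sub>C F s)"
    by (intro continuous_intros F)
  moreover have "norm (exp (- \<i> * of_real (\<xi> \<bullet> s)) *\<^sub>C F s) = norm (F s)" for s
    by (simp add: norm_scaleC)
  ultimately show ?thesis
    using banach_integrable_continuous_on[of UNIV "\<lambda>s. exp (- \<i> * of_real (\<xi> \<bullet> s)) *\<^sub>C F s"]
      banach_integrable_norm_finite[OF F(2)] by simp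
qed

text \<open>Continuity is needed to integrate \<open>fourier F\<close> over a ball: it is integrable by
  \<open>banach_integrable_continuous_on\<close>.\<close>

lemma continuous_on_fourier:
  fixes F :: "real^'n \<Rightarrow> 'a::complex_banach"
  assumes F: "continuous_on UNIV F" "banach_integrable lborel F"
  shows "continuous_on UNIV (fourier F)"
  unfolding continuous_on_sequentially
proof (intro allI ballI impI)
  fix X \<xi> assume X: "(\<forall>n. X n \<in> UNIV) \<and> X \<longlonglongrightarrow> (\<xi> :: real^'n)"
  let ?e = "\<lambda>\<xi> s. exp (- \<i> * of_real (\<xi> \<bullet> s)) :: complex"
  let ?g = "\<lambda>i s. ennreal (norm (?e (X i) s *\<^sub>C F s - ?e \<xi> s *\<^sub>C F s))"
  have [measurable]: "(\<lambda>s. norm (F s)) \<in> borel_measurable borel"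
    by (intro borel_measurable_continuous_onI continuous_intros F)
  have "(\<lambda>i. \<integral>\<^sup>+s. ?g i s \<partial>lborel) \<longlonglongrightarrow> (\<integral>\<^sup>+s. 0 \<partial>(lborel :: (real^'n) measure))"
  proof (rule nn_integral_dominated_convergence[where w="\<lambda>s. ennreal 2 * ennreal (norm (F s))"])
    show "?g i \<in> borel_measurable lborel" for i
      by (auto intro!: borel_measurable_continuous_onI continuous_intros F measurable_compose[OF _ measurable_ennreal])
    show "AE s in lborel. ?g i s \<le> ennreal 2 * ennreal (norm (F s))" for i
    proof (rule AE_I2)
      fix s
      have "norm (?e (X i) s *\<^sub>C F s - ?e \<xi> s *\<^sub>C F s) \<le> 2 * norm (F s)"
        using norm_triangle_ineq4[of "?e (X i) s *\<^sub>C F s" "?e \<xi> s *\<^sub>C F s"] by (simp add: norm_scaleC)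
      then show "?g i s \<le> ennreal 2 * ennreal (norm (F s))"
        by (subst ennreal_mult[symmetric]) (auto intro!: ennreal_leI)
    qed
    show "(\<integral>\<^sup>+s. ennreal 2 * ennreal (norm (F s)) \<partial>lborel) < \<infinity>"
      using banach_integrable_norm_finite[OF F(2)]
      by (subst nn_integral_cmult) (auto simp: ennreal_mult_less_top)
    show "AE s in lborel. (\<lambda>i. ?g i s) \<longlonglongrightarrow> 0"
    proof (rule AE_I2)
      fix s
      have "continuous_on UNIV (\<lambda>\<xi>. norm (?e \<xi> s *\<^sub>C F s - ?e \<xi>' s *\<^sub>C F s))" for \<xi>'
        by (intro continuous_intros)
      from continuous_on_tendsto_compose[OF this, of X \<xi> sequentially \<xi>] X
      have "(\<lambda>i. norm (?e (X i) s *\<^sub>C F s - ?e \<xi> s *\<^sub>C F s)) \<longlonglongrightarrow> 0" by simp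
      then show "(\<lambda>i. ?g i s) \<longlonglongrightarrow> 0" using tendsto_ennrealI by fastforce
    qed
  qed auto
  then have lim: "(\<lambda>i. \<integral>\<^sup>+s. ?g i s \<partial>lborel) \<longlonglongrightarrow> 0" by simp
  have "(\<lambda>i. ennreal (dist (fourier F (X i)) (fourier F \<xi>))) \<longlonglongrightarrow> 0"
  proof (rule tendsto_sandwich[OF _ _ tendsto_const lim])
    show "\<forall>\<^sub>F i in sequentially. ennreal (dist (fourier F (X i)) (fourier F \<xi>)) \<le> (\<integral>\<^sup>+s. ?g i s \<partial>lborel)"
      unfolding fourier_def dist_norm
      by (intro always_eventually allI norm_banach_integral_diff_le banach_integrable_character_scaleC F)
  qed simp
  then have "(\<lambda>i. dist (fourier F (X i)) (fourier F \<xi>)) \<longlonglongrightarrow> 0"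
    using ennreal_tendsto_0_iff by force
  then show "(fourier F \<circ> X) \<longlonglongrightarrow> fourier F \<xi>"
    unfolding o_def by (subst tendsto_dist_iff)
qed

lemma LINT_ball_sin: "(LINT \<xi>|lborel. indicator (cball 0 R) \<xi> * sin (w \<bullet> \<xi>)) = (0::real)"
  for w :: "'a::euclidean_space"
proof -
  have orth: "orthogonal_transformation (uminus :: 'a \<Rightarrow> 'a)"
    by (simp add: orthogonal_transformation_def linear_iff)
  have "(LINT \<xi>|lborel. indicator (cball 0 R) \<xi> * sin (w \<bullet> \<xi>)) =
    (LINT \<xi>|distr lborel borel uminus. indicator (cball 0 R) \<xi> * sin (w \<bullet> \<xi>))"
    by (simp add: lborel_distr_orthogonal[OF orth])
  also have "\<dots> = (LINT \<xi>|lborel. - (indicator (cball 0 R) \<xi> * sin (w \<bullet> \<xi>)))"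
    by (subst integral_distr) (auto simp: indicator_def intro!: Bochner_Integration.integral_cong)
  also have "\<dots> = - (LINT \<xi>|lborel. indicator (cball 0 R) \<xi> * sin (w \<bullet> \<xi>))" by simp
  finally show ?thesis by simp
qed

text \<open>Fubini for the scalar function \<open>\<phi> \<circ> F\<close>.  A real-linear \<open>\<phi>\<close> splits
  \<open>\<phi>(e^(i\<theta>) v)\<close> into \<open>cos \<theta> \<phi>(v) + sin \<theta> \<phi>(i v)\<close>, and the sine part integrates to
  \<open>0\<close> over the ball by symmetry.\<close>

lemma fourier_partial_functional:
  fixes F :: "real^'n \<Rightarrow> 'a::complex_banach" and \<phi> :: "'a \<Rightarrow> real"
  assumes F: "continuous_on UNIV F" "banach_integrable lborel F"
    and \<phi>: "linear \<phi>" "\<And>v. \<bar>\<phi> v\<bar> \<le> norm v"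
  shows "\<phi> (fourier_partial R F x) = (LINT z|lborel. \<phi> (F (x + z)) * ball_kernel R z)"
proof -
  let ?E = "\<lambda>\<xi>. exp (\<i> * of_real (x \<bullet> \<xi>)) *\<^sub>C fourier F \<xi>"
  let ?B = "indicator (cball 0 R) :: real^'n \<Rightarrow> real"
  have contE: "continuous_on UNIV ?E"
    by (intro continuous_intros continuous_on_fourier F)
  define I where "I = (\<integral>\<^sup>+s. norm (F s) \<partial>lborel)"
  have I: "I < \<infinity>" unfolding I_def by (rule banach_integrable_norm_finite[OF F(2)])
  have normE: "ennreal (norm (?E \<xi>)) \<le> I" for \<xi>
  proof -
    have "norm (?E \<xi>) = norm (fourier F \<xi>)" by (simp add: norm_scaleC)
    also have "ennreal \<dots> \<le> (\<integral>\<^sup>+s. norm (exp (- \<i> * of_real (\<xi> \<bullet> s)) *\<^sub>C F s) \<partial>lborel)"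
      unfolding fourier_def by (intro norm_banach_integral_le banach_integrable_character_scaleC F)
    also have "\<dots> = I" by (simp add: norm_scaleC I_def)
    finally show ?thesis .
  qed
  have "banach_integrable lborel (\<lambda>\<xi>. ?B \<xi> *\<^sub>R ?E \<xi>)"
  proof (rule banach_integrable_continuous_on)
    show "continuous_on (cball 0 R) ?E" by (rule continuous_on_subset[OF contE]) simp
    have "(\<integral>\<^sup>+\<xi>\<in>cball 0 R. norm (?E \<xi>) \<partial>lborel) \<le> (\<integral>\<^sup>+\<xi>. I * indicator (cball 0 R) \<xi> \<partial>(lborel :: (real^'n) measure))"
      by (intro nn_integral_mono mult_right_mono normE) auto
    also have "\<dots> < \<infinity>" using I emeasure_lborel_cball_finite[of "0::real^'n" R]
      by (subst nn_integral_cmult_indicator) (auto simp: ennreal_mult_less_top)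
    finally show "(\<integral>\<^sup>+\<xi>\<in>cball 0 R. norm (?E \<xi>) \<partial>lborel) < \<infinity>" .
  qed simp
  from banach_integral_functional(2)[OF this \<phi>(1), of 1] \<phi>(2)
  have 1: "\<phi> (fourier_partial R F x) = (LINT \<xi>|lborel. ?B \<xi> * \<phi> (?E \<xi>)) / (2 * pi) ^ CARD('n)"
    by (simp add: fourier_partial_def linear_scale[OF \<phi>(1)])
  define a where "a s = \<phi> (F s)" for s
  define b where "b s = \<phi> (\<i> *\<^sub>C F s)" for s
  let ?h = "\<lambda>\<xi> s. ?B \<xi> * (cos ((x - s) \<bullet> \<xi>) * a s + sin ((x - s) \<bullet> \<xi>) * b s)"
  have 2: "?B \<xi> * \<phi> (?E \<xi>) = (LINT s|lborel. ?h \<xi> s)" for \<xi>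
  proof -
    let ?c = "exp (\<i> * of_real (x \<bullet> \<xi>)) :: complex"
    have lin: "linear (\<lambda>v. \<phi> (?c *\<^sub>C v))" using linear_compose[OF linear_scaleC \<phi>(1)] by (simp add: o_def)
    have le: "\<bar>\<phi> (?c *\<^sub>C v)\<bar> \<le> 1 * norm v" for v using \<phi>(2)[of "?c *\<^sub>C v"] by (simp add: norm_scaleC)
    have "\<phi> (?E \<xi>) = (LINT s|lborel. \<phi> (?c *\<^sub>C exp (- \<i> * of_real (\<xi> \<bullet> s)) *\<^sub>C F s))"
      unfolding fourier_def
      by (rule banach_integral_functional(2)[OF banach_integrable_character_scaleC[OF F] lin le])
    also have "\<dots> = (LINT s|lborel. cos ((x - s) \<bullet> \<xi>) * a s + sin ((x - s) \<bullet> \<xi>) * b s)"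
    proof (rule Bochner_Integration.integral_cong[OF refl])
      fix s
      have "?c * exp (- \<i> * of_real (\<xi> \<bullet> s)) = cis ((x - s) \<bullet> \<xi>)"
        by (simp add: cis_conv_exp inner_diff_left inner_commute[of \<xi>] algebra_simps flip: exp_add)
      also have "\<dots> = of_real (cos ((x - s) \<bullet> \<xi>)) + of_real (sin ((x - s) \<bullet> \<xi>)) * \<i>"
        by (simp add: complex_eq_iff)
      finally have "?c *\<^sub>C exp (- \<i> * of_real (\<xi> \<bullet> s)) *\<^sub>C F s =
          cos ((x - s) \<bullet> \<xi>) *\<^sub>R F s + sin ((x - s) \<bullet> \<xi>) *\<^sub>R (\<i> *\<^sub>C F s)"
        by (simp add: scaleC_scaleC scaleC_add_left scaleC_of_real[symmetric])
      then show "\<phi> (?c *\<^sub>C exp (- \<i> * of_real (\<xi> \<bullet> s)) *\<^sub>C F s) = cos ((x - s) \<bullet> \<xi>) * a s + sin ((x - s) \<bullet> \<xi>) * b s"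
        by (simp add: a_def b_def linear_add[OF \<phi>(1)] linear_scale[OF \<phi>(1)])
    qed
    finally show ?thesis by simp
  qed
  have a_int: "integrable lborel a"
    unfolding a_def using banach_integral_functional(1)[OF F(2) \<phi>(1), of 1] \<phi>(2) by simp
  have b_int: "integrable lborel b"
  proof -
    have "linear (\<lambda>v. \<phi> (\<i> *\<^sub>C v))" using linear_compose[OF linear_scaleC \<phi>(1)] by (simp add: o_def)
    moreover have "\<bar>\<phi> (\<i> *\<^sub>C v)\<bar> \<le> 1 * norm v" for v using \<phi>(2)[of "\<i> *\<^sub>C v"] by (simp add: norm_scaleC)
    ultimately show ?thesis unfolding b_def by (rule banach_integral_functional(1)[OF F(2)])
  qed
  note [measurable] = borel_measurable_integrable[OF a_int] borel_measurable_integrable[OF b_int]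
  have h_int: "integrable (lborel \<Otimes>\<^sub>M lborel) (\<lambda>(\<xi>, s). ?h \<xi> s)"
  proof (rule integrableI_bounded)
    have ab: "(\<integral>\<^sup>+s. ennreal (\<bar>a s\<bar> + \<bar>b s\<bar>) \<partial>lborel) < \<infinity>"
    proof -
      have "integrable lborel (\<lambda>s. \<bar>a s\<bar> + \<bar>b s\<bar>)" using a_int b_int by auto
      then show ?thesis by (subst (asm) integrable_iff_bounded) simp
    qed
    have "(\<integral>\<^sup>+p. ennreal (norm (case p of (\<xi>, s) \<Rightarrow> ?h \<xi> s)) \<partial>(lborel \<Otimes>\<^sub>M lborel)) =
       (\<integral>\<^sup>+\<xi>. \<integral>\<^sup>+s. ennreal (norm (?h \<xi> s)) \<partial>lborel \<partial>lborel)"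
      by (subst lborel.nn_integral_fst[symmetric]) (auto simp: case_prod_unfold)
    also have "\<dots> \<le> (\<integral>\<^sup>+\<xi>. \<integral>\<^sup>+s. indicator (cball 0 R) \<xi> * ennreal (\<bar>a s\<bar> + \<bar>b s\<bar>) \<partial>lborel \<partial>(lborel :: (real^'n) measure))"
    proof (intro nn_integral_mono)
      fix \<xi> s :: "real^'n"
      have "\<bar>cos ((x - s) \<bullet> \<xi>) * a s\<bar> \<le> 1 * \<bar>a s\<bar>" "\<bar>sin ((x - s) \<bullet> \<xi>) * b s\<bar> \<le> 1 * \<bar>b s\<bar>"
        unfolding abs_mult by (intro mult_right_mono; simp)+
      then have "\<bar>cos ((x - s) \<bullet> \<xi>) * a s + sin ((x - s) \<bullet> \<xi>) * b s\<bar> \<le> \<bar>a s\<bar> + \<bar>b s\<bar>" by linarith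
      then show "ennreal (norm (?h \<xi> s)) \<le> indicator (cball 0 R) \<xi> * ennreal (\<bar>a s\<bar> + \<bar>b s\<bar>)"
        by (cases "\<xi> \<in> cball 0 R") (auto intro!: ennreal_leI simp del: ennreal_plus)
    qed
    also have "\<dots> = (\<integral>\<^sup>+\<xi>. (\<integral>\<^sup>+s. ennreal (\<bar>a s\<bar> + \<bar>b s\<bar>) \<partial>lborel) * indicator (cball 0 R) \<xi> \<partial>(lborel :: (real^'n) measure))"
      by (intro nn_integral_cong, subst nn_integral_cmult) (measurable, rule mult.commute)
    also have "\<dots> < \<infinity>" using ab emeasure_lborel_cball_finite[of "0::real^'n" R]
      by (subst nn_integral_cmult_indicator) (auto simp: ennreal_mult_less_top)
    finally show "(\<integral>\<^sup>+p. ennreal (norm (case p of (\<xi>, s) \<Rightarrow> ?h \<xi> s)) \<partial>(lborel \<Otimes>\<^sub>M lborel)) < \<infinity>" .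
  qed measurable
  have cont_int: "integrable lborel (\<lambda>\<xi>. ?B \<xi> * q \<xi>)" if "continuous_on UNIV q" for q :: "real^'n \<Rightarrow> real"
    using borel_integrable_compact[OF compact_cball continuous_on_subset[OF that subset_UNIV], of 0 R] by simp
  have trig_int: "integrable lborel (\<lambda>\<xi>. ?B \<xi> * cos (w \<bullet> \<xi>))" "integrable lborel (\<lambda>\<xi>. ?B \<xi> * sin (w \<bullet> \<xi>))" for w :: "real^'n"
    by (intro cont_int continuous_intros)+
  have "(LINT \<xi>|lborel. ?B \<xi> * \<phi> (?E \<xi>)) = (LINT \<xi>|lborel. LINT s|lborel. ?h \<xi> s)"
    by (simp only: 2)
  also have "\<dots> = (LINT s|lborel. LINT \<xi>|lborel. ?h \<xi> s)"
    by (rule lborel_pair.Fubini_integral[OF h_int, symmetric])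
  also have "\<dots> = (LINT s|lborel. a s * (ball_kernel R (x - s) * (2 * pi) ^ CARD('n)))"
  proof (rule Bochner_Integration.integral_cong[OF refl])
    fix s
    have "(LINT \<xi>|lborel. ?h \<xi> s) = (LINT \<xi>|lborel. a s * (?B \<xi> * cos ((x - s) \<bullet> \<xi>)) + b s * (?B \<xi> * sin ((x - s) \<bullet> \<xi>)))"
      by (intro Bochner_Integration.integral_cong) (auto simp: algebra_simps)
    also have "\<dots> = a s * (LINT \<xi>|lborel. ?B \<xi> * cos ((x - s) \<bullet> \<xi>)) + b s * (LINT \<xi>|lborel. ?B \<xi> * sin ((x - s) \<bullet> \<xi>))"
      using trig_int[of "x - s"] by (subst Bochner_Integration.integral_add) auto
    finally show "(LINT \<xi>|lborel. ?h \<xi> s) = a s * (ball_kernel R (x - s) * (2 * pi) ^ CARD('n))"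
      by (simp add: LINT_ball_sin ball_kernel_def)
  qed
  also have "\<dots> = (LINT s|lborel. a s * ball_kernel R (x - s)) * (2 * pi) ^ CARD('n)"
    unfolding mult.assoc[symmetric] by (rule integral_mult_left_zero)
  also have "(LINT s|lborel. a s * ball_kernel R (x - s)) = (LINT s|distr lborel borel ((+) x). a s * ball_kernel R (x - s))"
    by (simp add: lborel_distr_plus)
  also have "\<dots> = (LINT z|lborel. a (x + z) * ball_kernel R z)"
  proof (subst integral_distr)
    have "ball_kernel R (- z) = ball_kernel R z" for z :: "real^'n" by (simp add: ball_kernel_def)
    then show "(LINT z|lborel. a (x + z) * ball_kernel R (x - (x + z))) = (LINT z|lborel. a (x + z) * ball_kernel R z)"
      by simp
    have [measurable]: "(ball_kernel R :: real^'n \<Rightarrow> real) \<in> borel_measurable borel"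
      unfolding ball_kernel_def by measurable
    show "(\<lambda>s. a s * ball_kernel R (x - s)) \<in> borel_measurable borel" by measurable
  qed simp
  finally have 3: "(LINT \<xi>|lborel. ?B \<xi> * \<phi> (?E \<xi>)) = (LINT z|lborel. a (x + z) * ball_kernel R z) * (2 * pi) ^ CARD('n)" .
  show ?thesis unfolding 1 3 a_def by simp
qed

section \<open>Uniform convergence\<close>

text \<open>The supremum is a lower semicontinuous function of \<open>z\<close>, hence Borel measurable.  This
  makes it a better majorant than the given \<open>g\<close>, which is only Lebesgue measurable and whose composition with
  polar coordinates would need care on null sets.\<close>

definition deriv_sup :: "nat \<Rightarrow> (real^'n) set \<Rightarrow> (real^'n \<Rightarrow> 'a::real_normed_vector) \<Rightarrow> real^'n \<Rightarrow> ennreal" where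
  "deriv_sup k K F z = (SUP \<alpha>\<in>{\<alpha>. sum \<alpha> UNIV \<le> k}. SUP x\<in>K. ennreal (norm (nabla \<alpha> F (x + z))))"

lemma finite_multi_indices: "finite {\<alpha> :: 'n::finite \<Rightarrow> nat. sum \<alpha> UNIV \<le> k}"
proof (rule finite_subset)
  show "{\<alpha> :: 'n \<Rightarrow> nat. sum \<alpha> UNIV \<le> k} \<subseteq> {\<alpha>. \<forall>i. \<alpha> i \<in> {..k}}"
  proof safe
    fix \<alpha> :: "'n \<Rightarrow> nat" and i assume "sum \<alpha> UNIV \<le> k"
    moreover have "\<alpha> i \<le> sum \<alpha> UNIV" by (rule member_le_sum) auto
    ultimately show "\<alpha> i \<le> k" by linarith
  qed
  show "finite {\<alpha> :: 'n \<Rightarrow> nat. \<forall>i. \<alpha> i \<in> {..k}}"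
    using finite_set_of_finite_funs[OF finite[of "UNIV :: 'n set"] finite_atMost[of k], of 0] by simp
qed

lemma borel_measurable_deriv_sup:
  fixes F :: "real^'n \<Rightarrow> 'a::real_normed_vector"
  assumes F: "C_k k F"
  shows "deriv_sup k K F \<in> borel_measurable borel"
proof (rule borel_measurableI_greater)
  fix c :: ennreal
  have "{z \<in> space borel. c < deriv_sup k K F z} =
      (\<Union>\<alpha>\<in>{\<alpha>. sum \<alpha> UNIV \<le> k}. \<Union>x\<in>K. {z. c < ennreal (norm (nabla \<alpha> F (x + z)))})"
    by (auto simp: deriv_sup_def less_SUP_iff)
  moreover have "open \<dots>"
  proof (intro open_UN ballI)
    fix \<alpha> :: "'n \<Rightarrow> nat" and x assume "\<alpha> \<in> {\<alpha>. sum \<alpha> UNIV \<le> k}"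
    then have "continuous_on UNIV (\<lambda>z. ennreal (norm (nabla \<alpha> F (x + z))))"
      by (intro continuous_on_ennreal continuous_on_norm
          continuous_on_compose2[OF continuous_nabla[OF F]] continuous_intros) auto
    then show "open {z. c < ennreal (norm (nabla \<alpha> F (x + z)))}"
      by (intro open_Collect_less continuous_on_const)
  qed
  ultimately show "{z \<in> space borel. c < deriv_sup k K F z} \<in> sets borel" by simp
qed

lemma deriv_sup_bounded:
  fixes F :: "real^'n \<Rightarrow> 'a::real_normed_vector"
  assumes F: "C_k k F" and K: "compact K"
  shows "\<exists>C. \<forall>z. norm z \<le> r \<longrightarrow> deriv_sup k K F z \<le> ennreal C"
proof -
  have "\<exists>C. \<forall>x\<in>K. \<forall>z\<in>cball 0 r. norm (nabla \<alpha> F (x + z)) \<le> C" if "sum \<alpha> UNIV \<le> k" for \<alpha> :: "'n \<Rightarrow> nat"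
  proof -
    have "compact ((\<lambda>(x, z). nabla \<alpha> F (x + z)) ` (K \<times> cball 0 r))"
      unfolding case_prod_unfold
      by (intro compact_continuous_image compact_Times K compact_cball
          continuous_on_compose2[OF continuous_nabla[OF F that]] continuous_intros) auto
    then have "bounded ((\<lambda>(x, z). nabla \<alpha> F (x + z)) ` (K \<times> cball 0 r))" by (rule compact_imp_bounded)
    then show ?thesis unfolding bounded_iff by fastforce
  qed
  then have "\<forall>\<alpha>. \<exists>C. sum \<alpha> UNIV \<le> k \<longrightarrow> (\<forall>x\<in>K. \<forall>z\<in>cball 0 r. norm (nabla \<alpha> F (x + z)) \<le> C)" by blast
  then obtain C where C: "\<And>\<alpha> x z. sum \<alpha> UNIV \<le> k \<Longrightarrow> x \<in> K \<Longrightarrow> z \<in> cball 0 r \<Longrightarrow> norm (nabla \<alpha> F (x + z)) \<le> C \<alpha>"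
    by metis
  let ?A = "{\<alpha> :: 'n \<Rightarrow> nat. sum \<alpha> UNIV \<le> k}"
  have "deriv_sup k K F z \<le> ennreal (\<Sum>\<alpha>\<in>?A. \<bar>C \<alpha>\<bar>)" if "norm z \<le> r" for z
    unfolding deriv_sup_def
  proof (intro SUP_least ennreal_leI)
    fix \<alpha> :: "'n \<Rightarrow> nat" and x assume \<alpha>: "\<alpha> \<in> ?A" and x: "x \<in> K"
    have "norm (nabla \<alpha> F (x + z)) \<le> \<bar>C \<alpha>\<bar>" using C[of \<alpha> x z] \<alpha> x that by auto
    also have "\<dots> \<le> (\<Sum>\<alpha>\<in>?A. \<bar>C \<alpha>\<bar>)"
      by (rule member_le_sum[OF \<alpha>]) (auto simp: finite_multi_indices)
    finally show "norm (nabla \<alpha> F (x + z)) \<le> (\<Sum>\<alpha>\<in>?A. \<bar>C \<alpha>\<bar>)" .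
  qed
  then show ?thesis by blast
qed

lemma foldr_partial_functional_le:
  fixes F :: "real^'n \<Rightarrow> 'a::real_normed_vector" and \<phi> :: "'a \<Rightarrow> real"
  assumes F: "C_k k F" and \<phi>: "linear \<phi>" "\<And>v. \<bar>\<phi> v\<bar> \<le> norm v"
    and x: "x \<in> K" and len: "length is \<le> k"
  shows "ennreal \<bar>foldr partial is (\<lambda>y. \<phi> (F y)) (x + z)\<bar> \<le> deriv_sup k K F z"
proof -
  have bl: "bounded_linear \<phi>"
    using \<phi> by (intro bounded_linear_functional[of _ 1]) auto
  have \<alpha>: "sum (count_list is) UNIV = length is" by (simp add: sum_count_set)
  have Cf: "C_k (length is) (\<lambda>y. \<phi> (F y))"
    using C_k_bounded_linear[OF bl F] len by (rule C_k_mono)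
  have "foldr partial is (\<lambda>y. \<phi> (F y)) (x + z) = \<phi> (nabla (count_list is) F (x + z))"
    unfolding foldr_partial_eq_nabla[OF Cf]
    using nabla_bounded_linear[OF bl, of "count_list is" F] C_k_mono[OF F len] \<alpha> by simp
  then have "ennreal \<bar>foldr partial is (\<lambda>y. \<phi> (F y)) (x + z)\<bar> \<le> ennreal (norm (nabla (count_list is) F (x + z)))"
    using \<phi>(2) by (simp add: ennreal_leI)
  also have "\<dots> \<le> deriv_sup k K F z"
    unfolding deriv_sup_def using \<alpha> len x by (intro SUP_upper2[of "count_list is"] SUP_upper) auto
  finally show ?thesis .
qed

theorem proposition2p13:
  fixes F :: "real^'n \<Rightarrow> 'a::complex_banach"
    and K :: "(real^'n) set"
    and k :: nat
  assumes "k \<ge> 1"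
    and "CARD('n) = 2 * k"
    and "compact K"
    and "banach_integrable lborel F"
    and "C_k k F"
    and "\<exists>(g :: real^'n \<Rightarrow> real) (\<delta> :: real).
           integrable lebesgue g \<and> \<delta> > 0 \<and>
           (\<forall>y. norm y \<ge> \<delta> \<longrightarrow>
             (SUP \<alpha>\<in>{\<alpha> :: 'n \<Rightarrow> nat. sum \<alpha> UNIV \<le> k}. SUP x\<in>K.
                ereal (norm y powi (- int CARD('n) + int k) * norm (nabla \<alpha> F (x + y))))
             \<le> ereal (g y))"
  shows "uniform_limit K (\<lambda>R x. fourier_partial R F x) F at_top"
proof -
  obtain g :: "real^'n \<Rightarrow> real" and \<delta>0 where g: "integrable lebesgue g" "\<delta>0 > 0"
    and far: "\<And>y. norm y \<ge> \<delta>0 \<Longrightarrow> (SUP \<alpha>\<in>{\<alpha> :: 'n \<Rightarrow> nat. sum \<alpha> UNIV \<le> k}. SUP x\<in>K.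
                ereal (norm y powi (- int CARD('n) + int k) * norm (nabla \<alpha> F (x + y)))) \<le> ereal (g y)"
    using assms(6) by blast
  note F = C_k_continuous[OF assms(5)] assms(4)
  \<comment> \<open>Enlarging the radius to at least one is harmless and makes \<open>1 + t \<le> 2 t\<close> beyond it.\<close>
  define \<delta> where "\<delta> = max \<delta>0 1"
  let ?H = "deriv_sup k K F"
  define G where "G z = enn2real (?H z)" for z
  \<comment> \<open>Here the exponent \<open>k - n\<close> is \<open>- k\<close>.\<close>
  have H_far: "?H y \<le> ennreal (\<bar>g y\<bar> * norm y ^ k)" if y: "norm y \<ge> \<delta>" for y
    unfolding deriv_sup_def
  proof (intro SUP_least ennreal_leI)
    fix \<alpha> :: "'n \<Rightarrow> nat" and x assume \<alpha>: "\<alpha> \<in> {\<alpha>. sum \<alpha> UNIV \<le> k}" and x: "x \<in> K"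
    have ny: "norm y > 0" "norm y \<ge> \<delta>0" using y by (auto simp: \<delta>_def)
    have "ereal (norm y powi (- int CARD('n) + int k) * norm (nabla \<alpha> F (x + y))) \<le>
      (SUP \<alpha>\<in>{\<alpha> :: 'n \<Rightarrow> nat. sum \<alpha> UNIV \<le> k}. SUP x\<in>K.
                ereal (norm y powi (- int CARD('n) + int k) * norm (nabla \<alpha> F (x + y))))"
      using \<alpha> x by (intro SUP_upper2[of \<alpha>] SUP_upper) auto
    also have "\<dots> \<le> ereal (g y)" by (rule far[OF ny(2)])
    finally have "norm y powi (- int CARD('n) + int k) * norm (nabla \<alpha> F (x + y)) \<le> g y" by simp
    moreover have "norm y powi (- int CARD('n) + int k) = inverse (norm y ^ k)"
    proof -
      have "- int CARD('n) + int k = - int k" using assms(2) by simp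
      then show ?thesis by (simp only: power_int_minus power_int_of_nat)
    qed
    ultimately have "inverse (norm y ^ k) * norm (nabla \<alpha> F (x + y)) \<le> g y" by simp
    then have "norm y ^ k * (inverse (norm y ^ k) * norm (nabla \<alpha> F (x + y))) \<le> norm y ^ k * \<bar>g y\<bar>"
      by (intro mult_left_mono) auto
    moreover have "norm y ^ k * (inverse (norm y ^ k) * norm (nabla \<alpha> F (x + y))) = norm (nabla \<alpha> F (x + y))"
      unfolding mult.assoc[symmetric] using ny by simp
    ultimately show "norm (nabla \<alpha> F (x + y)) \<le> \<bar>g y\<bar> * norm y ^ k"
      by (simp only: mult.commute)
  qed
  obtain G0 where G0: "\<And>z. norm z \<le> \<delta> \<Longrightarrow> ?H z \<le> ennreal G0"
    using deriv_sup_bounded[OF assms(5,3), of \<delta>] by blast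
  have H_fin: "?H z < \<infinity>" for z
  proof (cases "norm z \<le> \<delta>")
    case True
    show ?thesis using le_less_trans[OF G0[OF True] ennreal_less_top] by simp
  next
    case False
    then show ?thesis using le_less_trans[OF H_far[of z] ennreal_less_top] by simp
  qed
  then have HG: "?H z = ennreal (G z)" for z by (simp add: G_def)
  interpret ray_majorant k G \<delta> "\<bar>G0\<bar>"
  proof
    show "G \<in> borel_measurable borel"
      unfolding G_def using borel_measurable_deriv_sup[OF assms(5)] by measurable
    show "G z \<le> \<bar>G0\<bar>" if "norm z \<le> \<delta>" for z
    proof -
      have "ennreal (G z) \<le> ennreal \<bar>G0\<bar>"
        using G0[OF that] unfolding HG by (rule order.trans) (simp add: ennreal_leI)
      then show ?thesis by simp
    qed
    have "(\<integral>\<^sup>+z. ennreal (indicator {\<delta>..} (norm z) * (G z / norm z ^ k)) \<partial>lborel) =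
       (\<integral>\<^sup>+z. ennreal (indicator {\<delta>..} (norm z) * (G z / norm z ^ k)) \<partial>lebesgue)"
      by (simp add: nn_integral_completion)
    also have "\<dots> \<le> (\<integral>\<^sup>+z. ennreal (norm (g z)) \<partial>lebesgue)"
    proof (intro nn_integral_mono ennreal_leI)
      fix z :: "real^'n"
      show "indicator {\<delta>..} (norm z) * (G z / norm z ^ k) \<le> norm (g z)"
      proof (cases "\<delta> \<le> norm z")
        case True
        then have "norm z > 0" by (auto simp: \<delta>_def)
        moreover have "G z \<le> \<bar>g z\<bar> * norm z ^ k" using H_far[OF True] unfolding HG by (simp add: ennreal_le_iff)
        ultimately show ?thesis using True by (simp add: divide_le_eq)
      qed simp
    qed
    also have "\<dots> < \<infinity>" using g(1) by (simp add: integrable_iff_bounded)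
    finally show "(\<integral>\<^sup>+z. ennreal (indicator {\<delta>..} (norm z) * (G z / norm z ^ k)) \<partial>lborel) < \<infinity>" .
  qed (use assms(1,2) in \<open>auto simp: G_def \<delta>_def\<close>)
  define M where "M = unit_ball_vol (real (2 * k - 1)) * odd_fact k / (2 * pi) ^ (2 * k) *
      (real CARD('n) * (radial_const k 0 + 1) * real CARD('n) ^ k)"
  have error: "ennreal (dist (fourier_partial R F x) (F x)) \<le> ennreal M * bessel_error R"
    if R: "R > 0" and x: "x \<in> K" for R x
  proof -
    let ?v = "fourier_partial R F x - F x"
    obtain \<phi> where \<phi>: "linear \<phi>" "\<And>x. \<bar>\<phi> x\<bar> \<le> norm x" "\<phi> ?v = norm ?v"
      using norming_functional[of ?v] by blast
    have bl: "bounded_linear \<phi>"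
      using \<phi> by (intro bounded_linear_functional[of _ 1]) auto
    have "norm ?v = (LINT z|lborel. \<phi> (F (x + z)) * ball_kernel R z) - \<phi> (F x)"
      using \<phi>(3) fourier_partial_functional[OF F \<phi>(1,2)] by (simp add: linear_diff[OF \<phi>(1)])
    then have "ennreal (dist (fourier_partial R F x) (F x)) \<le>
        ennreal \<bar>(LINT z|lborel. \<phi> (F (x + z)) * ball_kernel R z) - \<phi> (F x)\<bar>"
      by (simp add: dist_norm)
    also have "\<dots> \<le> ennreal M * bessel_error R"
      unfolding M_def
    proof (rule ball_kernel_error[OF _ _ R])
      show "C_k k (\<lambda>y. \<phi> (F y))" by (rule C_k_bounded_linear[OF bl assms(5)])
      show "\<bar>foldr partial is (\<lambda>y. \<phi> (F y)) (x + z)\<bar> \<le> G z" if "length is \<le> k" for "is" z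
        using foldr_partial_functional_le[OF assms(5) \<phi>(1,2) x that, of z] G_nonneg[of z]
        unfolding HG by (simp add: ennreal_le_iff)
      have int: "integrable lborel (\<lambda>z. \<phi> (F z))"
        using banach_integral_functional(1)[OF assms(4) \<phi>(1), of 1] \<phi>(2) by simp
      have plus: "(+) x \<in> measurable lborel borel" by simp
      have "integrable (distr lborel borel ((+) x)) (\<lambda>z. \<phi> (F z))"
        using int by (simp only: lborel_distr_plus)
      from integrable_distr[OF plus this] show "integrable lborel (\<lambda>z. \<phi> (F (x + z)))" .
    qed
    finally show ?thesis .
  qed
  show ?thesis
  proof (rule uniform_limitI)
    fix e :: real assume e: "e > 0"
    have "((\<lambda>R. ennreal M * bessel_error R) \<longlongrightarrow> ennreal M * 0) at_top"
      by (intro ennreal_tendsto_cmult bessel_error_tendsto_0) simp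
    then have "\<forall>\<^sub>F R in at_top. ennreal M * bessel_error R < ennreal e"
      using e by (intro order_tendstoD(2)) auto
    then show "\<forall>\<^sub>F R in at_top. \<forall>x\<in>K. dist (fourier_partial R F x) (F x) < e"
      using eventually_gt_at_top[of 0]
    proof eventually_elim
      case (elim R)
      show ?case
      proof
        fix x assume "x \<in> K"
        from le_less_trans[OF error[OF elim(2) this] elim(1)]
        show "dist (fourier_partial R F x) (F x) < e" by (simp add: ennreal_less_iff)
      qed
    qed
  qed
qed

end
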